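(* $\mathsf{Equiv}$ is a set-complete lattice, i.e.\ infima and suprema of subsets of $\mathsf{Equiv}$ exist. Moreover, these infima and suprema coincide with those of $\mathsf{Log}$.
   Context: A logic $\vdash$ is a substitution-invariant consequence relation on the set of formulas, in some infinite cardinal of variables, of a language without constants. $\mathrm{Mod}^{\equiv}(\vdash)$ is the class of matrices $\langle \mathbf{A}, F\rangle$ such that $F$ is a deductive filter of $\vdash$ on $\mathbf{A}$ and the Suszko congruence of $F$ relative to $\vdash$ is the identity. An interpretation of $\vdash$ into $\vdash'$ is a translation $\tau$ of languages such that $\langle \mathbf{A}^{\tau}, F\rangle \in \mathrm{Mod}^{\equiv}(\vdash)$ for all $\langle \mathbf{A}, F\rangle \in \mathrm{Mod}^{\equiv}(\vdash')$; $[\vdash]$ is the class of logics equi-interpretable with $\vdash$ and $\mathsf{Log}$ the poset of these classes ordered by interpretability. A logic $\vdash$ is equivalential if there is a non-empty set of formulas $\Delta(x,y)$ such that for every model $\langle \mathbf{A},F\rangle$ of $\vdash$ and $a,b\in A$, $\langle a,b\rangle$ belongs to the Leibniz congruence of $F$ (the largest congruence of $\mathbf{A}$ compatible with $F$) iff $\Delta^{\mathbf{A}}(a,b)\subseteq F$. $\mathsf{Equiv}$ is the subposet of $\mathsf{Log}$ consisting of the classes $[\vdash]$ with $\vdash$ equivalential.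
   Formalization: Suprema are claimed only for non-empty subsets of Equiv: the supremum of the empty set would be a minimum of Equiv, and none exists. Infima are claimed for all subsets, the empty one included. Sets and classes are read relative to an arbitrary inaccessible universe. *)

theory Defs
  imports "HOL-Algebra.Lattice" "HOL-Library.Equipollence"
begin

text \<open>
  The objects called \<open>Log\<close> and \<open>Equiv\<close> are proper classes, and interpretability quantifies over
  all matrices. Everything is therefore relativised to a Grothendieck universe, represented
  by a type \<open>'u\<close> whose cardinality is strongly inaccessible: a collection is a \<open>set\<close> iff it is
  strictly smaller than \<open>'u\<close>, and up to isomorphism every set is a small subset of \<open>'u\<close>.
  The hypothesis \<open>inaccessible TYPE('u)\<close> holds e.g. for the type of sets of any axiomatic
  embedding of ZFC in HOL.
\<close>

definition inaccessible :: "'u itself \<Rightarrow> bool" where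
  "inaccessible _ \<longleftrightarrow>
     (UNIV :: nat set) \<prec> (UNIV :: 'u set) \<and>
     (\<forall>A :: 'u set. A \<prec> (UNIV :: 'u set) \<longrightarrow> Pow A \<prec> (UNIV :: 'u set)) \<and>
     (\<forall>(A :: 'u set) (B :: 'u \<Rightarrow> 'u set).
        A \<prec> (UNIV :: 'u set) \<and> (\<forall>a\<in>A. B a \<prec> (UNIV :: 'u set)) \<longrightarrow>
        (\<Union>a\<in>A. B a) \<prec> (UNIV :: 'u set))"


section \<open>Languages, formulas, algebras\<close>

text \<open>A language is a partial map sending each of its symbols to its arity.\<close>

type_synonym 'f language = "'f \<rightharpoonup> nat"

datatype ('f, 'v) trm = Var 'v | App 'f "('f, 'v) trm list"

inductive_set Fm :: "'f language \<Rightarrow> 'v set \<Rightarrow> ('f, 'v) trm set"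
  for L :: "'f language" and V :: "'v set" where
  Var: "x \<in> V \<Longrightarrow> Var x \<in> Fm L V"
| App: "L f = Some (length ts) \<Longrightarrow> ts \<in> lists (Fm L V) \<Longrightarrow> App f ts \<in> Fm L V"

fun subst :: "('v \<Rightarrow> ('f, 'w) trm) \<Rightarrow> ('f, 'v) trm \<Rightarrow> ('f, 'w) trm" where
  "subst \<sigma> (Var x) = \<sigma> x"
| "subst \<sigma> (App f ts) = App f (map (subst \<sigma>) ts)"

text \<open>Only the values of \<open>oper\<close> on symbols of the language and argument lists of the right
  length over the carrier are meaningful.\<close>

record ('f, 'a) alg = "'a partial_object" +
  oper :: "'f \<Rightarrow> 'a list \<Rightarrow> 'a"

definition is_alg :: "'f language \<Rightarrow> ('f, 'a) alg \<Rightarrow> bool" where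
  "is_alg L A \<longleftrightarrow> carrier A \<noteq> {} \<and>
     (\<forall>f as. L f = Some (length as) \<and> as \<in> lists (carrier A) \<longrightarrow> oper A f as \<in> carrier A)"

fun eval :: "('f, 'a) alg \<Rightarrow> ('v \<Rightarrow> 'a) \<Rightarrow> ('f, 'v) trm \<Rightarrow> 'a" where
  "eval A h (Var x) = h x"
| "eval A h (App f ts) = oper A f (map (eval A h) ts)"


section \<open>Logics\<close>

record ('f, 'v) logic =
  lang :: "'f language"
  vars :: "'v set"
  entails :: "('f, 'v) trm set \<Rightarrow> ('f, 'v) trm \<Rightarrow> bool"

abbreviation formulas :: "('f, 'v) logic \<Rightarrow> ('f, 'v) trm set" where
  "formulas l \<equiv> Fm (lang l) (vars l)"

definition is_consequence :: "('f, 'v) logic \<Rightarrow> bool" where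
  "is_consequence l \<longleftrightarrow>
     (\<forall>\<Gamma> \<phi>. entails l \<Gamma> \<phi> \<longrightarrow> \<Gamma> \<subseteq> formulas l \<and> \<phi> \<in> formulas l) \<and>
     (\<forall>\<Gamma> \<phi>. \<Gamma> \<subseteq> formulas l \<and> \<phi> \<in> \<Gamma> \<longrightarrow> entails l \<Gamma> \<phi>) \<and>
     (\<forall>\<Gamma> \<Delta> \<phi>. \<Gamma> \<subseteq> formulas l \<and> (\<forall>\<psi>\<in>\<Delta>. entails l \<Gamma> \<psi>) \<and> entails l \<Delta> \<phi> \<longrightarrow> entails l \<Gamma> \<phi>)"

definition substitution_invariant :: "('f, 'v) logic \<Rightarrow> bool" where
  "substitution_invariant l \<longleftrightarrow>
     (\<forall>\<sigma> \<Gamma> \<phi>. \<sigma> ` vars l \<subseteq> formulas l \<and> entails l \<Gamma> \<phi> \<longrightarrow> entails l (subst \<sigma> ` \<Gamma>) (subst \<sigma> \<phi>))"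

text \<open>The variables form an arbitrary infinite small subset of the universe, so that every
  infinite cardinal of the universe occurs as a cardinal of variables.\<close>

definition is_logic :: "('u, 'u) logic \<Rightarrow> bool" where
  "is_logic l \<longleftrightarrow>
     dom (lang l) \<prec> (UNIV :: 'u set) \<and> 0 \<notin> ran (lang l) \<and>
     vars l \<prec> (UNIV :: 'u set) \<and> infinite (vars l) \<and>
     is_consequence l \<and> substitution_invariant l"


section \<open>Matrices, Leibniz and Suszko congruences\<close>

definition deductive_filter :: "('f, 'v) logic \<Rightarrow> ('f, 'a) alg \<Rightarrow> 'a set \<Rightarrow> bool" where
  "deductive_filter l A F \<longleftrightarrow> F \<subseteq> carrier A \<and>
     (\<forall>\<Gamma> \<phi> h. entails l \<Gamma> \<phi> \<and> h ` vars l \<subseteq> carrier A \<and> eval A h ` \<Gamma> \<subseteq> F \<longrightarrow> eval A h \<phi> \<in> F)"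

definition congruence :: "'f language \<Rightarrow> ('f, 'a) alg \<Rightarrow> ('a \<times> 'a) set \<Rightarrow> bool" where
  "congruence L A \<theta> \<longleftrightarrow> equiv (carrier A) \<theta> \<and>
     (\<forall>f as bs. L f = Some (length as) \<and> list_all2 (\<lambda>a b. (a, b) \<in> \<theta>) as bs \<longrightarrow>
        (oper A f as, oper A f bs) \<in> \<theta>)"

definition compatible :: "('a \<times> 'a) set \<Rightarrow> 'a set \<Rightarrow> bool" where
  "compatible \<theta> F \<longleftrightarrow> (\<forall>(a, b)\<in>\<theta>. a \<in> F \<longrightarrow> b \<in> F)"

definition Leibniz :: "'f language \<Rightarrow> ('f, 'a) alg \<Rightarrow> 'a set \<Rightarrow> ('a \<times> 'a) set" where
  "Leibniz L A F = (GREATEST \<theta>. congruence L A \<theta> \<and> compatible \<theta> F)"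

definition Suszko :: "('f, 'v) logic \<Rightarrow> ('f, 'a) alg \<Rightarrow> 'a set \<Rightarrow> ('a \<times> 'a) set" where
  "Suszko l A F = (\<Inter>G\<in>{G. deductive_filter l A G \<and> F \<subseteq> G}. Leibniz (lang l) A G)"

definition Mod :: "('u, 'u) logic \<Rightarrow> (('u, 'u) alg \<times> 'u set) set" where
  "Mod l = {(A, F). is_alg (lang l) A \<and> carrier A \<prec> (UNIV :: 'u set) \<and> deductive_filter l A F}"

definition Mod_equiv :: "('u, 'u) logic \<Rightarrow> (('u, 'u) alg \<times> 'u set) set" where
  "Mod_equiv l = {(A, F) \<in> Mod l. Suszko l A F = Id_on (carrier A)}"


section \<open>Interpretations and the posets\<close>

text \<open>An \<open>n\<close>-ary symbol is translated to a term in the variables \<open>0, \<dots>, n - 1\<close>.\<close>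

definition is_translation ::
  "('f \<Rightarrow> ('g, nat) trm) \<Rightarrow> 'f language \<Rightarrow> 'g language \<Rightarrow> bool" where
  "is_translation \<tau> L L' \<longleftrightarrow> (\<forall>f n. L f = Some n \<longrightarrow> \<tau> f \<in> Fm L' {..<n})"

definition reduct :: "('f \<Rightarrow> ('g, nat) trm) \<Rightarrow> ('g, 'a) alg \<Rightarrow> ('f, 'a) alg" where
  "reduct \<tau> A = \<lparr>carrier = carrier A, oper = (\<lambda>f as. eval A (\<lambda>i. as ! i) (\<tau> f))\<rparr>"

definition is_interpretation ::
  "('u \<Rightarrow> ('u, nat) trm) \<Rightarrow> ('u, 'u) logic \<Rightarrow> ('u, 'u) logic \<Rightarrow> bool" where
  "is_interpretation \<tau> l l' \<longleftrightarrow> is_translation \<tau> (lang l) (lang l') \<and>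
     (\<forall>(A, F)\<in>Mod_equiv l'. (reduct \<tau> A, F) \<in> Mod_equiv l)"

definition interpretable :: "('u, 'u) logic \<Rightarrow> ('u, 'u) logic \<Rightarrow> bool" where
  "interpretable l l' \<longleftrightarrow> (\<exists>\<tau>. is_interpretation \<tau> l l')"

definition equi_interpretable :: "(('u, 'u) logic \<times> ('u, 'u) logic) set" where
  "equi_interpretable =
     {(l, l'). is_logic l \<and> is_logic l' \<and> interpretable l l' \<and> interpretable l' l}"

text \<open>\<open>\<Delta>(x, y)\<close> is a set of formulas of the logic in two distinct variables \<open>x\<close>, \<open>y\<close>.\<close>

definition equivalential :: "('u, 'u) logic \<Rightarrow> bool" where
  "equivalential l \<longleftrightarrow>
     (\<exists>x y \<Delta>. x \<in> vars l \<and> y \<in> vars l \<and> x \<noteq> y \<and> \<Delta> \<noteq> {} \<and> \<Delta> \<subseteq> Fm (lang l) {x, y} \<and>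
       (\<forall>(A, F)\<in>Mod l. \<forall>a\<in>carrier A. \<forall>b\<in>carrier A.
          (a, b) \<in> Leibniz (lang l) A F \<longleftrightarrow> eval A (\<lambda>z. if z = x then a else b) ` \<Delta> \<subseteq> F))"

definition Log :: "('u, 'u) logic set gorder" where
  "Log = \<lparr>carrier = {l. is_logic l} // equi_interpretable, eq = (=),
     le = (\<lambda>C D. \<exists>l\<in>C. \<exists>l'\<in>D. interpretable l l')\<rparr>"

definition Equiv :: "('u, 'u) logic set gorder" where
  "Equiv = Log\<lparr>carrier := {l. is_logic l \<and> equivalential l} // equi_interpretable\<rparr>"

end

theory Submission
  imports Defs
begin

text \<open>
  For a family of equivalential logics with equivalence formulas \<open>\<Delta> i\<close>, the supremum is the logic,
  over the disjoint union of the languages, of all matrices whose reducts are reduced models of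
  the members. The infimum is the logic of all direct products of reduced models of the members,
  over the language whose \<open>n\<close>-ary symbols are families of \<open>n\<close>-ary terms. In both cases a set of
  formulas in two variables defines equality in the matrices that generate the logic. Hence every
  implication between equations and filter memberships that holds in the generating matrices
  becomes a set of rules of the logic, so it holds in all its reduced models, and the logic is
  equivalential.

  For the infimum, such implications about the symbols that read the \<open>i\<close>-th coordinate from
  their second argument and all others from their first show that every reduced model is a
  subdirect product of reduced models of the members. Since the reduced models of an arbitrary
  logic are closed under subdirect products, every logic that is interpretable in all members is
  interpretable in the infimum. Both constructions are optimal among all logics, which is why the
  bounds in \<open>Equiv\<close> and in \<open>Log\<close> coincide.
\<close>

section \<open>Small sets\<close>

text \<open>A reduced model of the sum or of the product is not given as one of the generating
  matrices, so every fact needed about it has to be cast as an implication that can be checked in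
  those matrices. Such an implication may need one premise per index, for instance when an element
  is recovered from its coordinates; this is harmless, since \<open>entails\<close> accepts
  arbitrary sets of premises.

  The second obstacle is the lack of constants. A coordinate that is to be ignored must still return
  a value, and only the arguments of the symbol are at hand. Arities are positive, so the first
  argument exists and is returned there; in a reduced model of the product a base point
  \<open>c\<close> is then fed in as that argument. The base point is taken from the filter, so that
  ignored coordinates never spoil a membership. It exists because the set of equivalence formulas is
  non-empty and each of them holds on the diagonal.

  About the logics that compete with a bound, nothing is known but closure of
  \<open>Mod_equiv\<close>, which for them rests on Suszko congruences. For the members of the
  family and for the bounds themselves, Suszko and Leibniz congruences agree.\<close>

abbreviation (input) small :: "'u itself \<Rightarrow> 'b set \<Rightarrow> bool" where
  "small U A \<equiv> A \<prec> (UNIV :: 'u set)"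

locale universe =
  fixes U :: "'u itself"
  assumes inac: "inaccessible U"
begin

lemma small_lepoll: "A \<lesssim> B \<Longrightarrow> small U B \<Longrightarrow> small U A"
  by (rule lesspoll_trans1)

lemma small_subset: "A \<subseteq> B \<Longrightarrow> small U B \<Longrightarrow> small U A"
  by (meson small_lepoll subset_imp_lepoll)

lemma small_image: "small U A \<Longrightarrow> small U (f ` A)"
  by (meson small_lepoll image_lepoll)

lemma small_nat: "small U (UNIV :: nat set)"
  using inac by (simp add: inaccessible_def)

lemma infinite_universe: "infinite (UNIV :: 'u set)"
  using small_nat infinite_le_lepoll lesspoll_imp_lepoll by blast

lemma small_finite: "finite A \<Longrightarrow> small U A"
  by (rule finite_lesspoll_infinite[OF infinite_universe])

text \<open>Inaccessibility speaks only of subsets of \<open>'u\<close>, so a small set of another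
  type is first moved into \<open>'u\<close> by an injection, and its power set is transported along
  the image map.\<close>

lemma small_Pow:
  assumes "small U A" shows "small U (Pow A)"
proof -
  obtain f :: "_ \<Rightarrow> 'u" where f: "inj_on f A"
    using lesspoll_imp_lepoll[OF assms] by (auto simp: lepoll_def)
  have "small U (f ` A)" using assms by (rule small_image)
  then have "small U (Pow (f ` A))" using inac by (simp add: inaccessible_def)
  moreover have "Pow A \<lesssim> Pow (f ` A)"
    unfolding lepoll_def using inj_on_image_Pow[OF f] by (intro exI[of _ "image f"]) auto
  ultimately show ?thesis using small_lepoll by blast
qed

lemma inaccessible_UN:
  fixes A :: "'u set" and B :: "'u \<Rightarrow> 'u set"
  assumes "small U A" "\<And>a. a \<in> A \<Longrightarrow> small U (B a)"
  shows "small U (\<Union>a\<in>A. B a)"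
  using inac[unfolded inaccessible_def, THEN conjunct2, THEN conjunct2, rule_format, of A B] assms
  by simp

lemma ex_pairing: "\<exists>p :: 'u \<times> 'u \<Rightarrow> 'u. inj p"
proof -
  have "(UNIV :: ('u \<times> 'u) set) \<approx> (UNIV :: 'u set)"
    unfolding eqpoll_iff_card_of_ordIso
    using card_of_Times_same_infinite[OF infinite_universe] by simp
  then show ?thesis unfolding eqpoll_def bij_betw_def by blast
qed

lemma small_Sigma:
  assumes A: "small U A" and B: "\<And>a. a \<in> A \<Longrightarrow> small U (B a)"
  shows "small U (Sigma A B)"
proof -
  obtain p :: "'u \<times> 'u \<Rightarrow> 'u" where p: "inj p" using ex_pairing by blast
  obtain f :: "_ \<Rightarrow> 'u" where f: "inj_on f A"
    using lesspoll_imp_lepoll[OF A] by (auto simp: lepoll_def)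
  have "\<forall>a\<in>A. \<exists>g :: _ \<Rightarrow> 'u. inj_on g (B a)"
    using lesspoll_imp_lepoll[OF B] by (auto simp: lepoll_def)
  then obtain g :: "_ \<Rightarrow> _ \<Rightarrow> 'u" where g: "\<And>a. a \<in> A \<Longrightarrow> inj_on (g a) (B a)"
    by metis
  let ?h = "\<lambda>(a, b). p (f a, g a b)"
  let ?C = "\<lambda>u. (\<lambda>b. p (u, g (inv_into A f u) b)) ` B (inv_into A f u)"
  have inj: "inj_on ?h (Sigma A B)"
  proof (rule inj_onI)
    fix y z assume y: "y \<in> Sigma A B" and z: "z \<in> Sigma A B" and eq: "?h y = ?h z"
    obtain a b where y': "y = (a, b)" "a \<in> A" "b \<in> B a" using y by blast
    obtain a' b' where z': "z = (a', b')" "a' \<in> A" "b' \<in> B a'" using z by blast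
    have "(f a, g a b) = (f a', g a' b')" using eq p y' z' by (simp add: inj_eq)
    then show "y = z" using f g y' z' by (auto dest: inj_onD)
  qed
  have C: "?C (f a) = (\<lambda>b. p (f a, g a b)) ` B a" if "a \<in> A" for a
    using that f by simp
  have "small U (?C u)" if "u \<in> f ` A" for u
    using that small_image[OF B, of "inv_into A f u"] inv_into_into[OF that] by simp
  then have "small U (\<Union>u\<in>f ` A. ?C u)"
    by (intro inaccessible_UN small_image[OF A])
  moreover have "?h ` Sigma A B \<subseteq> (\<Union>u\<in>f ` A. ?C u)"
    using C by auto
  ultimately have "small U (?h ` Sigma A B)" by (rule small_subset[rotated])
  then show ?thesis using inj_on_image_lesspoll_1[OF inj] by blast
qed

lemma small_UN:
  assumes "small U A" "\<And>a. a \<in> A \<Longrightarrow> small U (B a)"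
  shows "small U (\<Union>a\<in>A. B a)"
proof -
  have "(\<Union>a\<in>A. B a) = snd ` Sigma A B" by force
  then show ?thesis using small_image[OF small_Sigma[OF assms]] by simp
qed

text \<open>An extensional function is determined by its graph over \<open>A\<close>, which is a
  subset of \<open>Sigma A B\<close>.\<close>

lemma small_PiE:
  assumes "small U A" "\<And>a. a \<in> A \<Longrightarrow> small U (B a)"
  shows "small U (PiE A B)"
proof -
  let ?g = "\<lambda>f. (\<lambda>a. (a, f a)) ` A"
  have "inj_on ?g (PiE A B)"
  proof (rule inj_onI)
    fix f g assume fg: "f \<in> PiE A B" "g \<in> PiE A B" "?g f = ?g g"
    have "f a = g a" if "a \<in> A" for a
    proof -
      have "(a, f a) \<in> ?g g" using fg(3) that by blast
      then show ?thesis by auto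
    qed
    then show "f = g" using fg by (meson PiE_ext)
  qed
  moreover have "?g ` PiE A B \<subseteq> Pow (Sigma A B)" by (auto simp: PiE_def Pi_def)
  ultimately have "PiE A B \<lesssim> Pow (Sigma A B)" unfolding lepoll_def by blast
  then show ?thesis by (rule small_lepoll) (intro small_Pow small_Sigma assms)
qed

text \<open>Lists are split by length. The union over all lengths stays small because the universe
  is uncountable.\<close>

lemma small_lists:
  assumes "small U A" shows "small U (lists A)"
proof -
  have len: "small U {xs \<in> lists A. length xs = n}" for n
  proof (induction n)
    case 0
    have "{xs \<in> lists A. length xs = 0} \<subseteq> {[]}" by auto
    then show ?case using small_finite by (metis finite.emptyI finite_insert finite_subset)
  next
    case (Suc n)
    have "{xs \<in> lists A. length xs = Suc n} \<subseteq>
        (\<lambda>(x, xs). x # xs) ` (A \<times> {xs \<in> lists A. length xs = n})"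
      by (auto simp: length_Suc_conv image_iff)
    then show ?case
      using small_subset[OF _ small_image[OF small_Sigma[OF assms Suc.IH]]] by blast
  qed
  have "lists A = (\<Union>n\<in>UNIV. {xs \<in> lists A. length xs = n})" by auto
  also have "small U \<dots>" by (intro small_UN small_nat len)
  finally show ?thesis .
qed

text \<open>\<open>T n\<close> collects the formulas of depth below \<open>n\<close>. Each stage is
  small, and since argument lists are finite, all arguments of a symbol occur together at one stage,
  so countably many stages exhaust the formulas.\<close>

lemma small_Fm:
  fixes L :: "'b language" and V :: "'c set"
  assumes L: "small U (dom L)" and V: "small U V"
  shows "small U (Fm L V)"
proof -
  define step where
    "step T = Var ` V \<union> (\<lambda>(f, ts). App f ts) ` (dom L \<times> lists T)" for T :: "('b, 'c) trm set"
  define T where "T n = (step ^^ n) {}" for n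
  have small_T: "small U (T n)" for n
  proof (induction n)
    case 0 show ?case by (simp add: T_def small_finite)
  next
    case (Suc n)
    let ?Y = "(\<lambda>(f, ts). App f ts) ` (dom L \<times> lists (T n))"
    have "small U (Var ` V :: ('b, 'c) trm set)" "small U ?Y"
      by (intro small_image small_Sigma L V small_lists Suc)+
    then have "small U (\<Union>b\<in>UNIV. if b then Var ` V else ?Y)"
      by (intro small_UN small_finite[OF finite]) simp
    then show ?case by (simp add: T_def step_def UNIV_bool Un_commute)
  qed
  have step_mono: "step X \<subseteq> step Y" if "X \<subseteq> Y" for X Y
    unfolding step_def using lists_mono[OF that] by blast
  have T_Suc: "T n \<subseteq> T (Suc n)" for n
    by (induction n) (simp_all add: T_def step_mono)
  have T_mono: "T m \<subseteq> T n" if "m \<le> n" for m n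
    using lift_Suc_mono_le[of T, OF T_Suc that] .
  have "t \<in> (\<Union>n. T n)" if "t \<in> Fm L V" for t
    using that
  proof (induction rule: Fm.induct)
    case (Var x)
    then have "trm.Var x \<in> T (Suc 0)" by (simp add: T_def step_def)
    then show ?case by blast
  next
    case (App f ts)
    have "\<exists>n. set ts \<subseteq> T n" if "\<forall>t\<in>set ts. t \<in> (\<Union>n. T n)" for ts
      using that
    proof (induction ts)
      case (Cons t ts)
      then obtain m n where "t \<in> T m" "set ts \<subseteq> T n" by auto
      then have "set (t # ts) \<subseteq> T (max m n)"
        using T_mono[of m "max m n"] T_mono[of n "max m n"] by auto
      then show ?case by blast
    qed simp
    moreover have "\<forall>t\<in>set ts. t \<in> (\<Union>n. T n)" using App.IH by auto
    ultimately obtain n where "set ts \<subseteq> T n" by blast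
    then have "trm.App f ts \<in> T (Suc n)"
      using App.hyps by (auto simp: T_def step_def)
    then show ?case by blast
  qed
  then have "Fm L V \<subseteq> (\<Union>n. T n)" by blast
  then show ?thesis by (rule small_subset) (intro small_UN small_nat small_T)
qed

text \<open>Supplies the names in \<open>'u\<close> for the symbols of the two languages built
  below, which are pairs or families and not elements of \<open>'u\<close>.\<close>

lemma ex_code:
  assumes "small U S"
  shows "\<exists>code :: 'b \<Rightarrow> 'u. inj_on code S"
  using lesspoll_imp_lepoll[OF assms] by (auto simp: lepoll_def)

end


section \<open>Terms, translations and homomorphisms\<close>

lemma eval_subst: "eval A h (subst \<sigma> t) = eval A (\<lambda>x. eval A h (\<sigma> x)) t"
  by (induction t) (simp_all add: comp_def cong: map_cong)

lemma eval_cong: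
  assumes "t \<in> Fm L V" "\<And>x. x \<in> V \<Longrightarrow> h x = g x"
  shows "eval A h t = eval A g t"
  using assms(1)
proof (induction rule: Fm.induct)
  case (App f ts)
  then have "map (eval A h) ts = map (eval A g) ts" by auto
  then show ?case by (simp only: eval.simps)
qed (use assms in simp)

lemma eval_closed:
  assumes A: "is_alg L A" and t: "t \<in> Fm L V" and h: "h ` V \<subseteq> carrier A"
  shows "eval A h t \<in> carrier A"
  using t
proof (induction rule: Fm.induct)
  case (App f ts)
  then have "map (eval A h) ts \<in> lists (carrier A)" by auto
  then show ?case using A App.hyps unfolding is_alg_def by (metis eval.simps(2) length_map)
qed (use h in auto)

lemma subst_Fm:
  assumes "t \<in> Fm L V" "\<And>x. x \<in> V \<Longrightarrow> \<sigma> x \<in> Fm L W"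
  shows "subst \<sigma> t \<in> Fm L W"
  using assms(1)
  by (induction rule: Fm.induct) (auto intro!: Fm.App simp: assms(2))

lemma App_vars_Fm: "L f = Some n \<Longrightarrow> App f (map Var [0..<n]) \<in> Fm L {..<n}"
  by (rule Fm.App) (auto intro!: Fm.Var)

fun translate :: "('f \<Rightarrow> ('g, nat) trm) \<Rightarrow> ('f, 'v) trm \<Rightarrow> ('g, 'v) trm" where
  "translate \<tau> (Var x) = Var x"
| "translate \<tau> (App f ts) = subst (\<lambda>i. map (translate \<tau>) ts ! i) (\<tau> f)"

lemma translate_Fm:
  assumes \<tau>: "is_translation \<tau> L L'" and t: "t \<in> Fm L V"
  shows "translate \<tau> t \<in> Fm L' V"
  using t
proof (induction rule: Fm.induct)
  case (App f ts)
  have "\<tau> f \<in> Fm L' {..<length ts}" using \<tau> App.hyps by (simp add: is_translation_def)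
  then show ?case unfolding translate.simps by (rule subst_Fm) (use App.IH in auto)
qed (auto intro: Fm.Var)

text \<open>Turns a statement about a reduct into one about formulas of the larger language; in this
  way the rules of a logic become candidate rules of a logic over another language.\<close>

lemma eval_reduct:
  assumes \<tau>: "is_translation \<tau> L L'" and t: "t \<in> Fm L V"
  shows "eval (reduct \<tau> A) h t = eval A h (translate \<tau> t)"
  using t
proof (induction rule: Fm.induct)
  case (App f ts)
  have f: "\<tau> f \<in> Fm L' {..<length ts}" using \<tau> App.hyps by (simp add: is_translation_def)
  have "eval A ((!) (map (eval (reduct \<tau> A) h) ts)) (\<tau> f) =
      eval A (\<lambda>i. eval A h (map (translate \<tau>) ts ! i)) (\<tau> f)"
    by (rule eval_cong[OF f]) (use App.IH in auto)
  then show ?case by (simp add: eval_subst) (simp add: reduct_def)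
qed simp

lemma carrier_reduct [simp]: "carrier (reduct \<tau> A) = carrier A"
  by (simp add: reduct_def)

lemma is_alg_reduct:
  assumes \<tau>: "is_translation \<tau> L L'" and A: "is_alg L' A"
  shows "is_alg L (reduct \<tau> A)"
  unfolding is_alg_def
proof (intro conjI allI impI)
  show "carrier (reduct \<tau> A) \<noteq> {}" using A by (simp add: is_alg_def)
  fix f as assume *: "L f = Some (length as) \<and> as \<in> lists (carrier (reduct \<tau> A))"
  then have "\<tau> f \<in> Fm L' {..<length as}" using \<tau> by (simp add: is_translation_def)
  then show "oper (reduct \<tau> A) f as \<in> carrier (reduct \<tau> A)"
    using * by (auto simp: reduct_def in_lists_conv_set intro!: eval_closed[OF A])
qed

text \<open>Operations carry meaning only for symbols of the language on argument lists of the right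
  length over the carrier, so commutation is required only there.\<close>

definition surj_hom :: "'f language \<Rightarrow> ('f, 'a) alg \<Rightarrow> ('f, 'b) alg \<Rightarrow> ('a \<Rightarrow> 'b) \<Rightarrow> bool" where
  "surj_hom L A B p \<longleftrightarrow> p ` carrier A = carrier B \<and>
     (\<forall>f as. L f = Some (length as) \<and> as \<in> lists (carrier A) \<longrightarrow>
        p (oper A f as) = oper B f (map p as))"

lemma surj_homI:
  assumes "p ` carrier A = carrier B"
    and "\<And>f as. L f = Some (length as) \<Longrightarrow> as \<in> lists (carrier A) \<Longrightarrow>
      p (oper A f as) = oper B f (map p as)"
  shows "surj_hom L A B p"
  using assms by (simp add: surj_hom_def)

lemma surj_homD:
  assumes "surj_hom L A B p"
  shows "p ` carrier A = carrier B"
    and "L f = Some (length as) \<Longrightarrow> as \<in> lists (carrier A) \<Longrightarrow>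
      p (oper A f as) = oper B f (map p as)"
  using assms by (simp_all add: surj_hom_def)

lemma eval_hom:
  assumes p: "surj_hom L A B p" and A: "is_alg L A" and t: "t \<in> Fm L V"
    and h: "h ` V \<subseteq> carrier A"
  shows "p (eval A h t) = eval B (\<lambda>x. p (h x)) t"
  using t
proof (induction rule: Fm.induct)
  case (App f ts)
  have "map (eval A h) ts \<in> lists (carrier A)"
    using App.IH eval_closed[OF A _ h] by auto
  moreover have "map p (map (eval A h) ts) = map (eval B (\<lambda>x. p (h x))) ts"
    using App.IH by auto
  ultimately show ?case
    using surj_homD(2)[OF p, of f "map (eval A h) ts"] App.hyps
    by (simp only: eval.simps length_map)
qed simp

lemma lists_surj:
  assumes "p ` X = Y" "bs \<in> lists Y"
  obtains as where "as \<in> lists X" "map p as = bs"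
  using assms(2) unfolding assms(1)[symmetric] lists_image by blast

lemma is_alg_surj_hom:
  assumes p: "surj_hom L A B p" and A: "is_alg L A"
  shows "is_alg L B"
  unfolding is_alg_def
proof (intro conjI allI impI)
  show "carrier B \<noteq> {}" using surj_homD(1)[OF p] A by (auto simp: is_alg_def)
  fix f bs assume *: "L f = Some (length bs) \<and> bs \<in> lists (carrier B)"
  then obtain as where as: "as \<in> lists (carrier A)" "map p as = bs"
    using lists_surj[OF surj_homD(1)[OF p]] by blast
  then have f: "L f = Some (length as)" using * by auto
  then have "oper A f as \<in> carrier A" using A as by (simp add: is_alg_def)
  then show "oper B f bs \<in> carrier B"
    using surj_homD[OF p] as f by (metis imageI)
qed


section \<open>Leibniz and Suszko congruences\<close>

lemma congruence_subset: "congruence L A \<theta> \<Longrightarrow> \<theta> \<subseteq> carrier A \<times> carrier A"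
  by (auto simp: congruence_def equiv_def refl_on_def)

lemma congruence_refl: "congruence L A \<theta> \<Longrightarrow> a \<in> carrier A \<Longrightarrow> (a, a) \<in> \<theta>"
  by (auto simp: congruence_def equiv_def refl_on_def)

lemma congruence_sym: "congruence L A \<theta> \<Longrightarrow> (a, b) \<in> \<theta> \<Longrightarrow> (b, a) \<in> \<theta>"
  by (auto simp: congruence_def equiv_def dest: symD)

lemma congruence_trans: "congruence L A \<theta> \<Longrightarrow> (a, b) \<in> \<theta> \<Longrightarrow> (b, c) \<in> \<theta> \<Longrightarrow> (a, c) \<in> \<theta>"
  by (auto simp: congruence_def equiv_def dest: transD)

lemma congruence_oper:
  "congruence L A \<theta> \<Longrightarrow> L f = Some (length as) \<Longrightarrow> list_all2 (\<lambda>a b. (a, b) \<in> \<theta>) as bs \<Longrightarrow>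
    (oper A f as, oper A f bs) \<in> \<theta>"
  by (auto simp: congruence_def)

lemma congruenceI:
  assumes "\<theta> \<subseteq> carrier A \<times> carrier A"
    and "\<And>a. a \<in> carrier A \<Longrightarrow> (a, a) \<in> \<theta>"
    and "\<And>a b. (a, b) \<in> \<theta> \<Longrightarrow> (b, a) \<in> \<theta>"
    and "\<And>a b c. (a, b) \<in> \<theta> \<Longrightarrow> (b, c) \<in> \<theta> \<Longrightarrow> (a, c) \<in> \<theta>"
    and "\<And>f as bs. L f = Some (length as) \<Longrightarrow> list_all2 (\<lambda>a b. (a, b) \<in> \<theta>) as bs \<Longrightarrow>
      (oper A f as, oper A f bs) \<in> \<theta>"
  shows "congruence L A \<theta>"
  using assms unfolding congruence_def equiv_def refl_on_def sym_def trans_def by blast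

lemma congruence_Id_on: "is_alg L A \<Longrightarrow> congruence L A (Id_on (carrier A))"
proof (rule congruenceI)
  fix f as bs
  assume A: "is_alg L A" and f: "L f = Some (length as)"
    and *: "list_all2 (\<lambda>a b. (a, b) \<in> Id_on (carrier A)) as bs"
  have "as = bs \<and> as \<in> lists (carrier A)" using * by (induction rule: list_all2_induct) auto
  then show "(oper A f as, oper A f bs) \<in> Id_on (carrier A)"
    using A f by (auto simp: is_alg_def)
qed auto

lemma congruence_eval:
  assumes \<theta>: "congruence L A \<theta>" and t: "t \<in> Fm L V"
    and h: "\<And>x. x \<in> V \<Longrightarrow> (h x, g x) \<in> \<theta>"
  shows "(eval A h t, eval A g t) \<in> \<theta>"
  using t
proof (induction rule: Fm.induct)
  case (App f ts)
  then have "list_all2 (\<lambda>a b. (a, b) \<in> \<theta>) (map (eval A h) ts) (map (eval A g) ts)"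
    by (auto simp: list_all2_conv_all_nth in_lists_conv_set)
  then show ?case using congruence_oper[OF \<theta>] App.hyps by (metis eval.simps(2) length_map)
qed (use h in simp)

text \<open>\<open>GREATEST\<close> in the definition of \<open>Leibniz\<close> needs a witness. It
  is the join of all compatible congruences, that is, the transitive closure of their union;
  compatibility is preserved along each link of a chain.\<close>

lemma ex_largest_compatible:
  assumes A: "is_alg L A"
  shows "\<exists>\<Omega>. (congruence L A \<Omega> \<and> compatible \<Omega> F) \<and>
    (\<forall>\<theta>. congruence L A \<theta> \<and> compatible \<theta> F \<longrightarrow> \<theta> \<subseteq> \<Omega>)"
proof (intro exI conjI)
  define C where "C = {\<theta>. congruence L A \<theta> \<and> compatible \<theta> F}"
  let ?\<Omega> = "(\<Union>C)\<^sup>+"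
  have Id: "Id_on (carrier A) \<in> C"
    using congruence_Id_on[OF A] by (auto simp: C_def compatible_def)
  have sub: "?\<Omega> \<subseteq> carrier A \<times> carrier A"
    by (rule trancl_subset_Sigma) (use congruence_subset in \<open>auto simp: C_def\<close>)
  have refl: "(a, a) \<in> ?\<Omega>" if "a \<in> carrier A" for a
    using Id that by blast
  have sym: "(b, a) \<in> ?\<Omega>" if "(a, b) \<in> ?\<Omega>" for a b
    using that
  proof (induction rule: trancl_induct)
    case (base y)
    then show ?case using congruence_sym by (fastforce simp: C_def)
  next
    case (step y z)
    then have "(z, y) \<in> \<Union>C" using congruence_sym by (fastforce simp: C_def)
    then show ?case using step.IH by (rule trancl_into_trancl2)
  qed
  \<comment> \<open>Two related arguments are joined by a chain whose links belong to possibly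
    different congruences. Changing a single argument position along that chain yields a chain of
    values, link by link.\<close>
  have step: "(oper A f (xs @ a # ys), oper A f (xs @ b # ys)) \<in> ?\<Omega>"
    if f: "L f = Some (length (xs @ a # ys))" and ab: "(a, b) \<in> ?\<Omega>"
      and xs: "xs \<in> lists (carrier A)" and ys: "ys \<in> lists (carrier A)" for f xs ys a b
  proof -
    have one: "(oper A f (xs @ c # ys), oper A f (xs @ d # ys)) \<in> \<Union>C"
      if "(c, d) \<in> \<Union>C" for c d
    proof -
      from that obtain \<theta> where \<theta>: "\<theta> \<in> C" "(c, d) \<in> \<theta>" by blast
      then have cong: "congruence L A \<theta>" by (simp add: C_def)
      have "list_all2 (\<lambda>a b. (a, b) \<in> \<theta>) zs zs" if "zs \<in> lists (carrier A)" for zs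
        using that congruence_refl[OF cong] by (induction zs) auto
      then have "list_all2 (\<lambda>a b. (a, b) \<in> \<theta>) (xs @ c # ys) (xs @ d # ys)"
        using xs ys \<theta> by (simp add: list_all2_appendI)
      then have "(oper A f (xs @ c # ys), oper A f (xs @ d # ys)) \<in> \<theta>"
        using congruence_oper[OF cong] f by simp
      then show ?thesis using \<theta> by blast
    qed
    show ?thesis
      using ab
    proof (induction rule: trancl_induct)
      case (base y)
      then show ?case using one by blast
    next
      case (step y z)
      then show ?case using one by (meson trancl_into_trancl)
    qed
  qed
  \<comment> \<open>All arguments are changed one after the other; the prefix \<open>xs\<close>
    holds those that have already been replaced.\<close>
  have oper: "(oper A f (xs @ as), oper A f (xs @ bs)) \<in> ?\<Omega>"
    if "list_all2 (\<lambda>a b. (a, b) \<in> ?\<Omega>) as bs" "L f = Some (length (xs @ as))"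
      "xs \<in> lists (carrier A)" for f as bs xs
    using that
  proof (induction arbitrary: xs rule: list_all2_induct)
    case Nil
    then show ?case using A by (intro refl) (simp add: is_alg_def)
  next
    case (Cons a as b bs)
    have ab: "a \<in> carrier A" "b \<in> carrier A" using sub Cons.hyps by auto
    have as: "as \<in> lists (carrier A)"
      using Cons.hyps(2) sub by (induction rule: list_all2_induct) auto
    have "(oper A f (xs @ a # as), oper A f (xs @ b # as)) \<in> ?\<Omega>"
      using step Cons.hyps(1) Cons.prems as by simp
    moreover have "(oper A f ((xs @ [b]) @ as), oper A f ((xs @ [b]) @ bs)) \<in> ?\<Omega>"
      using Cons.prems ab by (intro Cons.IH) auto
    ultimately show ?case by simp
  qed
  show "congruence L A ?\<Omega>"
    by (rule congruenceI[OF sub refl sym]) (use oper[of _ _ _ "[]"] in auto)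
  show "compatible ?\<Omega> F"
    unfolding compatible_def
  proof (clarify)
    fix a b assume "(a, b) \<in> ?\<Omega>" "a \<in> F"
    then show "b \<in> F"
      by (induction rule: trancl_induct) (fastforce simp: C_def compatible_def)+
  qed
  show "\<forall>\<theta>. congruence L A \<theta> \<and> compatible \<theta> F \<longrightarrow> \<theta> \<subseteq> ?\<Omega>"
    by (auto simp: C_def)
qed

lemma Leibniz_largest:
  assumes A: "is_alg L A"
  shows Leibniz_congruence: "congruence L A (Leibniz L A F)"
    and Leibniz_compatible: "compatible (Leibniz L A F) F"
    and Leibniz_greatest: "congruence L A \<theta> \<Longrightarrow> compatible \<theta> F \<Longrightarrow> \<theta> \<subseteq> Leibniz L A F"
proof -
  obtain \<Omega> where \<Omega>: "congruence L A \<Omega> \<and> compatible \<Omega> F"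
      "\<And>\<theta>. congruence L A \<theta> \<and> compatible \<theta> F \<Longrightarrow> \<theta> \<subseteq> \<Omega>"
    using ex_largest_compatible[OF A] by metis
  then have "Leibniz L A F = \<Omega>" unfolding Leibniz_def by (rule Greatest_equality)
  with \<Omega> show "congruence L A (Leibniz L A F)" "compatible (Leibniz L A F) F"
    "congruence L A \<theta> \<Longrightarrow> compatible \<theta> F \<Longrightarrow> \<theta> \<subseteq> Leibniz L A F"
    by auto
qed

lemma Leibniz_iff:
  assumes A: "is_alg L A" and "(a, b) \<in> Leibniz L A F"
  shows "a \<in> F \<longleftrightarrow> b \<in> F"
  using Leibniz_compatible[OF A, of F] assms(2)
    congruence_sym[OF Leibniz_congruence[OF A] assms(2)]
  by (auto simp: compatible_def)

text \<open>The kernel of \<open>p\<close> is compatible with the preimage of \<open>G\<close>, so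
  it lies below the Leibniz congruence of that preimage. The image of this congruence under
  \<open>p\<close> is therefore again a congruence, and it is compatible with
  \<open>G\<close>.\<close>

lemma Leibniz_image:
  assumes p: "surj_hom L A B p" and A: "is_alg L A"
    and ab: "(a, b) \<in> Leibniz L A {x \<in> carrier A. p x \<in> G}"
  shows "(p a, p b) \<in> Leibniz L B G"
proof -
  let ?F = "{x \<in> carrier A. p x \<in> G}" and ?\<Omega> = "Leibniz L B G"
  have B: "is_alg L B" using is_alg_surj_hom[OF p A] .
  have img: "p x \<in> carrier B" if "x \<in> carrier A" for x
    using surj_homD(1)[OF p] that by blast
  let ?\<Psi> = "Leibniz L A ?F"
  note \<Psi> = Leibniz_congruence[OF A, of ?F]
  let ?ker = "{(x, y). x \<in> carrier A \<and> y \<in> carrier A \<and> p x = p y}"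
  let ?\<theta> = "(\<lambda>(x, y). (p x, p y)) ` ?\<Psi>"
  have "congruence L A ?ker"
  proof (rule congruenceI)
    fix f as bs
    assume f: "L f = Some (length as)" and *: "list_all2 (\<lambda>a b. (a, b) \<in> ?ker) as bs"
    have as: "as \<in> lists (carrier A)" "bs \<in> lists (carrier A)" "map p as = map p bs"
      using * by (induction rule: list_all2_induct) auto
    have "length bs = length as" using * by (simp add: list_all2_lengthD)
    then show "(oper A f as, oper A f bs) \<in> ?ker"
      using as f A by (simp add: surj_homD(2)[OF p] is_alg_def)
  qed auto
  moreover have "compatible ?ker ?F" by (auto simp: compatible_def)
  ultimately have ker: "?ker \<subseteq> ?\<Psi>" by (rule Leibniz_greatest[OF A])
  \<comment> \<open>Since the kernel is contained in the congruence, the choice of preimages does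
    not matter. Transitivity of the image depends on this.\<close>
  have \<theta>_iff: "(p x, p y) \<in> ?\<theta> \<longleftrightarrow> (x, y) \<in> ?\<Psi>" if "x \<in> carrier A" "y \<in> carrier A" for x y
  proof
    assume "(p x, p y) \<in> ?\<theta>"
    then obtain x' y' where xy': "p x = p x'" "p y = p y'" "(x', y') \<in> ?\<Psi>" by auto
    then have "(x, x') \<in> ?\<Psi>" "(y', y) \<in> ?\<Psi>"
      using ker congruence_subset[OF \<Psi>] that by auto
    then show "(x, y) \<in> ?\<Psi>" using xy' congruence_trans[OF \<Psi>] by blast
  qed force
  have sub: "?\<theta> \<subseteq> carrier B \<times> carrier B"
    using congruence_subset[OF \<Psi>] img by auto
  have lift: thesis if "u \<in> carrier B" "\<And>x. x \<in> carrier A \<Longrightarrow> u = p x \<Longrightarrow> thesis" for u thesis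
    using surj_homD(1)[OF p] that by blast
  have "congruence L B ?\<theta>"
  proof (rule congruenceI[OF sub])
    fix u assume "u \<in> carrier B"
    then obtain x where "x \<in> carrier A" "u = p x" by (rule lift)
    then show "(u, u) \<in> ?\<theta>" using \<theta>_iff congruence_refl[OF \<Psi>] by blast
  next
    fix u v assume "(u, v) \<in> ?\<theta>"
    then obtain x y where "u = p x" "v = p y" "(x, y) \<in> ?\<Psi>" by auto
    then show "(v, u) \<in> ?\<theta>" using congruence_sym[OF \<Psi>] by force
  next
    fix u v w assume uv: "(u, v) \<in> ?\<theta>" and vw: "(v, w) \<in> ?\<theta>"
    obtain x where x: "x \<in> carrier A" "u = p x" by (rule lift[of u]) (use sub uv in blast)
    obtain y where y: "y \<in> carrier A" "v = p y" by (rule lift[of v]) (use sub uv in blast)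
    obtain z where z: "z \<in> carrier A" "w = p z" by (rule lift[of w]) (use sub vw in blast)
    have "(x, y) \<in> ?\<Psi>" "(y, z) \<in> ?\<Psi>"
      using uv vw x y z \<theta>_iff by simp_all
    then show "(u, w) \<in> ?\<theta>" using x z \<theta>_iff congruence_trans[OF \<Psi>] by blast
  next
    fix f us vs
    assume f: "L f = Some (length us)" and *: "list_all2 (\<lambda>a b. (a, b) \<in> ?\<theta>) us vs"
    have "\<exists>as bs. as \<in> lists (carrier A) \<and> bs \<in> lists (carrier A) \<and> us = map p as \<and>
        vs = map p bs \<and> list_all2 (\<lambda>a b. (a, b) \<in> ?\<Psi>) as bs"
      using *
    proof (induction rule: list_all2_induct)
      case (Cons u us v vs)
      then obtain as bs where IH: "as \<in> lists (carrier A)" "bs \<in> lists (carrier A)"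
        "us = map p as" "vs = map p bs" "list_all2 (\<lambda>a b. (a, b) \<in> ?\<Psi>) as bs" by blast
      obtain x y where "u = p x" "v = p y" "(x, y) \<in> ?\<Psi>" using Cons.hyps by auto
      then show ?case using IH congruence_subset[OF \<Psi>]
        by (intro exI[of _ "x # as"] exI[of _ "y # bs"]) auto
    qed auto
    then obtain as bs where as: "as \<in> lists (carrier A)" "bs \<in> lists (carrier A)"
      "us = map p as" "vs = map p bs" "list_all2 (\<lambda>a b. (a, b) \<in> ?\<Psi>) as bs" by blast
    have len: "length as = length us" "length bs = length us"
      using as(3,5) by (auto simp: list_all2_lengthD)
    have "(oper A f as, oper A f bs) \<in> ?\<Psi>"
      using congruence_oper[OF \<Psi> _ as(5), of f] f len by simp
    moreover have "oper B f us = p (oper A f as)" "oper B f vs = p (oper A f bs)"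
      using surj_homD(2)[OF p, of f as, OF _ as(1)] surj_homD(2)[OF p, of f bs, OF _ as(2)]
      unfolding as(3,4) by (simp_all only: f len)
    ultimately show "(oper B f us, oper B f vs) \<in> ?\<theta>" by auto
  qed
  moreover have "compatible ?\<theta> G"
    unfolding compatible_def
    using Leibniz_compatible[OF A, of ?F] congruence_subset[OF \<Psi>] by (fastforce simp: compatible_def)
  ultimately have "?\<theta> \<subseteq> ?\<Omega>" by (rule Leibniz_greatest[OF B])
  then show ?thesis using ab by auto
qed


section \<open>Deductive filters and closure properties of reduced models\<close>

lemma deductive_filter_entails:
  assumes "deductive_filter l A F" "entails l \<Gamma> \<phi>" "h ` vars l \<subseteq> carrier A"
    "\<And>\<gamma>. \<gamma> \<in> \<Gamma> \<Longrightarrow> eval A h \<gamma> \<in> F"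
  shows "eval A h \<phi> \<in> F"
proof -
  have "eval A h ` \<Gamma> \<subseteq> F" using assms(4) by blast
  then show ?thesis
    using assms(1)[unfolded deductive_filter_def, THEN conjunct2, rule_format, of \<Gamma> \<phi> h] assms(2,3)
    by simp
qed

lemma deductive_filterI:
  assumes "F \<subseteq> carrier A"
    and "\<And>\<Gamma> \<phi> h. entails l \<Gamma> \<phi> \<Longrightarrow> h ` vars l \<subseteq> carrier A \<Longrightarrow> eval A h ` \<Gamma> \<subseteq> F \<Longrightarrow>
      eval A h \<phi> \<in> F"
  shows "deductive_filter l A F"
  unfolding deductive_filter_def
proof (intro conjI allI impI)
  fix \<Gamma> \<phi> and h :: "_ \<Rightarrow> _"
  assume "entails l \<Gamma> \<phi> \<and> h ` vars l \<subseteq> carrier A \<and> eval A h ` \<Gamma> \<subseteq> F"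
  then show "eval A h \<phi> \<in> F" by (elim conjE) (rule assms(2))
qed (rule assms(1))

lemma entails_formulas:
  assumes "is_consequence l" "entails l \<Gamma> \<phi>"
  shows "\<Gamma> \<subseteq> formulas l" "\<phi> \<in> formulas l"
  using assms(1)[unfolded is_consequence_def, THEN conjunct1, rule_format, OF assms(2)] by simp_all

lemma deductive_filter_preimage:
  assumes l: "is_consequence l" and p: "surj_hom (lang l) A B p" and A: "is_alg (lang l) A"
    and G: "deductive_filter l B G"
  shows "deductive_filter l A {x \<in> carrier A. p x \<in> G}"
proof (rule deductive_filterI)
  fix \<Gamma> \<phi> and h :: "_ \<Rightarrow> _"
  assume ent: "entails l \<Gamma> \<phi>" and h: "h ` vars l \<subseteq> carrier A"
    and \<Gamma>: "eval A h ` \<Gamma> \<subseteq> {x \<in> carrier A. p x \<in> G}"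
  note fm = entails_formulas[OF l ent]
  have hom: "p (eval A h t) = eval B (\<lambda>x. p (h x)) t" if "t \<in> formulas l" for t
    by (rule eval_hom[OF p A that h])
  have "eval B (\<lambda>x. p (h x)) \<phi> \<in> G"
  proof (rule deductive_filter_entails[OF G ent])
    show "(\<lambda>x. p (h x)) ` vars l \<subseteq> carrier B" using h surj_homD(1)[OF p] by blast
  next
    fix \<gamma> assume "\<gamma> \<in> \<Gamma>"
    then show "eval B (\<lambda>x. p (h x)) \<gamma> \<in> G"
      using \<Gamma> fm(1) hom[of \<gamma>] by fastforce
  qed
  then show "eval A h \<phi> \<in> {x \<in> carrier A. p x \<in> G}"
    using hom fm eval_closed[OF A fm(2) h] by simp
qed auto

text \<open>The intersection is formed inside the carrier, so an empty index set gives the whole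
  carrier, which is the largest filter.\<close>

lemma deductive_filter_INT:
  assumes "\<And>i. i \<in> I \<Longrightarrow> deductive_filter l A (F i)" and A: "is_alg (lang l) A"
    and l: "is_consequence l"
  shows "deductive_filter l A {x \<in> carrier A. \<forall>i\<in>I. x \<in> F i}"
proof (rule deductive_filterI)
  fix \<Gamma> \<phi> and h :: "_ \<Rightarrow> _"
  assume ent: "entails l \<Gamma> \<phi>" and h: "h ` vars l \<subseteq> carrier A"
    and \<Gamma>: "eval A h ` \<Gamma> \<subseteq> {x \<in> carrier A. \<forall>i\<in>I. x \<in> F i}"
  have "eval A h \<phi> \<in> F i" if "i \<in> I" for i
    by (rule deductive_filter_entails[OF assms(1)[OF that] ent h]) (use \<Gamma> that in blast)
  then show "eval A h \<phi> \<in> {x \<in> carrier A. \<forall>i\<in>I. x \<in> F i}"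
    using eval_closed[OF A entails_formulas(2)[OF l ent] h] by simp
qed auto

lemma Suszko_iff:
  "(a, b) \<in> Suszko l A F \<longleftrightarrow>
    (\<forall>G. deductive_filter l A G \<and> F \<subseteq> G \<longrightarrow> (a, b) \<in> Leibniz (lang l) A G)"
  by (auto simp: Suszko_def)

lemma Suszko_subset_Leibniz:
  "deductive_filter l A F \<Longrightarrow> Suszko l A F \<subseteq> Leibniz (lang l) A F"
  by (auto simp: Suszko_def)

text \<open>An intersection of Leibniz congruences; \<open>F\<close> itself is one of the filters
  above \<open>F\<close>, which keeps the intersection inside the carrier.\<close>

lemma Suszko_congruence:
  assumes A: "is_alg (lang l) A" and F: "deductive_filter l A F"
  shows "congruence (lang l) A (Suszko l A F)"
proof (rule congruenceI)
  note cong = Leibniz_congruence[OF A]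
  show "Suszko l A F \<subseteq> carrier A \<times> carrier A"
    using Suszko_subset_Leibniz[OF F] congruence_subset[OF cong] by blast
  fix f as bs
  assume f: "lang l f = Some (length as)"
    and *: "list_all2 (\<lambda>a b. (a, b) \<in> Suszko l A F) as bs"
  have "list_all2 (\<lambda>a b. (a, b) \<in> Leibniz (lang l) A G) as bs"
    if "deductive_filter l A G" "F \<subseteq> G" for G
    using * by (rule list_all2_mono) (use that in \<open>simp add: Suszko_iff\<close>)
  then show "(oper A f as, oper A f bs) \<in> Suszko l A F"
    unfolding Suszko_iff using congruence_oper[OF cong f] by blast
next
  note cong = Leibniz_congruence[OF A]
  show "(a, a) \<in> Suszko l A F" if "a \<in> carrier A" for a
    using congruence_refl[OF cong that] by (simp add: Suszko_iff)
  show "(b, a) \<in> Suszko l A F" if "(a, b) \<in> Suszko l A F" for a b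
    using that congruence_sym[OF cong] by (simp add: Suszko_iff)
  show "(a, c) \<in> Suszko l A F" if "(a, b) \<in> Suszko l A F" "(b, c) \<in> Suszko l A F" for a b c
    using that congruence_trans[OF cong] unfolding Suszko_iff by blast
qed

lemma Mod_equivI:
  assumes A: "is_alg (lang l) A" and small: "carrier A \<prec> (UNIV :: 'u set)"
    and F: "deductive_filter l A F"
    and Suszko: "\<And>a b. a \<in> carrier A \<Longrightarrow> b \<in> carrier A \<Longrightarrow> (a, b) \<in> Suszko l A F \<Longrightarrow> a = b"
  shows "(A :: ('u, 'u) alg, F) \<in> Mod_equiv l"
proof -
  have "Suszko l A F = Id_on (carrier A)"
    using Suszko congruence_subset[OF Suszko_congruence[OF A F]]
      congruence_refl[OF Suszko_congruence[OF A F]] by fastforce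
  then show ?thesis using assms by (simp add: Mod_equiv_def Mod_def)
qed

lemma Mod_equivD:
  assumes "(A, F) \<in> Mod_equiv (l :: ('u, 'u) logic)"
  shows "is_alg (lang l) A" "carrier A \<prec> (UNIV :: 'u set)" "deductive_filter l A F" "(A, F) \<in> Mod l"
    "(a, b) \<in> Suszko l A F \<Longrightarrow> a = b"
  using assms by (auto simp: Mod_equiv_def Mod_def)

text \<open>The index set may be empty, which gives the trivial matrices, or a singleton, which gives
  isomorphic copies.\<close>

lemma Mod_equiv_subdirect:
  fixes A :: "('u, 'u) alg"
  assumes l: "is_consequence l" and A: "is_alg (lang l) A" and small: "carrier A \<prec> (UNIV :: 'u set)"
    and p: "\<And>i. i \<in> I \<Longrightarrow> surj_hom (lang l) A (B i) (p i)"
    and B: "\<And>i. i \<in> I \<Longrightarrow> (B i, G i) \<in> Mod_equiv l"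
    and F: "F = {a \<in> carrier A. \<forall>i\<in>I. p i a \<in> G i}"
    and inj: "\<And>a b. a \<in> carrier A \<Longrightarrow> b \<in> carrier A \<Longrightarrow> \<forall>i\<in>I. p i a = p i b \<Longrightarrow> a = b"
  shows "(A, F) \<in> Mod_equiv l"
proof (rule Mod_equivI[OF A small])
  have "F = {a \<in> carrier A. \<forall>i\<in>I. a \<in> {x \<in> carrier A. p i x \<in> G i}}" using F by blast
  also have "deductive_filter l A \<dots>"
    by (rule deductive_filter_INT[OF deductive_filter_preimage[OF l p A Mod_equivD(3)[OF B]] A l])
  finally show "deductive_filter l A F" .
  fix a b assume a: "a \<in> carrier A" and b: "b \<in> carrier A" and ab: "(a, b) \<in> Suszko l A F"
  have "p i a = p i b" if i: "i \<in> I" for i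
  proof (rule Mod_equivD(5)[OF B[OF i]])
    show "(p i a, p i b) \<in> Suszko l (B i) (G i)"
      unfolding Suszko_iff
    proof (intro allI impI)
      \<comment> \<open>A filter above \<open>G i\<close> pulls back to a filter above
        \<open>F\<close>. The Suszko pair of \<open>A\<close> thus lies in the Leibniz congruence of
        the pullback, and \<open>Leibniz_image\<close> pushes it down to \<open>B i\<close>.\<close>
      fix H assume H: "deductive_filter l (B i) H \<and> G i \<subseteq> H"
      have "deductive_filter l A {x \<in> carrier A. p i x \<in> H}"
        using H by (intro deductive_filter_preimage[OF l p[OF i] A]) simp
      moreover have "F \<subseteq> {x \<in> carrier A. p i x \<in> H}" using F H i by blast
      ultimately have "(a, b) \<in> Leibniz (lang l) A {x \<in> carrier A. p i x \<in> H}"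
        using ab by (simp add: Suszko_iff)
      then show "(p i a, p i b) \<in> Leibniz (lang l) (B i) H"
        by (rule Leibniz_image[OF p[OF i] A])
    qed
  qed
  then show "a = b" using inj a b by blast
qed

text \<open>These one-element matrices fill the remaining coordinates when a single member is placed
  inside a product.\<close>

lemma Mod_equiv_trivial:
  assumes "is_consequence l" "is_alg (lang l) A" "carrier A = {u}" "carrier A \<prec> (UNIV :: 'u set)"
  shows "(A :: ('u, 'u) alg, {u}) \<in> Mod_equiv l"
proof (rule Mod_equiv_subdirect[where I = "{}" and p = "\<lambda>_. id" and B = "\<lambda>_. A" and G = "\<lambda>_. {}"])
  show "{u} = {a \<in> carrier A. \<forall>i\<in>{}. id a \<in> {}}" using assms(3) by simp
  show "a = b" if "a \<in> carrier A" "b \<in> carrier A" for a b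
    using that unfolding assms(3) by simp
qed (fact assms | simp)+

text \<open>\<open>oper\<close> is unconstrained off the language and off the carrier, so algebras
  that are the same mathematically can differ as records. The identity map is a subdirect embedding
  with one factor.\<close>

lemma Mod_equiv_cong:
  assumes l: "is_consequence l" and A: "(A, F) \<in> Mod_equiv l"
    and car: "carrier B = carrier A"
    and oper: "\<And>f as. lang l f = Some (length as) \<Longrightarrow> as \<in> lists (carrier A) \<Longrightarrow>
      oper B f as = oper A f as"
  shows "(B :: ('u, 'u) alg, F) \<in> Mod_equiv l"
proof (rule Mod_equiv_subdirect[where I = "{()}" and p = "\<lambda>_. id" and B = "\<lambda>_. A" and G = "\<lambda>_. F"])
  show "is_alg (lang l) B"
    using Mod_equivD(1)[OF A] car oper by (simp add: is_alg_def)
  show "F = {a \<in> carrier B. \<forall>i\<in>{()}. id a \<in> F}"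
    using Mod_equivD(3)[OF A] car by (auto simp: deductive_filter_def)
  show "surj_hom (lang l) B A id"
    by (rule surj_homI) (simp_all add: car oper)
  show "carrier B \<prec> (UNIV :: 'u set)"
    using Mod_equivD(2)[OF A] by (simp add: car)
qed (use l A in simp_all)


section \<open>Equivalence formulas\<close>

definition pair :: "'a \<Rightarrow> 'a \<Rightarrow> nat \<Rightarrow> 'a" where
  "pair a b k = (if k = 0 then a else b)"

definition eq_formulas :: "('f, nat) trm set \<Rightarrow> ('f, 'a) alg \<Rightarrow> 'a set \<Rightarrow> 'a \<Rightarrow> 'a \<Rightarrow> bool" where
  "eq_formulas \<Delta> A F a b \<longleftrightarrow> (\<forall>\<delta>\<in>\<Delta>. eval A (pair a b) \<delta> \<in> F)"

lemma eq_formulas_translate: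
  assumes \<tau>: "is_translation \<tau> L L'" and \<Delta>: "\<Delta> \<subseteq> Fm L {..<2}"
  shows "eq_formulas (translate \<tau> ` \<Delta>) A F a b \<longleftrightarrow> eq_formulas \<Delta> (reduct \<tau> A) F a b"
proof -
  have "eval (reduct \<tau> A) h \<delta> = eval A h (translate \<tau> \<delta>)" if "\<delta> \<in> \<Delta>" for h \<delta>
    using eval_reduct[OF \<tau>] that \<Delta> by blast
  then show ?thesis by (simp add: eq_formulas_def)
qed

text \<open>The variables \<open>0\<close> and \<open>1\<close> replace the two chosen variables of
  the logic, so the formulas can be translated into other languages and instantiated without regard
  to \<open>vars l\<close>.\<close>

definition defines_Leibniz :: "('u, nat) trm set \<Rightarrow> ('u, 'u) logic \<Rightarrow> bool" where
  "defines_Leibniz \<Delta> l \<longleftrightarrow> \<Delta> \<noteq> {} \<and> \<Delta> \<subseteq> Fm (lang l) {..<2} \<and>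
     (\<forall>(A, F)\<in>Mod l. \<forall>a\<in>carrier A. \<forall>b\<in>carrier A.
        (a, b) \<in> Leibniz (lang l) A F \<longleftrightarrow> eq_formulas \<Delta> A F a b)"

lemma equivalential_iff:
  fixes l :: "('u, 'u) logic"
  assumes "is_logic l"
  shows "equivalential l \<longleftrightarrow> (\<exists>\<Delta>. defines_Leibniz \<Delta> l)"
proof
  assume "equivalential l"
  then obtain x y \<Delta> where eq: "x \<in> vars l \<and> y \<in> vars l \<and> x \<noteq> y \<and> \<Delta> \<noteq> {} \<and>
      \<Delta> \<subseteq> Fm (lang l) {x, y} \<and> (\<forall>(A, F)\<in>Mod l. \<forall>a\<in>carrier A. \<forall>b\<in>carrier A.
        (a, b) \<in> Leibniz (lang l) A F \<longleftrightarrow> eval A (\<lambda>z. if z = x then a else b) ` \<Delta> \<subseteq> F)"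
    unfolding equivalential_def by (elim exE) (rule that)
  then have \<Delta>: "\<Delta> \<noteq> {}" "\<Delta> \<subseteq> Fm (lang l) {x, y}" by simp_all
  note L = eq[THEN conjunct2, THEN conjunct2, THEN conjunct2, THEN conjunct2, THEN conjunct2]
  let ?\<sigma> = "\<lambda>z. Var (if z = x then 0 else 1 :: nat)"
  have "eval A (pair a b) (subst ?\<sigma> \<delta>) = eval A (\<lambda>z. if z = x then a else b) \<delta>"
    for A :: "('u, 'u) alg" and a b \<delta>
    by (auto simp: eval_subst pair_def intro!: arg_cong[where f = "\<lambda>h. eval A h \<delta>"])
  then have "eq_formulas (subst ?\<sigma> ` \<Delta>) A F a b \<longleftrightarrow>
      eval A (\<lambda>z. if z = x then a else b) ` \<Delta> \<subseteq> F" for A :: "('u, 'u) alg" and F a b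
    by (auto simp: eq_formulas_def)
  moreover have "subst ?\<sigma> ` \<Delta> \<subseteq> Fm (lang l) {..<2}"
  proof clarify
    fix \<delta> assume "\<delta> \<in> \<Delta>"
    then show "subst ?\<sigma> \<delta> \<in> Fm (lang l) {..<2}"
      using \<Delta>(2) by (intro subst_Fm[of \<delta> _ "{x, y}"]) (auto intro!: Fm.Var)
  qed
  ultimately have "defines_Leibniz (subst ?\<sigma> ` \<Delta>) l"
    using L \<Delta>(1) by (simp add: defines_Leibniz_def)
  then show "\<exists>\<Delta>. defines_Leibniz \<Delta> l" by blast
next
  assume "\<exists>\<Delta>. defines_Leibniz \<Delta> l"
  then obtain \<Delta> where "defines_Leibniz \<Delta> l" by blast
  then have \<Delta>: "\<Delta> \<noteq> {}" "\<Delta> \<subseteq> Fm (lang l) {..<2}" and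
    L: "\<forall>(A, F)\<in>Mod l. \<forall>a\<in>carrier A. \<forall>b\<in>carrier A.
        (a, b) \<in> Leibniz (lang l) A F \<longleftrightarrow> eq_formulas \<Delta> A F a b"
    by (simp_all add: defines_Leibniz_def)
  have inf: "infinite (vars l)" using assms by (simp add: is_logic_def)
  then obtain x where x: "x \<in> vars l" using infinite_imp_nonempty by blast
  have "infinite (vars l - {x})" using inf by simp
  then obtain y where y: "y \<in> vars l" "x \<noteq> y" using infinite_imp_nonempty by blast
  let ?\<sigma> = "\<lambda>k :: nat. Var (if k = 0 then x else y)"
  have "eval A (\<lambda>z. if z = x then a else b) (subst ?\<sigma> \<delta>) = eval A (pair a b) \<delta>"
    for A :: "('u, 'u) alg" and a b \<delta>
    using y(2) by (auto simp: eval_subst pair_def intro!: arg_cong[where f = "\<lambda>h. eval A h \<delta>"])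
  then have "eval A (\<lambda>z. if z = x then a else b) ` subst ?\<sigma> ` \<Delta> \<subseteq> F \<longleftrightarrow> eq_formulas \<Delta> A F a b"
    for A :: "('u, 'u) alg" and F a b
    by (simp add: eq_formulas_def image_subset_iff)
  moreover have "subst ?\<sigma> ` \<Delta> \<subseteq> Fm (lang l) {x, y}"
  proof clarify
    fix \<delta> assume "\<delta> \<in> \<Delta>"
    then show "subst ?\<sigma> \<delta> \<in> Fm (lang l) {x, y}"
      using \<Delta>(2) by (intro subst_Fm[of \<delta> _ "{..<2}"]) (auto intro!: Fm.Var)
  qed
  ultimately show "equivalential l"
    unfolding equivalential_def using x y \<Delta>(1) L
    by (intro exI[of _ x] exI[of _ y] exI[of _ "subst ?\<sigma> ` \<Delta>"]) auto
qed

text \<open>\<open>eq_formulas\<close> is monotone in the filter, so the Leibniz congruence grows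
  with the filter and the intersection over all larger filters is attained at
  \<open>F\<close>.\<close>

lemma Suszko_defines_Leibniz:
  assumes \<Delta>: "defines_Leibniz \<Delta> l" and AF: "(A, F) \<in> Mod l"
    and a: "a \<in> carrier A" and b: "b \<in> carrier A"
  shows "(a, b) \<in> Suszko l A F \<longleftrightarrow> eq_formulas \<Delta> A F a b"
proof
  have F: "deductive_filter l A F" using AF by (simp add: Mod_def)
  have L: "(a, b) \<in> Leibniz (lang l) A G \<longleftrightarrow> eq_formulas \<Delta> A G a b" if "deductive_filter l A G" for G
    using \<Delta> AF that a b unfolding defines_Leibniz_def by (auto simp: Mod_def)
  show "eq_formulas \<Delta> A F a b" if "(a, b) \<in> Suszko l A F"
    using that Suszko_subset_Leibniz[OF F] L[OF F] by blast
  show "(a, b) \<in> Suszko l A F" if "eq_formulas \<Delta> A F a b"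
    unfolding Suszko_iff
  proof (intro allI impI)
    fix G assume G: "deductive_filter l A G \<and> F \<subseteq> G"
    then have "eq_formulas \<Delta> A G a b" using that by (auto simp: eq_formulas_def)
    then show "(a, b) \<in> Leibniz (lang l) A G" using L G by blast
  qed
qed

lemma eq_formulas_Mod_equiv:
  assumes "defines_Leibniz \<Delta> l" "(A, F) \<in> Mod_equiv l" "a \<in> carrier A" "b \<in> carrier A"
  shows "eq_formulas \<Delta> A F a b \<longleftrightarrow> a = b"
  using Suszko_defines_Leibniz[OF assms(1) Mod_equivD(4)[OF assms(2)] assms(3,4)] assms(2,3)
  by (auto simp: Mod_equiv_def)

lemma Mod_equiv_eq_formulasI:
  assumes "defines_Leibniz \<Delta> l" "(A, F) \<in> Mod l"
    "\<And>a b. a \<in> carrier A \<Longrightarrow> b \<in> carrier A \<Longrightarrow> eq_formulas \<Delta> A F a b \<Longrightarrow> a = b"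
  shows "(A, F) \<in> Mod_equiv l"
  by (rule Mod_equivI) (use assms Suszko_defines_Leibniz[OF assms(1,2)] in \<open>auto simp: Mod_def\<close>)


section \<open>The logic of a class of matrices\<close>

text \<open>The carrier type \<open>'b\<close> is independent of \<open>'u\<close>: products of
  matrices live on functions \<open>'i \<Rightarrow> 'u\<close> and can generate a logic without
  being coded into \<open>'u\<close>.\<close>

definition valid :: "(('f, 'b) alg \<times> 'b set) set \<Rightarrow> 'v set \<Rightarrow> ('f, 'v) trm set \<Rightarrow> ('f, 'v) trm \<Rightarrow> bool" where
  "valid K V \<Gamma> \<phi> \<longleftrightarrow> (\<forall>(A, F)\<in>K. \<forall>h. h ` V \<subseteq> carrier A \<and> (\<forall>\<gamma>\<in>\<Gamma>. eval A h \<gamma> \<in> F) \<longrightarrow> eval A h \<phi> \<in> F)"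

definition logic_of :: "'f language \<Rightarrow> 'v set \<Rightarrow> (('f, 'b) alg \<times> 'b set) set \<Rightarrow> ('f, 'v) logic" where
  "logic_of L V K = \<lparr>lang = L, vars = V,
     entails = \<lambda>\<Gamma> \<phi>. \<Gamma> \<subseteq> Fm L V \<and> \<phi> \<in> Fm L V \<and> valid K V \<Gamma> \<phi>\<rparr>"

lemma logic_of_simps [simp]:
  "lang (logic_of L V K) = L" "vars (logic_of L V K) = V"
  "entails (logic_of L V K) \<Gamma> \<phi> \<longleftrightarrow> \<Gamma> \<subseteq> Fm L V \<and> \<phi> \<in> Fm L V \<and> valid K V \<Gamma> \<phi>"
  by (simp_all add: logic_of_def)

lemma validD:
  "valid K V \<Gamma> \<phi> \<Longrightarrow> (A, F) \<in> K \<Longrightarrow> h ` V \<subseteq> carrier A \<Longrightarrow>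
    (\<And>\<gamma>. \<gamma> \<in> \<Gamma> \<Longrightarrow> eval A h \<gamma> \<in> F) \<Longrightarrow> eval A h \<phi> \<in> F"
  unfolding valid_def by fastforce

lemma validI:
  "(\<And>A F h. (A, F) \<in> K \<Longrightarrow> h ` V \<subseteq> carrier A \<Longrightarrow> (\<And>\<gamma>. \<gamma> \<in> \<Gamma> \<Longrightarrow> eval A h \<gamma> \<in> F) \<Longrightarrow>
    eval A h \<phi> \<in> F) \<Longrightarrow> valid K V \<Gamma> \<phi>"
  unfolding valid_def by auto

lemma is_logic_logic_of:
  fixes K :: "(('u, 'b) alg \<times> 'b set) set"
  assumes L: "dom L \<prec> (UNIV :: 'u set)" "0 \<notin> ran L"
    and V: "V \<prec> (UNIV :: 'u set)" "infinite V"
    and K: "\<And>A F. (A, F) \<in> K \<Longrightarrow> is_alg L A"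
  shows "is_logic (logic_of L V K)"
proof -
  have "is_consequence (logic_of L V K)"
    unfolding is_consequence_def
  proof (intro conjI allI impI)
    fix \<Gamma> \<Delta> :: "('u, 'u) trm set" and \<phi>
    assume *: "\<Gamma> \<subseteq> formulas (logic_of L V K) \<and> (\<forall>\<psi>\<in>\<Delta>. entails (logic_of L V K) \<Gamma> \<psi>) \<and>
      entails (logic_of L V K) \<Delta> \<phi>"
    have "valid K V \<Gamma> \<phi>"
    proof (rule validI)
      fix A F and h :: "'u \<Rightarrow> 'b"
      assume A: "(A, F) \<in> K" "h ` V \<subseteq> carrier A" and \<Gamma>: "\<And>\<gamma>. \<gamma> \<in> \<Gamma> \<Longrightarrow> eval A h \<gamma> \<in> F"
      have "eval A h \<psi> \<in> F" if "\<psi> \<in> \<Delta>" for \<psi>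
      proof (rule validD[OF _ A \<Gamma>])
        show "valid K V \<Gamma> \<psi>" using * that by simp
      qed
      moreover have "valid K V \<Delta> \<phi>" using * by simp
      ultimately show "eval A h \<phi> \<in> F" using validD A by blast
    qed
    then show "entails (logic_of L V K) \<Gamma> \<phi>" using * by simp
  qed (auto intro: validI)
  moreover have "substitution_invariant (logic_of L V K)"
    unfolding substitution_invariant_def
  proof (intro allI impI)
    fix \<sigma> :: "'u \<Rightarrow> ('u, 'u) trm" and \<Gamma> \<phi>
    assume *: "\<sigma> ` vars (logic_of L V K) \<subseteq> formulas (logic_of L V K) \<and> entails (logic_of L V K) \<Gamma> \<phi>"
    then have \<sigma>: "\<And>x. x \<in> V \<Longrightarrow> \<sigma> x \<in> Fm L V" and val: "valid K V \<Gamma> \<phi>"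
      and fm: "\<Gamma> \<subseteq> Fm L V" "\<phi> \<in> Fm L V" by auto
    have "valid K V (subst \<sigma> ` \<Gamma>) (subst \<sigma> \<phi>)"
    proof (rule validI)
      fix A F and h :: "'u \<Rightarrow> 'b"
      assume A: "(A, F) \<in> K" and h: "h ` V \<subseteq> carrier A"
        and \<Gamma>: "\<And>\<gamma>. \<gamma> \<in> subst \<sigma> ` \<Gamma> \<Longrightarrow> eval A h \<gamma> \<in> F"
      have "eval A (\<lambda>x. eval A h (\<sigma> x)) \<phi> \<in> F"
      proof (rule validD[OF val A])
        show "(\<lambda>x. eval A h (\<sigma> x)) ` V \<subseteq> carrier A"
          using eval_closed[OF K[OF A] \<sigma> h] by blast
        show "eval A (\<lambda>x. eval A h (\<sigma> x)) \<gamma> \<in> F" if "\<gamma> \<in> \<Gamma>" for \<gamma>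
          using \<Gamma>[of "subst \<sigma> \<gamma>"] that by (simp add: eval_subst)
      qed
      then show "eval A h (subst \<sigma> \<phi>) \<in> F" by (simp add: eval_subst)
    qed
    moreover have "subst \<sigma> t \<in> Fm L V" if "t \<in> Fm L V" for t
      using that \<sigma> by (rule subst_Fm)
    then have "subst \<sigma> ` \<Gamma> \<subseteq> Fm L V" "subst \<sigma> \<phi> \<in> Fm L V" using fm by auto
    ultimately show "entails (logic_of L V K) (subst \<sigma> ` \<Gamma>) (subst \<sigma> \<phi>)" by simp
  qed
  ultimately show ?thesis using L V by (simp add: is_logic_def)
qed

lemma Mod_logic_of:
  assumes "(A, F) \<in> K" "is_alg L A" "carrier A \<prec> (UNIV :: 'u set)" "F \<subseteq> carrier A"
  shows "(A :: ('u, 'u) alg, F) \<in> Mod (logic_of L V K)"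
proof -
  have "deductive_filter (logic_of L V K) A F"
  proof (rule deductive_filterI[OF assms(4)])
    fix \<Gamma> \<phi> and h :: "'u \<Rightarrow> 'u"
    assume ent: "entails (logic_of L V K) \<Gamma> \<phi>" and h: "h ` vars (logic_of L V K) \<subseteq> carrier A"
      and \<Gamma>: "eval A h ` \<Gamma> \<subseteq> F"
    show "eval A h \<phi> \<in> F"
      by (rule validD[OF _ assms(1)]) (use ent h \<Gamma> in auto)
  qed
  then show ?thesis using assms by (simp add: Mod_def)
qed

text \<open>\<open>W \<lesssim> V\<close> suffices because the rule can be renamed into the variables of the logic.\<close>

lemma deductive_filter_valid:
  assumes A: "is_alg L A" and F: "deductive_filter (logic_of L V K) A F"
    and W: "W \<lesssim> V" and fm: "\<Gamma> \<subseteq> Fm L W" "\<phi> \<in> Fm L W" and val: "valid K W \<Gamma> \<phi>"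
    and h: "h ` W \<subseteq> carrier A" and \<Gamma>: "\<And>\<gamma>. \<gamma> \<in> \<Gamma> \<Longrightarrow> eval A h \<gamma> \<in> F"
  shows "eval A h \<phi> \<in> F"
proof -
  obtain f where f: "inj_on f W" "f ` W \<subseteq> V" using W by (auto simp: lepoll_def)
  obtain a where a: "a \<in> carrier A" using A by (auto simp: is_alg_def)
  \<comment> \<open>Variables of \<open>V\<close> that do not come from \<open>W\<close> receive the
    arbitrary element \<open>a\<close>; the renamed formulas do not contain them.\<close>
  define g where "g v = (if v \<in> f ` W then h (inv_into W f v) else a)" for v
  let ?\<rho> = "subst (\<lambda>w. Var (f w))"
  have ev: "eval A g (?\<rho> t) = eval A h t" if "t \<in> Fm L W" for t
    unfolding eval_subst by (rule eval_cong[OF that]) (use f in \<open>simp add: g_def\<close>)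
  have \<rho>: "?\<rho> t \<in> Fm L V" if "t \<in> Fm L W" for t
    by (rule subst_Fm[OF that]) (use f in \<open>auto intro: Fm.Var\<close>)
  have "eval A g (?\<rho> \<phi>) \<in> F"
  proof (rule deductive_filter_entails[OF F])
    have "valid K V (?\<rho> ` \<Gamma>) (?\<rho> \<phi>)"
    proof (rule validI)
      fix B G k
      assume B: "(B, G) \<in> K" and k: "k ` V \<subseteq> carrier B"
        and *: "\<And>\<gamma>. \<gamma> \<in> ?\<rho> ` \<Gamma> \<Longrightarrow> eval B k \<gamma> \<in> G"
      have "eval B (\<lambda>w. k (f w)) \<phi> \<in> G"
      proof (rule validD[OF val B])
        show "(\<lambda>w. k (f w)) ` W \<subseteq> carrier B" using f k by blast
        show "eval B (\<lambda>w. k (f w)) \<gamma> \<in> G" if "\<gamma> \<in> \<Gamma>" for \<gamma>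
          using *[of "?\<rho> \<gamma>"] that by (simp add: eval_subst)
      qed
      then show "eval B k (?\<rho> \<phi>) \<in> G" by (simp add: eval_subst)
    qed
    then show "entails (logic_of L V K) (?\<rho> ` \<Gamma>) (?\<rho> \<phi>)" using fm \<rho> by auto
    show "g ` vars (logic_of L V K) \<subseteq> carrier A"
      using h a by (auto simp: g_def inv_into_into)
    show "eval A g \<gamma> \<in> F" if "\<gamma> \<in> ?\<rho> ` \<Gamma>" for \<gamma>
    proof -
      from that obtain \<gamma>' where "\<gamma>' \<in> \<Gamma>" "\<gamma> = ?\<rho> \<gamma>'" by blast
      then show ?thesis using \<Gamma> ev fm(1) by auto
    qed
  qed
  then show ?thesis using ev fm by simp
qed

text \<open>The common core of both constructions. Because \<Delta> defines true equality in the
  generating matrices, equations can be replaced by filter memberships, and implications with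
  equations become rules.\<close>

locale equality_class =
  fixes L :: "'f language" and V :: "'v set" and K :: "(('f, 'b) alg \<times> 'b set) set"
    and \<Delta> :: "('f, nat) trm set"
  assumes alg: "(A, F) \<in> K \<Longrightarrow> is_alg L A"
    and \<Delta>_nonempty: "\<Delta> \<noteq> {}" and \<Delta>_Fm: "\<Delta> \<subseteq> Fm L {..<2}"
    and equality: "(A, F) \<in> K \<Longrightarrow> a \<in> carrier A \<Longrightarrow> b \<in> carrier A \<Longrightarrow>
      eq_formulas \<Delta> A F a b \<longleftrightarrow> a = b"
    and infinite_V: "infinite V"
begin

lemma pair_Fm: "\<delta> \<in> \<Delta> \<Longrightarrow> u \<in> Fm L W \<Longrightarrow> v \<in> Fm L W \<Longrightarrow> subst (pair u v) \<delta> \<in> Fm L W"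
  using \<Delta>_Fm by (intro subst_Fm[of \<delta> L "{..<2}"]) (auto simp: pair_def)

lemma eq_formulas_eval:
  "eq_formulas \<Delta> A F (eval A h u) (eval A h v) \<longleftrightarrow> (\<forall>\<delta>\<in>\<Delta>. eval A h (subst (pair u v) \<delta>) \<in> F)"
proof -
  have "(\<lambda>k. eval A h (pair u v k)) = pair (eval A h u) (eval A h v)"
    by (auto simp: pair_def)
  then show ?thesis by (simp add: eq_formulas_def eval_subst)
qed

text \<open>An equation \<open>(u, v)\<close> in \<open>E\<close> is encoded by the formulas \<open>\<Delta>(u, v)\<close>.\<close>

lemma implication_mem:
  assumes A: "is_alg L A" and F: "deductive_filter (logic_of L V K) A F"
    and W: "W \<lesssim> V" and fm: "\<Gamma> \<subseteq> Fm L W" "E \<subseteq> Fm L W \<times> Fm L W" "\<phi> \<in> Fm L W"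
    and h: "h ` W \<subseteq> carrier A"
    and val: "\<And>B G k. (B, G) \<in> K \<Longrightarrow> k ` W \<subseteq> carrier B \<Longrightarrow>
      \<forall>\<gamma>\<in>\<Gamma>. eval B k \<gamma> \<in> G \<Longrightarrow>
      \<forall>(u, v)\<in>E. eval B k u = eval B k v \<Longrightarrow> eval B k \<phi> \<in> G"
    and \<Gamma>: "\<forall>\<gamma>\<in>\<Gamma>. eval A h \<gamma> \<in> F"
    and E: "\<forall>(u, v)\<in>E. eq_formulas \<Delta> A F (eval A h u) (eval A h v)"
  shows "eval A h \<phi> \<in> F"
proof -
  let ?E = "{subst (pair u v) \<delta> |u v \<delta>. (u, v) \<in> E \<and> \<delta> \<in> \<Delta>}"
  have "valid K W (\<Gamma> \<union> ?E) \<phi>"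
  proof (rule validI)
    fix B G k
    assume B: "(B, G) \<in> K" and k: "k ` W \<subseteq> carrier B"
      and *: "\<And>\<gamma>. \<gamma> \<in> \<Gamma> \<union> ?E \<Longrightarrow> eval B k \<gamma> \<in> G"
    show "eval B k \<phi> \<in> G"
    proof (rule val[OF B k], safe)
      fix u v assume uv: "(u, v) \<in> E"
      then have "eq_formulas \<Delta> B G (eval B k u) (eval B k v)"
        unfolding eq_formulas_eval using * by blast
      moreover have "eval B k u \<in> carrier B" "eval B k v \<in> carrier B"
        using uv fm(2) eval_closed[OF alg[OF B] _ k] by blast+
      ultimately show "eval B k u = eval B k v" using equality[OF B] by blast
    qed (use * in blast)
  qed
  moreover have "subst (pair u v) \<delta> \<in> Fm L W" if "(u, v) \<in> E" "\<delta> \<in> \<Delta>" for u v \<delta>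
    using that fm(2) by (intro pair_Fm) auto
  then have "\<Gamma> \<union> ?E \<subseteq> Fm L W" using fm(1) by blast
  moreover have "eval A h \<gamma> \<in> F" if "\<gamma> \<in> \<Gamma> \<union> ?E" for \<gamma>
    using that \<Gamma> E unfolding eq_formulas_eval by blast
  ultimately show ?thesis
    by (intro deductive_filter_valid[OF A F W _ fm(3) _ h]) auto
qed

text \<open>An equation is concluded through the formulas of \<Delta>, one rule for each. The
  conclusion is \<open>eq_formulas\<close> and not equality because \<open>A\<close> need not be
  reduced here.\<close>

lemma implication_eq:
  assumes A: "is_alg L A" and F: "deductive_filter (logic_of L V K) A F"
    and W: "W \<lesssim> V" and fm: "\<Gamma> \<subseteq> Fm L W" "E \<subseteq> Fm L W \<times> Fm L W" "s \<in> Fm L W" "t \<in> Fm L W"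
    and h: "h ` W \<subseteq> carrier A"
    and val: "\<And>B G k. (B, G) \<in> K \<Longrightarrow> k ` W \<subseteq> carrier B \<Longrightarrow>
      \<forall>\<gamma>\<in>\<Gamma>. eval B k \<gamma> \<in> G \<Longrightarrow>
      \<forall>(u, v)\<in>E. eval B k u = eval B k v \<Longrightarrow> eval B k s = eval B k t"
    and \<Gamma>: "\<forall>\<gamma>\<in>\<Gamma>. eval A h \<gamma> \<in> F"
    and E: "\<forall>(u, v)\<in>E. eq_formulas \<Delta> A F (eval A h u) (eval A h v)"
  shows "eq_formulas \<Delta> A F (eval A h s) (eval A h t)"
  unfolding eq_formulas_eval
proof
  fix \<delta> assume \<delta>: "\<delta> \<in> \<Delta>"
  show "eval A h (subst (pair s t) \<delta>) \<in> F"
  proof (rule implication_mem[OF A F W fm(1,2) pair_Fm[OF \<delta> fm(3,4)] h _ \<Gamma> E])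
    fix B G k
    assume B: "(B, G) \<in> K" and k: "k ` W \<subseteq> carrier B"
      and *: "\<forall>\<gamma>\<in>\<Gamma>. eval B k \<gamma> \<in> G" "\<forall>(u, v)\<in>E. eval B k u = eval B k v"
    have "eval B k s = eval B k t" by (rule val[OF B k *])
    moreover have "eval B k s \<in> carrier B" using eval_closed[OF alg[OF B] fm(3) k] .
    ultimately have "eq_formulas \<Delta> B G (eval B k s) (eval B k t)"
      using equality[OF B] by metis
    then show "eval B k (subst (pair s t) \<delta>) \<in> G"
      unfolding eq_formulas_eval using \<delta> by blast
  qed
qed

text \<open>The laws of equality, namely being a congruence and respecting the filter, are
  implications valid in \<open>K\<close>; they transfer to \<Delta> in every model, so \<Delta>
  defines a compatible congruence. Conversely, reflexivity puts \<Delta>\<open>(a, a)\<close> into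
  \<open>F\<close>, and a Leibniz pair carries it to \<Delta>\<open>(a, b)\<close>.\<close>

lemma Leibniz_eq_formulas:
  assumes A: "is_alg L A" and F: "deductive_filter (logic_of L V K) A F"
    and a: "a \<in> carrier A" and b: "b \<in> carrier A"
  shows "(a, b) \<in> Leibniz L A F \<longleftrightarrow> eq_formulas \<Delta> A F a b"
proof
  have W: "(UNIV :: nat set) \<lesssim> V" using infinite_V by (simp add: infinite_le_lepoll)
  note mem = implication_mem[OF A F W] and eq = implication_eq[OF A F W]
  let ?\<theta> = "{(a, b). a \<in> carrier A \<and> b \<in> carrier A \<and> eq_formulas \<Delta> A F a b}"
  have refl: "eq_formulas \<Delta> A F c c" if "c \<in> carrier A" for c
  proof -
    have "eq_formulas \<Delta> A F (eval A (\<lambda>_. c) (Var (0 :: nat))) (eval A (\<lambda>_. c) (Var (0 :: nat)))"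
      by (rule eq[of "{}" "{}"]) (use that in \<open>auto simp: Fm.Var\<close>)
    then show ?thesis by simp
  qed
  show "eq_formulas \<Delta> A F a b" if ab: "(a, b) \<in> Leibniz L A F"
    unfolding eq_formulas_def
  proof
    fix \<delta> assume \<delta>: "\<delta> \<in> \<Delta>"
    note cong = Leibniz_congruence[OF A, of F]
    have "(eval A (pair a a) \<delta>, eval A (pair a b) \<delta>) \<in> Leibniz L A F"
      by (rule congruence_eval[OF cong subsetD[OF \<Delta>_Fm \<delta>]])
        (use ab congruence_refl[OF cong a] in \<open>simp add: pair_def\<close>)
    moreover have "eval A (pair a a) \<delta> \<in> F" using refl[OF a] \<delta> by (simp add: eq_formulas_def)
    ultimately show "eval A (pair a b) \<delta> \<in> F" using Leibniz_iff[OF A] by blast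
  qed
  have "congruence L A ?\<theta>"
  proof (rule congruenceI)
    fix c d assume cd: "(c, d) \<in> ?\<theta>"
    have "eq_formulas \<Delta> A F (eval A (pair c d) (Var 1)) (eval A (pair c d) (Var 0))"
      by (rule eq[of "{}" "{(Var 0, Var 1)}"])
        (use cd in \<open>auto simp: Fm.Var image_subset_iff pair_def\<close>)
    then show "(d, c) \<in> ?\<theta>" using cd by (simp add: pair_def)
  next
    fix c d e assume cd: "(c, d) \<in> ?\<theta>" and de: "(d, e) \<in> ?\<theta>"
    let ?h = "\<lambda>k :: nat. if k = 0 then c else if k = 1 then d else e"
    have "eq_formulas \<Delta> A F (eval A ?h (Var 0)) (eval A ?h (Var 2))"
      by (rule eq[of "{}" "{(Var 0, Var 1), (Var 1, Var 2)}"])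
        (use cd de in \<open>auto simp: Fm.Var image_subset_iff\<close>)
    then show "(c, e) \<in> ?\<theta>" using cd de by simp
  next
    fix f as bs
    assume f: "L f = Some (length as)" and *: "list_all2 (\<lambda>a b. (a, b) \<in> ?\<theta>) as bs"
    have lists: "as \<in> lists (carrier A)" "bs \<in> lists (carrier A)"
      using * by (induction rule: list_all2_induct) auto
    have len: "length bs = length as" using * by (simp add: list_all2_lengthD)
    \<comment> \<open>Both argument lists are interleaved in one valuation: variable
      \<open>2 * k\<close> holds the \<open>k\<close>-th entry of \<open>as\<close> and
      \<open>2 * k + 1\<close> that of \<open>bs\<close>. Beyond the lists the valuation takes the
      value \<open>a\<close>, merely to stay in the carrier.\<close>
    let ?n = "length as"
    let ?h = "\<lambda>m. if m < 2 * ?n then (if even m then as ! (m div 2) else bs ! (m div 2)) else a"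
    let ?s = "App f (map (\<lambda>k. Var (2 * k)) [0..<?n])"
    let ?t = "App f (map (\<lambda>k. Var (2 * k + 1)) [0..<?n])"
    have s: "eval A ?h ?s = oper A f as"
    proof -
      have "map (eval A ?h) (map (\<lambda>k. Var (2 * k)) [0..<?n]) = as"
        by (rule nth_equalityI) auto
      then show ?thesis by (simp only: eval.simps)
    qed
    have t: "eval A ?h ?t = oper A f bs"
    proof -
      have "map (eval A ?h) (map (\<lambda>k. Var (2 * k + 1)) [0..<?n]) = bs"
        by (rule nth_equalityI) (auto simp: len)
      then show ?thesis by (simp only: eval.simps)
    qed
    have "eq_formulas \<Delta> A F (eval A ?h ?s) (eval A ?h ?t)"
    proof (rule eq[of "{}" "{(Var (2 * k), Var (2 * k + 1)) |k. k < ?n}"])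
      show "?s \<in> Fm L UNIV" "?t \<in> Fm L UNIV"
        using f by (auto intro!: Fm.App Fm.Var)
      show "?h ` UNIV \<subseteq> carrier A"
        using lists a len by (auto simp: in_lists_conv_set)
      show "eval B k ?s = eval B k ?t"
        if "\<forall>(u, v)\<in>{(Var (2 * k), Var (2 * k + 1)) |k. k < ?n}. eval B k u = eval B k v"
        for B :: "('f, 'b) alg" and k
      proof -
        have "k (2 * i) = k (2 * i + 1)" if "i < ?n" for i
          using \<open>\<forall>(u, v)\<in>_. _\<close> that by fastforce
        then have "map (eval B k) (map (\<lambda>k. Var (2 * k)) [0..<?n]) =
            map (eval B k) (map (\<lambda>k. Var (2 * k + 1)) [0..<?n])" by simp
        then show ?thesis by (simp only: eval.simps)
      qed
      show "\<forall>(u, v)\<in>{(Var (2 * k), Var (2 * k + 1)) |k. k < ?n}.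
          eq_formulas \<Delta> A F (eval A ?h u) (eval A ?h v)"
      proof -
        have "eq_formulas \<Delta> A F (as ! k) (bs ! k)" if "k < ?n" for k
          using * that by (auto simp: list_all2_conv_all_nth)
        then show ?thesis by auto
      qed
    qed (auto intro: Fm.Var)
    then show "(oper A f as, oper A f bs) \<in> ?\<theta>"
      unfolding s t using A f lists len by (auto simp: is_alg_def)
  qed (use refl in auto)
  moreover have "compatible ?\<theta> F"
    unfolding compatible_def
  proof clarify
    fix c d assume cd: "c \<in> carrier A" "d \<in> carrier A" "eq_formulas \<Delta> A F c d" and c: "c \<in> F"
    have "eval A (pair c d) (Var 1) \<in> F"
      by (rule mem[of "{Var 0}" "{(Var 0, Var 1)}"])
        (use cd c in \<open>auto simp: Fm.Var image_subset_iff pair_def\<close>)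
    then show "d \<in> F" by (simp add: pair_def)
  qed
  ultimately have "?\<theta> \<subseteq> Leibniz L A F" by (rule Leibniz_greatest[OF A])
  then show "(a, b) \<in> Leibniz L A F" if "eq_formulas \<Delta> A F a b" using that a b by blast
qed

end

lemma defines_Leibniz_logic_of:
  fixes L :: "'u language" and V :: "'u set"
  assumes "equality_class L V K \<Delta>"
  shows "defines_Leibniz \<Delta> (logic_of L V K)"
proof -
  interpret equality_class L V K \<Delta> by fact
  show ?thesis
    unfolding defines_Leibniz_def
    using \<Delta>_nonempty \<Delta>_Fm by (auto simp: Mod_def Leibniz_eq_formulas)
qed

text \<open>The transfer principle for all later arguments. In a reduced model \<Delta> defines
  equality, so implications that hold in \<open>K\<close> hold there literally, with arbitrarily
  many premises of both kinds.\<close>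

lemma
  fixes L :: "'u language" and V :: "'u set"
  assumes K: "equality_class L V K \<Delta>" and A: "(A, F) \<in> Mod_equiv (logic_of L V K)"
    and W: "W \<lesssim> V" and fm: "\<Gamma> \<subseteq> Fm L W" "E \<subseteq> Fm L W \<times> Fm L W"
    and h: "h ` W \<subseteq> carrier A"
    and \<Gamma>: "\<forall>\<gamma>\<in>\<Gamma>. eval A h \<gamma> \<in> F"
    and E: "\<forall>(u, v)\<in>E. eval A h u = eval A h v"
  shows reduced_implication_mem: "\<phi> \<in> Fm L W \<Longrightarrow>
      (\<And>B G k. (B, G) \<in> K \<Longrightarrow> k ` W \<subseteq> carrier B \<Longrightarrow> \<forall>\<gamma>\<in>\<Gamma>. eval B k \<gamma> \<in> G \<Longrightarrow>
        \<forall>(u, v)\<in>E. eval B k u = eval B k v \<Longrightarrow> eval B k \<phi> \<in> G) \<Longrightarrow>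
      eval A h \<phi> \<in> F"
    and reduced_implication_eq: "s \<in> Fm L W \<Longrightarrow> t \<in> Fm L W \<Longrightarrow>
      (\<And>B G k. (B, G) \<in> K \<Longrightarrow> k ` W \<subseteq> carrier B \<Longrightarrow> \<forall>\<gamma>\<in>\<Gamma>. eval B k \<gamma> \<in> G \<Longrightarrow>
        \<forall>(u, v)\<in>E. eval B k u = eval B k v \<Longrightarrow> eval B k s = eval B k t) \<Longrightarrow>
      eval A h s = eval A h t"
proof -
  interpret equality_class L V K \<Delta> by fact
  have alg: "is_alg L A" and F: "deductive_filter (logic_of L V K) A F"
    using Mod_equivD(1,3)[OF A] by simp_all
  have eq: "eq_formulas \<Delta> A F (eval A h u) (eval A h v) \<longleftrightarrow> eval A h u = eval A h v"
    if "u \<in> Fm L W" "v \<in> Fm L W" for u v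
    using eq_formulas_Mod_equiv[OF defines_Leibniz_logic_of[OF K] A] eval_closed[OF alg _ h] that
    by blast
  have E': "\<forall>(u, v)\<in>E. eq_formulas \<Delta> A F (eval A h u) (eval A h v)"
    using E eq fm(2) by blast
  show "eval A h \<phi> \<in> F" if "\<phi> \<in> Fm L W"
    "\<And>B G k. (B, G) \<in> K \<Longrightarrow> k ` W \<subseteq> carrier B \<Longrightarrow> \<forall>\<gamma>\<in>\<Gamma>. eval B k \<gamma> \<in> G \<Longrightarrow>
        \<forall>(u, v)\<in>E. eval B k u = eval B k v \<Longrightarrow> eval B k \<phi> \<in> G"
    by (rule implication_mem[OF alg F W fm that(1) h that(2) \<Gamma> E'])
  show "eval A h s = eval A h t" if st: "s \<in> Fm L W" "t \<in> Fm L W"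
    "\<And>B G k. (B, G) \<in> K \<Longrightarrow> k ` W \<subseteq> carrier B \<Longrightarrow> \<forall>\<gamma>\<in>\<Gamma>. eval B k \<gamma> \<in> G \<Longrightarrow>
        \<forall>(u, v)\<in>E. eval B k u = eval B k v \<Longrightarrow> eval B k s = eval B k t"
    unfolding eq[OF st(1,2), symmetric]
    by (rule implication_eq[OF alg F W fm st(1,2) h st(3) \<Gamma> E'])
qed


section \<open>Translations by symbols, and families of equivalential logics\<close>

lemma eval_vars: "length as = n \<Longrightarrow> map (eval A ((!) as)) (map Var [0..<n]) = as"
  by (rule nth_equalityI) auto

lemma oper_reduct_App:
  "length as = n f \<Longrightarrow> oper (reduct (\<lambda>f. App (g f) (map Var [0..<n f])) A) f as = oper A (g f) as"
  using eval_vars[of as "n f" A] by (simp add: reduct_def del: map_map)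

lemma interpretableI:
  assumes "is_translation \<tau> (lang l) (lang l')"
    and "\<And>A F. (A, F) \<in> Mod_equiv l' \<Longrightarrow> (reduct \<tau> A, F) \<in> Mod_equiv l"
  shows "interpretable l l'"
  using assms by (auto simp: interpretable_def is_interpretation_def)

locale equivalential_family = universe U for U :: "'u itself" +
  fixes I :: "'i set" and l :: "'i \<Rightarrow> ('u, 'u) logic" and \<Delta> :: "'i \<Rightarrow> ('u, nat) trm set"
  assumes small_I: "small U I"
    and logic: "i \<in> I \<Longrightarrow> is_logic (l i)"
    and \<Delta>: "i \<in> I \<Longrightarrow> defines_Leibniz (\<Delta> i) (l i)"
begin

lemma cons: "i \<in> I \<Longrightarrow> is_consequence (l i)"
  using logic by (auto simp: is_logic_def)

lemma small_lang: "i \<in> I \<Longrightarrow> small U (dom (lang (l i)))"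
  using logic by (auto simp: is_logic_def)

lemma family_Fm: "i \<in> I \<Longrightarrow> \<Delta> i \<subseteq> Fm (lang (l i)) {..<2}"
  using \<Delta> by (auto simp: defines_Leibniz_def)

lemma family_nonempty: "i \<in> I \<Longrightarrow> \<Delta> i \<noteq> {}"
  using \<Delta> by (auto simp: defines_Leibniz_def)

end


section \<open>Suprema\<close>

text \<open>\<open>code\<close> names the symbols of the disjoint union of the languages. The index
  \<open>i0\<close> selects the member whose formulas serve as equivalence formulas of the sum; one
  member is enough because the filter is shared by all reducts.\<close>

locale sum_of_logics = equivalential_family U I l \<Delta>
  for U :: "'u itself" and I :: "'i set" and l and \<Delta> +
  fixes code :: "'i \<times> 'u \<Rightarrow> 'u" and i0 :: 'i
  assumes inj_code: "inj_on code (SIGMA i:I. dom (lang (l i)))"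
    and i0: "i0 \<in> I"
begin

abbreviation "syms \<equiv> SIGMA i:I. dom (lang (l i))"

definition L :: "'u language" where
  "L u = (if u \<in> code ` syms then (case inv_into syms code u of (i, f) \<Rightarrow> lang (l i) f) else None)"

definition \<iota> :: "'i \<Rightarrow> 'u \<Rightarrow> ('u, nat) trm" where
  "\<iota> i f = App (code (i, f)) (map Var [0..<the (lang (l i) f)])"

definition K :: "(('u, 'u) alg \<times> 'u set) set" where
  "K = {(A, F). is_alg L A \<and> small U (carrier A) \<and> (\<forall>i\<in>I. (reduct (\<iota> i) A, F) \<in> Mod_equiv (l i))}"

text \<open>Large enough that every rule of every member can be written in the variables of the
  sum.\<close>

definition V :: "'u set" where
  "V = (\<Union>i\<in>I. vars (l i))"

definition D :: "('u, nat) trm set" where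
  "D = translate (\<iota> i0) ` \<Delta> i0"

lemma inv_code: "i \<in> I \<Longrightarrow> lang (l i) f = Some n \<Longrightarrow> inv_into syms code (code (i, f)) = (i, f)"
  by (rule inv_into_f_f[OF inj_code]) auto

lemma L_code: "i \<in> I \<Longrightarrow> lang (l i) f = Some n \<Longrightarrow> L (code (i, f)) = Some n"
  using inv_code[of i f n] by (force simp: L_def)

lemma L_cases:
  assumes "L u = Some n"
  obtains i f where "i \<in> I" "lang (l i) f = Some n" "u = code (i, f)"
proof -
  have "u \<in> code ` syms" using assms by (auto simp: L_def split: if_splits)
  then obtain i f m where *: "i \<in> I" "lang (l i) f = Some m" "u = code (i, f)" by auto
  then show thesis using that[of i f] L_code[of i f m] assms by simp
qed

lemma \<iota>: "i \<in> I \<Longrightarrow> is_translation (\<iota> i) (lang (l i)) L"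
  unfolding is_translation_def \<iota>_def using L_code by (auto intro!: App_vars_Fm)

lemma oper_\<iota>: "lang (l i) f = Some (length as) \<Longrightarrow> oper (reduct (\<iota> i) A) f as = oper A (code (i, f)) as"
  unfolding \<iota>_def using oper_reduct_App[of as "\<lambda>f. the (lang (l i) f)" f "\<lambda>f. code (i, f)" A] by simp

lemma vars_lepoll: "i \<in> I \<Longrightarrow> vars (l i) \<lesssim> V"
  by (rule subset_imp_lepoll) (auto simp: V_def)

lemma K_D:
  assumes "(A, F) \<in> K"
  shows "is_alg L A" "i \<in> I \<Longrightarrow> (reduct (\<iota> i) A, F) \<in> Mod_equiv (l i)"
  using assms by (auto simp: K_def)

text \<open>On a matrix of \<open>K\<close> the formulas of each member, and not only those of
  \<open>i0\<close>, define equality. This is the implication that later makes the reduct to each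
  member reduced.\<close>

lemma K_eq:
  assumes "(A, F) \<in> K" "i \<in> I" "a \<in> carrier A" "b \<in> carrier A"
  shows "eq_formulas (\<Delta> i) (reduct (\<iota> i) A) F a b \<longleftrightarrow> a = b"
  by (rule eq_formulas_Mod_equiv[OF \<Delta> K_D(2)[OF assms(1)]]) (use assms in simp_all)

sublocale equality_class L V K D
proof
  show "D \<noteq> {}" using family_nonempty[OF i0] by (simp add: D_def)
  show "D \<subseteq> Fm L {..<2}"
    unfolding D_def using family_Fm[OF i0] translate_Fm[OF \<iota>[OF i0]] by blast
  show "infinite V"
    using logic[OF i0] i0 infinite_super[of "vars (l i0)" V] by (auto simp: is_logic_def V_def)
  show "is_alg L A" if "(A, F) \<in> K" for A F using K_D(1)[OF that] .
  show "eq_formulas D A F a b \<longleftrightarrow> a = b"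
    if "(A, F) \<in> K" "a \<in> carrier A" "b \<in> carrier A" for A F a b
    unfolding D_def eq_formulas_translate[OF \<iota>[OF i0] family_Fm[OF i0]] using K_eq[OF that(1) i0 that(2,3)] .
qed

definition sum :: "('u, 'u) logic" where
  "sum = logic_of L V K"

lemma defines_Leibniz_sum: "defines_Leibniz D sum"
  unfolding sum_def by (rule defines_Leibniz_logic_of) unfold_locales

lemma is_logic_sum: "is_logic sum"
  unfolding sum_def
proof (rule is_logic_logic_of)
  have "dom L \<subseteq> code ` syms" by (auto simp: L_def split: if_splits)
  moreover have "small U (code ` syms)" by (intro small_image small_Sigma small_I small_lang)
  ultimately show "small U (dom L)" by (rule small_subset)
  show "0 \<notin> ran L"
  proof
    assume "0 \<in> ran L"
    then obtain u where "L u = Some 0" by (auto simp: ran_def)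
    then obtain i f where "i \<in> I" "lang (l i) f = Some 0" by (rule L_cases)
    then show False using logic[of i] by (auto simp: is_logic_def ran_def)
  qed
  show "small U V"
    unfolding V_def using logic by (intro small_UN small_I) (simp add: is_logic_def)
  show "infinite V" by (rule infinite_V)
qed (rule alg)

text \<open>A reduced model of the sum is not assumed to lie in \<open>K\<close>. Its reduct is a
  model because the translated rules of \<open>l i\<close> are valid in \<open>K\<close>, and it is
  reduced because equality defined by \<Delta> \<open>i\<close> is an implication valid in
  \<open>K\<close>.\<close>

lemma sum_upper:
  assumes i: "i \<in> I" shows "interpretable (l i) sum"
proof (rule interpretableI)
  show "is_translation (\<iota> i) (lang (l i)) (lang sum)" using \<iota>[OF i] by (simp add: sum_def)
  fix A F assume AF: "(A, F) \<in> Mod_equiv sum"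
  note AF' = AF[unfolded sum_def] and ec = equality_class_axioms
  have A: "is_alg L A" and small: "small U (carrier A)" and F: "F \<subseteq> carrier A"
    using Mod_equivD[OF AF'] by (simp_all add: deductive_filter_def)
  have red: "is_alg (lang (l i)) (reduct (\<iota> i) A)" by (rule is_alg_reduct[OF \<iota>[OF i] A])
  have ev: "eval (reduct (\<iota> i) B) h t = eval B h (translate (\<iota> i) t)"
    if "t \<in> Fm (lang (l i)) W" for B :: "('u, 'u) alg" and h and t :: "('u, 'w) trm" and W
    by (rule eval_reduct[OF \<iota>[OF i] that])
  have "deductive_filter (l i) (reduct (\<iota> i) A) F"
  proof (rule deductive_filterI)
    fix \<Gamma> \<phi> and h :: "'u \<Rightarrow> 'u"
    assume ent: "entails (l i) \<Gamma> \<phi>" and h: "h ` vars (l i) \<subseteq> carrier (reduct (\<iota> i) A)"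
      and \<Gamma>: "eval (reduct (\<iota> i) A) h ` \<Gamma> \<subseteq> F"
    note fm = entails_formulas[OF cons[OF i] ent]
    have "eval A h (translate (\<iota> i) \<phi>) \<in> F"
    proof (rule reduced_implication_mem[OF ec AF' vars_lepoll[OF i],
          where \<Gamma> = "translate (\<iota> i) ` \<Gamma>" and E = "{}"])
      show "translate (\<iota> i) ` \<Gamma> \<subseteq> Fm L (vars (l i))" "translate (\<iota> i) \<phi> \<in> Fm L (vars (l i))"
        using translate_Fm[OF \<iota>[OF i]] fm by blast+
      show "\<forall>\<gamma>\<in>translate (\<iota> i) ` \<Gamma>. eval A h \<gamma> \<in> F"
        using \<Gamma> ev fm(1) by fastforce
      show "eval B k (translate (\<iota> i) \<phi>) \<in> G"
        if B: "(B, G) \<in> K" and k: "k ` vars (l i) \<subseteq> carrier B"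
          and *: "\<forall>\<gamma>\<in>translate (\<iota> i) ` \<Gamma>. eval B k \<gamma> \<in> G" for B G k
      proof -
        have "eval (reduct (\<iota> i) B) k \<phi> \<in> G"
        proof (rule deductive_filter_entails[OF Mod_equivD(3)[OF K_D(2)[OF B i]] ent])
          show "k ` vars (l i) \<subseteq> carrier (reduct (\<iota> i) B)" using k by simp
          show "eval (reduct (\<iota> i) B) k \<gamma> \<in> G" if "\<gamma> \<in> \<Gamma>" for \<gamma>
            using * that ev[OF subsetD[OF fm(1) that]] by simp
        qed
        then show ?thesis using ev[OF fm(2)] by simp
      qed
    qed (use h in simp_all)
    then show "eval (reduct (\<iota> i) A) h \<phi> \<in> F" using ev[OF fm(2)] by simp
  qed (use F in simp)
  then have mod: "(reduct (\<iota> i) A, F) \<in> Mod (l i)" using red small by (simp add: Mod_def)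
  show "(reduct (\<iota> i) A, F) \<in> Mod_equiv (l i)"
  proof (rule Mod_equiv_eq_formulasI[OF \<Delta>[OF i] mod])
    fix a b assume ab: "a \<in> carrier (reduct (\<iota> i) A)" "b \<in> carrier (reduct (\<iota> i) A)"
      and eq: "eq_formulas (\<Delta> i) (reduct (\<iota> i) A) F a b"
    note tr = eq_formulas_translate[OF \<iota>[OF i] family_Fm[OF i]]
    \<comment> \<open>The transferred implication reads: if all formulas of
      \<Delta>\<open>(x, y)\<close> of the \<open>i\<close>-th member hold, then
      \<open>x = y\<close>.\<close>
    have "eval A (pair a b) (Var 0) = eval A (pair a b) (Var 1)"
    proof (rule reduced_implication_eq[OF ec AF', where W = "{..<2}" and E = "{}"
          and \<Gamma> = "translate (\<iota> i) ` \<Delta> i"])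
      show "{..<2 :: nat} \<lesssim> V" by (rule finite_lepoll_infinite[OF infinite_V]) simp
      show \<Gamma>: "translate (\<iota> i) ` \<Delta> i \<subseteq> Fm L {..<2}"
        using translate_Fm[OF \<iota>[OF i]] family_Fm[OF i] by blast
      show "\<forall>\<gamma>\<in>translate (\<iota> i) ` \<Delta> i. eval A (pair a b) \<gamma> \<in> F"
        using eq[folded tr] by (simp add: eq_formulas_def)
      show "eval B k (Var 0) = eval B k (Var 1)"
        if B: "(B, G) \<in> K" and k: "k ` {..<2} \<subseteq> carrier B"
          and *: "\<forall>\<gamma>\<in>translate (\<iota> i) ` \<Delta> i. eval B k \<gamma> \<in> G" for B G k
      proof -
        have "eval B k \<gamma> = eval B (pair (k 0) (k 1)) \<gamma>" if "\<gamma> \<in> Fm L {..<2}" for \<gamma>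
          by (rule eval_cong[OF that]) (auto simp: pair_def less_2_cases_iff)
        then have "eq_formulas (translate (\<iota> i) ` \<Delta> i) B G (k 0) (k 1)"
          using * \<Gamma> unfolding eq_formulas_def by (metis subsetD)
        moreover have "k 0 \<in> carrier B" "k 1 \<in> carrier B" using k by auto
        ultimately show ?thesis using K_eq[OF B i] unfolding tr by simp
      qed
    qed (use ab in \<open>auto simp: pair_def Fm.Var\<close>)
    then show "a = b" by (simp add: pair_def)
  qed
qed

text \<open>The given interpretations glue to one translation on the disjoint union, under which
  every reduced model of \<open>l'\<close> has its reduct in \<open>K\<close>.\<close>

lemma sum_least:
  assumes l': "is_logic l'" and up: "\<And>i. i \<in> I \<Longrightarrow> interpretable (l i) l'"
  shows "interpretable sum l'"
proof -
  have "\<forall>i\<in>I. \<exists>\<tau>. is_interpretation \<tau> (l i) l'" using up by (simp add: interpretable_def)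
  then obtain \<tau> where \<tau>: "\<And>i. i \<in> I \<Longrightarrow> is_interpretation (\<tau> i) (l i) l'" by metis
  then have trans: "is_translation (\<tau> i) (lang (l i)) (lang l')"
    and red: "(A, F) \<in> Mod_equiv l' \<Longrightarrow> (reduct (\<tau> i) A, F) \<in> Mod_equiv (l i)" if "i \<in> I" for i A F
    using that by (auto simp: is_interpretation_def)
  define \<sigma> where "\<sigma> u = (case inv_into syms code u of (i, f) \<Rightarrow> \<tau> i f)" for u
  have \<sigma>_code: "\<sigma> (code (i, f)) = \<tau> i f" if "i \<in> I" "lang (l i) f = Some n" for i f n
    using inv_code[OF that] by (simp add: \<sigma>_def)
  have \<sigma>: "is_translation \<sigma> L (lang l')"
    unfolding is_translation_def
  proof (intro allI impI)
    fix u n assume "L u = Some n"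
    then obtain i f where "i \<in> I" "lang (l i) f = Some n" "u = code (i, f)" by (rule L_cases)
    then show "\<sigma> u \<in> Fm (lang l') {..<n}"
      using trans[of i] \<sigma>_code by (auto simp: is_translation_def)
  qed
  show ?thesis
  proof (rule interpretableI)
    show "is_translation \<sigma> (lang sum) (lang l')" using \<sigma> by (simp add: sum_def)
    fix A F assume AF: "(A, F) \<in> Mod_equiv l'"
    note A = Mod_equivD[OF AF]
    have alg: "is_alg L (reduct \<sigma> A)" by (rule is_alg_reduct[OF \<sigma> A(1)])
    \<comment> \<open>The two reducts agree only on symbols of the \<open>i\<close>-th language,
      whence \<open>Mod_equiv_cong\<close>.\<close>
    have "(reduct (\<iota> i) (reduct \<sigma> A), F) \<in> Mod_equiv (l i)" if i: "i \<in> I" for i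
    proof (rule Mod_equiv_cong[OF cons[OF i] red[OF i AF]])
      show "oper (reduct (\<iota> i) (reduct \<sigma> A)) f as = oper (reduct (\<tau> i) A) f as"
        if f: "lang (l i) f = Some (length as)" for f as
        using oper_\<iota>[OF f] \<sigma>_code[OF i f] by (simp add: reduct_def)
    qed simp
    then have K: "(reduct \<sigma> A, F) \<in> K" using alg A(2) by (simp add: K_def)
    have "(reduct \<sigma> A, F) \<in> Mod sum"
      unfolding sum_def
      using A(2,3) by (intro Mod_logic_of[OF K alg]) (simp_all add: deductive_filter_def)
    then show "(reduct \<sigma> A, F) \<in> Mod_equiv sum"
      by (rule Mod_equiv_eq_formulasI[OF defines_Leibniz_sum]) (use equality[OF K] in blast)
  qed
qed

end

lemma (in universe) ex_supremum:
  fixes l :: "'i \<Rightarrow> ('u, 'u) logic"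
  assumes I: "small U I" "I \<noteq> {}"
    and l: "\<And>i. i \<in> I \<Longrightarrow> is_logic (l i)" "\<And>i. i \<in> I \<Longrightarrow> equivalential (l i)"
  shows "\<exists>s. is_logic s \<and> equivalential s \<and> (\<forall>i\<in>I. interpretable (l i) s) \<and>
    (\<forall>l'. is_logic l' \<and> (\<forall>i\<in>I. interpretable (l i) l') \<longrightarrow> interpretable s l')"
proof -
  have "\<forall>i\<in>I. \<exists>\<Delta>. defines_Leibniz \<Delta> (l i)" using l equivalential_iff by blast
  then obtain \<Delta> where \<Delta>: "\<And>i. i \<in> I \<Longrightarrow> defines_Leibniz (\<Delta> i) (l i)" by metis
  interpret equivalential_family U I l \<Delta>
    by unfold_locales (use I l \<Delta> in auto)
  have "small U (SIGMA i:I. dom (lang (l i)))" by (intro small_Sigma small_I small_lang)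
  then obtain code :: "'i \<times> 'u \<Rightarrow> 'u" where code: "inj_on code (SIGMA i:I. dom (lang (l i)))"
    using ex_code by blast
  obtain i0 where i0: "i0 \<in> I" using I by blast
  interpret sum_of_logics U I l \<Delta> code i0
    by unfold_locales (use code i0 in auto)
  show ?thesis
    using is_logic_sum sum_upper sum_least defines_Leibniz_sum equivalential_iff[OF is_logic_sum] by blast
qed


text \<open>Evaluation never consults the carrier, so restricting the carrier of an algebra leaves
  it unchanged.\<close>

lemma eval_oper_cong: "oper A = oper B \<Longrightarrow> eval A h t = eval B h t"
  by (induction t) (simp_all cong: map_cong)

section \<open>Infima\<close>

text \<open>An \<open>n\<close>-ary symbol of the non-indexed product is a family of \<open>n\<close>-ary terms, one
  in each factor.\<close>

locale product_of_logics = equivalential_family U I l \<Delta>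
  for U :: "'u itself" and I :: "'i set" and l and \<Delta> +
  fixes code :: "nat \<times> ('i \<Rightarrow> ('u, nat) trm) \<Rightarrow> 'u" and V :: "'u set"
  assumes inj_code: "inj_on code (SIGMA n:{0<..}. \<Pi>\<^sub>E i\<in>I. Fm (lang (l i)) {..<n})"
    and small_V: "small U V" and inf_V: "infinite V" and vars_V: "i \<in> I \<Longrightarrow> vars (l i) \<subseteq> V"
begin

text \<open>Arities start at one since a language has no constants; extensional families keep the
  collection small.\<close>

abbreviation "syms \<equiv> SIGMA n:{0<..}. \<Pi>\<^sub>E i\<in>I. Fm (lang (l i)) {..<n}"

definition L :: "'u language" where
  "L u = (if u \<in> code ` syms then Some (fst (inv_into syms code u)) else None)"

definition \<pi> :: "'i \<Rightarrow> 'u \<Rightarrow> ('u, nat) trm" where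
  "\<pi> i u = snd (inv_into syms code u) i"

definition sym :: "nat \<Rightarrow> ('i \<Rightarrow> ('u, nat) trm) \<Rightarrow> 'u" where
  "sym n t = code (n, restrict t I)"

definition Prod :: "('i \<Rightarrow> ('u, 'u) alg \<times> 'u set) \<Rightarrow> ('u, 'i \<Rightarrow> 'u) alg" where
  "Prod M = \<lparr>carrier = (\<Pi>\<^sub>E i\<in>I. carrier (fst (M i))),
     oper = \<lambda>u as. \<lambda>i\<in>I. oper (reduct (\<pi> i) (fst (M i))) u (map (\<lambda>a. a i) as)\<rparr>"

definition K :: "(('u, 'i \<Rightarrow> 'u) alg \<times> ('i \<Rightarrow> 'u) set) set" where
  "K = {(Prod M, \<Pi>\<^sub>E i\<in>I. snd (M i)) |M. \<forall>i\<in>I. M i \<in> Mod_equiv (l i)}"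

text \<open>A choice of one equivalence formula from each member is a family of binary terms, hence
  a symbol of the product language.\<close>

definition D :: "('u, nat) trm set" where
  "D = {App (sym 2 \<delta>) [Var 0, Var 1] |\<delta>. \<delta> \<in> (\<Pi>\<^sub>E i\<in>I. \<Delta> i)}"

definition prod :: "('u, 'u) logic" where
  "prod = logic_of L V K"

lemma sym_in_syms:
  "0 < n \<Longrightarrow> (\<And>i. i \<in> I \<Longrightarrow> t i \<in> Fm (lang (l i)) {..<n}) \<Longrightarrow> (n, restrict t I) \<in> syms"
  by auto

lemma L_sym:
  assumes "0 < n" "\<And>i. i \<in> I \<Longrightarrow> t i \<in> Fm (lang (l i)) {..<n}"
  shows "L (sym n t) = Some n"
  using sym_in_syms[OF assms] inv_into_f_f[OF inj_code sym_in_syms[OF assms]]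
  by (simp add: L_def sym_def)

lemma \<pi>_sym:
  assumes "0 < n" "\<And>i. i \<in> I \<Longrightarrow> t i \<in> Fm (lang (l i)) {..<n}" "i \<in> I"
  shows "\<pi> i (sym n t) = t i"
  using inv_into_f_f[OF inj_code sym_in_syms[OF assms(1,2)]] assms(3) by (simp add: \<pi>_def sym_def)

lemma L_cases:
  assumes "L u = Some n"
  obtains t where "0 < n" "\<And>i. i \<in> I \<Longrightarrow> t i \<in> Fm (lang (l i)) {..<n}" "u = sym n t"
proof -
  have "u \<in> code ` syms" using assms by (auto simp: L_def split: if_splits)
  then obtain m t where t: "0 < m" "t \<in> (\<Pi>\<^sub>E i\<in>I. Fm (lang (l i)) {..<m})" "u = code (m, t)" by auto
  then have "u = sym m t" by (simp add: sym_def PiE_restrict)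
  moreover have "m = n" using L_sym[of m t] t assms \<open>u = sym m t\<close> by auto
  ultimately show thesis using that[of t] t by auto
qed

lemma \<pi>: "i \<in> I \<Longrightarrow> is_translation (\<pi> i) L (lang (l i))"
  unfolding is_translation_def
proof (intro allI impI)
  fix u n assume i: "i \<in> I" and "L u = Some n"
  then obtain t where "0 < n" "\<And>i. i \<in> I \<Longrightarrow> t i \<in> Fm (lang (l i)) {..<n}" "u = sym n t"
    using L_cases by metis
  then show "\<pi> i u \<in> Fm (lang (l i)) {..<n}" using \<pi>_sym i by simp
qed

lemma oper_\<pi>_sym:
  assumes "0 < n" "\<And>i. i \<in> I \<Longrightarrow> t i \<in> Fm (lang (l i)) {..<n}" "i \<in> I"
  shows "oper (reduct (\<pi> i) A) (sym n t) as = eval A ((!) as) (t i)"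
  using \<pi>_sym[OF assms] by (simp add: reduct_def)

lemma K_cases:
  assumes "(B, G) \<in> K"
  obtains M where "\<forall>i\<in>I. M i \<in> Mod_equiv (l i)" "B = Prod M" "G = (\<Pi>\<^sub>E i\<in>I. snd (M i))"
  using assms by (auto simp: K_def)

lemma carrier_Prod [simp]: "carrier (Prod M) = (\<Pi>\<^sub>E i\<in>I. carrier (fst (M i)))"
  by (simp add: Prod_def)

lemma is_alg_factor: "X \<in> Mod_equiv (l i) \<Longrightarrow> is_alg (lang (l i)) (fst X)"
  using Mod_equivD(1)[of "fst X" "snd X"] by simp

lemma oper_Prod:
  "i \<in> I \<Longrightarrow> oper (Prod M) u as i = oper (reduct (\<pi> i) (fst (M i))) u (map (\<lambda>a. a i) as)"
  by (simp add: Prod_def)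

lemma is_alg_Prod:
  assumes M: "\<And>i. i \<in> I \<Longrightarrow> M i \<in> Mod_equiv (l i)"
  shows "is_alg L (Prod M)"
proof -
  have red: "is_alg L (reduct (\<pi> i) (fst (M i)))" if "i \<in> I" for i
    by (rule is_alg_reduct[OF \<pi>[OF that] is_alg_factor[OF M[OF that]]])
  have "carrier (Prod M) \<noteq> {}"
    using red by (auto simp: PiE_eq_empty_iff is_alg_def)
  moreover have "oper (Prod M) f as \<in> carrier (Prod M)"
    if f: "L f = Some (length as)" and as: "as \<in> lists (carrier (Prod M))" for f as
  proof -
    have "oper (reduct (\<pi> i) (fst (M i))) f (map (\<lambda>a. a i) as) \<in> carrier (fst (M i))" if "i \<in> I" for i
      using red[OF that] f as that unfolding is_alg_def
      by (auto simp: in_lists_conv_set PiE_def Pi_def)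
    then have "oper (Prod M) f as i \<in> carrier (fst (M i))" if "i \<in> I" for i
      using that by (simp add: oper_Prod)
    then show ?thesis by (auto simp: Prod_def)
  qed
  ultimately show ?thesis by (simp add: is_alg_def)
qed

lemma eval_Prod:
  assumes M: "\<And>i. i \<in> I \<Longrightarrow> M i \<in> Mod_equiv (l i)" and i: "i \<in> I"
  shows "t \<in> Fm L W \<Longrightarrow> eval (Prod M) h t i = eval (reduct (\<pi> i) (fst (M i))) (\<lambda>x. h x i) t"
proof (induction rule: Fm.induct)
  case (App f ts)
  then have "map (\<lambda>a. a i) (map (eval (Prod M) h) ts) =
      map (eval (reduct (\<pi> i) (fst (M i))) (\<lambda>x. h x i)) ts" by auto
  then show ?case unfolding eval.simps oper_Prod[OF i] by (simp only:)
qed simp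

lemma eval_Prod_sym:
  assumes "0 < n" "\<And>i. i \<in> I \<Longrightarrow> t i \<in> Fm (lang (l i)) {..<n}" "i \<in> I"
  shows "eval (Prod M) h (App (sym n t) ts) i =
    eval (fst (M i)) ((!) (map (\<lambda>s. eval (Prod M) h s i) ts)) (t i)"
  by (simp add: oper_Prod[OF assms(3)] oper_\<pi>_sym[OF assms] comp_def)

lemma eval_Prod_eqI:
  assumes "\<And>i. i \<in> I \<Longrightarrow> M i \<in> Mod_equiv (l i)" "h ` W \<subseteq> carrier (Prod M)"
    "s \<in> Fm L W" "t \<in> Fm L W" "\<And>i. i \<in> I \<Longrightarrow> eval (Prod M) h s i = eval (Prod M) h t i"
  shows "eval (Prod M) h s = eval (Prod M) h t"
  using eval_closed[OF is_alg_Prod[OF assms(1)] assms(3,2)]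
    eval_closed[OF is_alg_Prod[OF assms(1)] assms(4,2)] assms(5)
  by (intro PiE_ext) auto

lemma eval_Prod_memI:
  assumes "\<And>i. i \<in> I \<Longrightarrow> M i \<in> Mod_equiv (l i)" "h ` W \<subseteq> carrier (Prod M)"
    "t \<in> Fm L W" "\<And>i. i \<in> I \<Longrightarrow> eval (Prod M) h t i \<in> snd (M i)"
  shows "eval (Prod M) h t \<in> (\<Pi>\<^sub>E i\<in>I. snd (M i))"
  using eval_closed[OF is_alg_Prod[OF assms(1)] assms(3,2)] assms(4) by (auto simp: PiE_def)

lemma D_Fm: "\<delta> \<in> (\<Pi>\<^sub>E i\<in>I. \<Delta> i) \<Longrightarrow> App (sym 2 \<delta>) [Var 0, Var 1] \<in> Fm L {..<2 :: nat}"
  using L_sym[of 2 \<delta>] family_Fm by (intro Fm.App) (fastforce intro!: Fm.Var)+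

lemma eval_D:
  assumes \<delta>: "\<delta> \<in> (\<Pi>\<^sub>E i\<in>I. \<Delta> i)" and i: "i \<in> I"
  shows "eval (reduct (\<pi> i) A) (pair a b) (App (sym 2 \<delta>) [Var 0, Var 1]) = eval A (pair a b) (\<delta> i)"
proof -
  have fm: "\<delta> i \<in> Fm (lang (l i)) {..<2}" if "i \<in> I" for i
    using family_Fm[OF that] \<delta> that by blast
  have "eval (reduct (\<pi> i) A) (pair a b) (App (sym 2 \<delta>) [Var 0, Var 1]) = eval A ((!) [a, b]) (\<delta> i)"
    using oper_\<pi>_sym[of 2 \<delta>, OF _ fm i] by (simp add: pair_def)
  also have "\<dots> = eval A (pair a b) (\<delta> i)"
    by (rule eval_cong[OF fm[OF i]]) (auto simp: pair_def less_2_cases_iff)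
  finally show ?thesis .
qed

text \<open>Any formula of one member occurs in some full choice because no member has an empty set
  of formulas. Thus \<open>D\<close> sees every formula in every coordinate.\<close>

lemma ex_choice:
  assumes "i \<in> I" "\<gamma> \<in> \<Delta> i"
  shows "\<exists>\<delta>\<in>(\<Pi>\<^sub>E i\<in>I. \<Delta> i). \<delta> i = \<gamma>"
proof -
  have "\<forall>j\<in>I. \<exists>\<gamma>. \<gamma> \<in> \<Delta> j" using family_nonempty by blast
  then obtain \<epsilon> where "\<And>j. j \<in> I \<Longrightarrow> \<epsilon> j \<in> \<Delta> j" by metis
  then show ?thesis using assms by (intro bexI[of _ "\<lambda>j\<in>I. if j = i then \<gamma> else \<epsilon> j"]) auto
qed

lemma eq_formulas_reduct:
  assumes "i \<in> I" "eq_formulas D (reduct (\<pi> i) A) F a b"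
  shows "eq_formulas (\<Delta> i) A F a b"
  unfolding eq_formulas_def
proof
  fix \<gamma> assume "\<gamma> \<in> \<Delta> i"
  then obtain \<delta> where \<delta>: "\<delta> \<in> (\<Pi>\<^sub>E i\<in>I. \<Delta> i)" "\<delta> i = \<gamma>" using ex_choice[OF assms(1)] by blast
  then have "eval (reduct (\<pi> i) A) (pair a b) (App (sym 2 \<delta>) [Var 0, Var 1]) \<in> F"
    using assms(2) unfolding eq_formulas_def D_def by blast
  then show "eval A (pair a b) \<gamma> \<in> F" unfolding eval_D[OF \<delta>(1) assms(1)] \<delta>(2) .
qed

lemma factor_eq:
  assumes "i \<in> I" "X \<in> Mod_equiv (l i)" "a \<in> carrier (fst X)" "b \<in> carrier (fst X)"
  shows "eq_formulas (\<Delta> i) (fst X) (snd X) a b \<longleftrightarrow> a = b"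
  by (rule eq_formulas_Mod_equiv[OF \<Delta>[OF assms(1)]]) (use assms in simp_all)

sublocale equality_class L V K D
proof
  have "(\<Pi>\<^sub>E i\<in>I. \<Delta> i) \<noteq> {}" using family_nonempty by (simp add: PiE_eq_empty_iff)
  then show "D \<noteq> {}" by (auto simp: D_def)
  show "D \<subseteq> Fm L {..<2}" using D_Fm by (auto simp: D_def)
  show "infinite V" by (rule inf_V)
  show "is_alg L A" if "(A, F) \<in> K" for A F
    using that by (rule K_cases) (simp add: is_alg_Prod)
  show "eq_formulas D A F a b \<longleftrightarrow> a = b"
    if AF: "(A, F) \<in> K" and a: "a \<in> carrier A" and b: "b \<in> carrier A" for A F a b
  proof -
    obtain M where "\<forall>i\<in>I. M i \<in> Mod_equiv (l i)" and A: "A = Prod M"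
      and F: "F = (\<Pi>\<^sub>E i\<in>I. snd (M i))" using AF by (rule K_cases)
    then have M: "\<And>i. i \<in> I \<Longrightarrow> M i \<in> Mod_equiv (l i)" by blast
    have ab: "a i \<in> carrier (fst (M i))" "b i \<in> carrier (fst (M i))" if "i \<in> I" for i
      using a b that unfolding A by auto
    have pair: "(\<lambda>x. pair a b x i) = pair (a i) (b i)" for i by (auto simp: pair_def)
    have pr: "pair a b ` {..<2} \<subseteq> carrier (Prod M)" using a b by (auto simp: pair_def A)
    have ev: "eval A (pair a b) t \<in> F \<longleftrightarrow>
        (\<forall>i\<in>I. eval (reduct (\<pi> i) (fst (M i))) (pair (a i) (b i)) t \<in> snd (M i))" if "t \<in> Fm L {..<2}" for t
      using eval_closed[OF is_alg_Prod[OF M] that pr] eval_Prod[OF M _ that, of _ "pair a b"]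
      unfolding A F PiE_iff carrier_Prod pair by auto
    have "a = b" if "eq_formulas D A F a b"
    proof -
      have "a i = b i" if i: "i \<in> I" for i
      proof -
        have "eq_formulas D (reduct (\<pi> i) (fst (M i))) (snd (M i)) (a i) (b i)"
          using \<open>eq_formulas D A F a b\<close> ev i D_Fm unfolding eq_formulas_def D_def by blast
        then have "eq_formulas (\<Delta> i) (fst (M i)) (snd (M i)) (a i) (b i)"
          by (rule eq_formulas_reduct[OF i])
        then show ?thesis unfolding factor_eq[OF i M[OF i] ab[OF i]] .
      qed
      then show ?thesis using a b unfolding A by (auto intro: PiE_ext)
    qed
    moreover have "eq_formulas D A F a a"  if "a = b"
      unfolding eq_formulas_def
    proof
      fix t assume "t \<in> D"
      then obtain \<delta> where \<delta>: "\<delta> \<in> (\<Pi>\<^sub>E i\<in>I. \<Delta> i)" and t: "t = App (sym 2 \<delta>) [Var 0, Var 1]"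
        by (auto simp: D_def)
      have "eval (reduct (\<pi> i) (fst (M i))) (pair (a i) (b i)) t \<in> snd (M i)" if i: "i \<in> I" for i
        unfolding t eval_D[OF \<delta> i]
        using factor_eq[OF i M[OF i] ab[OF i]] \<open>a = b\<close> \<delta> i by (auto simp: eq_formulas_def)
      then have "eval A (pair a b) t \<in> F" using ev D_Fm[OF \<delta>] t by blast
      then show "eval A (pair a a) t \<in> F" using \<open>a = b\<close> by simp
    qed
    ultimately show ?thesis by blast
  qed
qed

lemma defines_Leibniz_prod: "defines_Leibniz D prod"
  unfolding prod_def by (rule defines_Leibniz_logic_of) unfold_locales

lemma is_logic_prod: "is_logic prod"
  unfolding prod_def
proof (rule is_logic_logic_of)
  have "dom L \<subseteq> code ` syms" by (auto simp: L_def split: if_splits)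
  moreover have "small U (code ` syms)"
    by (intro small_image small_Sigma small_PiE small_I small_Fm small_lang small_subset[OF subset_UNIV small_nat])
  ultimately show "small U (dom L)" by (rule small_subset)
  show "0 \<notin> ran L"
  proof
    assume "0 \<in> ran L"
    then obtain u where "L u = Some 0" by (auto simp: ran_def)
    then show False using L_cases by blast
  qed
  show "small U V" by (rule small_V)
  show "infinite V" by (rule inf_V)
qed (rule alg)

text \<open>The matrices of \<open>K\<close> live on functions over \<open>I\<close>, so a reduced
  model of \<open>l j\<close> is represented by the product that has it in coordinate
  \<open>j\<close> and one-element matrices elsewhere. Rules valid in this product can be read in
  coordinate \<open>j\<close>.\<close>

lemma prod_lower:
  assumes j: "j \<in> I" shows "interpretable prod (l j)"
proof (rule interpretableI)
  show "is_translation (\<pi> j) (lang prod) (lang (l j))" using \<pi>[OF j] by (simp add: prod_def)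
  fix A F assume AF: "(A, F) \<in> Mod_equiv (l j)"
  note A = Mod_equivD[OF AF]
  have red: "is_alg L (reduct (\<pi> j) A)" by (rule is_alg_reduct[OF \<pi>[OF j] A(1)])
  define u :: 'u where "u = undefined"
  define T :: "('u, 'u) alg" where "T = \<lparr>carrier = {u}, oper = \<lambda>_ _. u\<rparr>"
  define M where "M i = (if i = j then (A, F) else (T, {u}))" for i
  have "(T, {u}) \<in> Mod_equiv (l i)" if "i \<in> I" for i
    by (rule Mod_equiv_trivial[OF cons[OF that]]) (auto simp: T_def is_alg_def small_finite)
  then have M: "M i \<in> Mod_equiv (l i)" if "i \<in> I" for i
    using AF that by (simp add: M_def)
  have "deductive_filter prod (reduct (\<pi> j) A) F"
  proof (rule deductive_filterI)
    show "F \<subseteq> carrier (reduct (\<pi> j) A)" using A(3) by (simp add: deductive_filter_def)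
    fix \<Gamma> \<phi> and h :: "'u \<Rightarrow> 'u"
    assume ent: "entails prod \<Gamma> \<phi>" and h: "h ` vars prod \<subseteq> carrier (reduct (\<pi> j) A)"
      and \<Gamma>: "eval (reduct (\<pi> j) A) h ` \<Gamma> \<subseteq> F"
    have fm: "\<Gamma> \<subseteq> Fm L V" "\<phi> \<in> Fm L V" and val: "valid K V \<Gamma> \<phi>"
      using ent by (simp_all add: prod_def)
    define k where "k v = (\<lambda>i\<in>I. if i = j then h v else u)" for v
    have k: "k ` V \<subseteq> carrier (Prod M)"
      using h by (auto simp: k_def M_def T_def prod_def)
    have ev: "eval (Prod M) k t j = eval (reduct (\<pi> j) A) h t" if "t \<in> Fm L V" for t
      using eval_Prod[where M = M, OF M j that, of k] j by (simp add: k_def M_def)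
    have "eval (Prod M) k \<phi> \<in> (\<Pi>\<^sub>E i\<in>I. snd (M i))"
    proof (rule validD[OF val _ k])
      show "(Prod M, \<Pi>\<^sub>E i\<in>I. snd (M i)) \<in> K" using M by (auto simp: K_def)
      fix \<gamma> assume \<gamma>: "\<gamma> \<in> \<Gamma>"
      show "eval (Prod M) k \<gamma> \<in> (\<Pi>\<^sub>E i\<in>I. snd (M i))"
      proof (rule eval_Prod_memI[OF M k subsetD[OF fm(1) \<gamma>]])
        fix i assume i: "i \<in> I"
        show "eval (Prod M) k \<gamma> i \<in> snd (M i)"
        proof (cases "i = j")
          case True
          then show ?thesis using ev[OF subsetD[OF fm(1) \<gamma>]] \<Gamma> \<gamma> by (auto simp: M_def)
        next
          case False
          \<comment> \<open>In a trivial coordinate the filter is the whole carrier, so membership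
            follows from closure.\<close>
          have "eval (Prod M) k \<gamma> \<in> carrier (Prod M)"
            by (rule eval_closed[OF is_alg_Prod[OF M] subsetD[OF fm(1) \<gamma>] k])
          then have "eval (Prod M) k \<gamma> i \<in> carrier (fst (M i))" using i by auto
          then show ?thesis using False by (simp add: M_def T_def)
        qed
      qed
    qed
    then have "eval (Prod M) k \<phi> j \<in> snd (M j)" using j by blast
    then show "eval (reduct (\<pi> j) A) h \<phi> \<in> F" using ev[OF fm(2)] by (simp add: M_def)
  qed
  then have "(reduct (\<pi> j) A, F) \<in> Mod prod" using red A(2) by (simp add: Mod_def prod_def)
  then show "(reduct (\<pi> j) A, F) \<in> Mod_equiv prod"
  proof (rule Mod_equiv_eq_formulasI[OF defines_Leibniz_prod])
    fix a b assume "a \<in> carrier (reduct (\<pi> j) A)" "b \<in> carrier (reduct (\<pi> j) A)"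
      and "eq_formulas D (reduct (\<pi> j) A) F a b"
    then show "a = b"
      using eq_formulas_Mod_equiv[OF \<Delta>[OF j] AF] by (auto dest: eq_formulas_reduct[OF j])
  qed
qed

end


section \<open>Decomposition operations and terms that act on one coordinate\<close>

context product_of_logics
begin

text \<open>The decomposition operation, in the sense of universal algebra, that separates the
  \<open>i\<close>-th coordinate from the rest.\<close>

definition dec :: "'i \<Rightarrow> 'u" where
  "dec i = sym 2 (\<lambda>j. if j = i then Var 1 else Var 0)"

text \<open>Makes a symbol of the \<open>i\<close>-th language act in coordinate \<open>i\<close>
  and return its first argument elsewhere; positive arity makes \<open>Var 0\<close>
  available.\<close>

definition hat :: "'i \<Rightarrow> 'u \<Rightarrow> ('u, nat) trm" where
  "hat i f = App (sym (the (lang (l i) f))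
     (\<lambda>j. if j = i then App f (map Var [0..<the (lang (l i) f)]) else Var 0))
     (map Var [0..<the (lang (l i) f)])"

definition at :: "'i \<Rightarrow> ('u, 'x) trm \<Rightarrow> ('u, 'x) trm \<Rightarrow> ('u, 'x) trm" where
  "at i s t = App (dec i) [s, t]"

text \<open>The extra variable \<open>None\<close> stands for a base point: \<open>lift i t\<close> computes \<open>t\<close> in the \<open>i\<close>-th
  coordinate and returns the base point in all others.\<close>

abbreviation opt :: "'x set \<Rightarrow> 'x option set" where
  "opt W \<equiv> insert None (Some ` W)"

definition lift :: "'i \<Rightarrow> ('u, 'x) trm \<Rightarrow> ('u, 'x option) trm" where
  "lift i t = subst (\<lambda>x. at i (Var None) (Var (Some x))) (translate (hat i) t)"

lemma arity_pos: "i \<in> I \<Longrightarrow> lang (l i) f = Some n \<Longrightarrow> 0 < n"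
  using logic[of i] by (auto simp: is_logic_def ran_def intro: gr0I)

lemma dec_Fm: "(if j = i then Var 1 else Var 0) \<in> Fm K' {..<2 :: nat}"
  by (auto intro: Fm.Var)

lemma at_Fm: "s \<in> Fm L W \<Longrightarrow> t \<in> Fm L W \<Longrightarrow> at i s t \<in> Fm L W"
  unfolding at_def dec_def by (rule Fm.App) (auto simp: L_sym dec_Fm)

lemma hat_component_Fm:
  assumes "i \<in> I" "lang (l i) f = Some n" "j \<in> I"
  shows "(if j = i then App f (map Var [0..<n]) else Var 0) \<in> Fm (lang (l j)) {..<n}"
  using App_vars_Fm[of "lang (l i)", OF assms(2)] arity_pos[OF assms(1,2)] by (auto intro: Fm.Var)

lemma L_hat:
  assumes "i \<in> I" "lang (l i) f = Some n"
  shows "L (sym n (\<lambda>j. if j = i then App f (map Var [0..<n]) else Var 0)) = Some n"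
  by (rule L_sym[OF arity_pos[OF assms] hat_component_Fm[OF assms]])

lemma hat_eq:
  assumes "lang (l i) f = Some n"
  shows "hat i f =
    App (sym n (\<lambda>j. if j = i then App f (map Var [0..<n]) else Var 0)) (map Var [0..<n])"
  unfolding hat_def assms option.sel ..

lemma hat: "i \<in> I \<Longrightarrow> is_translation (hat i) (lang (l i)) L"
  by (auto simp: is_translation_def hat_eq intro!: App_vars_Fm L_hat)

lemma eval_Prod_at:
  assumes "j \<in> I"
  shows "eval (Prod M) k (at i s t) j = (if j = i then eval (Prod M) k t j else eval (Prod M) k s j)"
  unfolding at_def dec_def
    eval_Prod_sym[of 2 "\<lambda>j. if j = i then Var 1 else Var 0" j, OF zero_less_numeral dec_Fm assms]
  by simp

lemma oper_hat:
  assumes i: "i \<in> I" and f: "lang (l i) f = Some (length as)" and j: "j \<in> I"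
  shows "oper (reduct (hat i) (Prod M)) f as j =
    (if j = i then oper (fst (M i)) f (map (\<lambda>a. a i) as) else (as ! 0) j)"
proof -
  let ?n = "length as"
  let ?t = "\<lambda>j. if j = i then App f (map Var [0..<?n]) else Var 0"
  have "oper (reduct (hat i) (Prod M)) f as = oper (Prod M) (sym ?n ?t) as"
    using eval_vars[of as ?n "Prod M"] by (simp add: reduct_def hat_eq[OF f] del: map_map)
  then have "oper (reduct (hat i) (Prod M)) f as j =
      oper (reduct (\<pi> j) (fst (M j))) (sym ?n ?t) (map (\<lambda>a. a j) as)"
    by (simp only: oper_Prod[OF j])
  also have "\<dots> = eval (fst (M j)) ((!) (map (\<lambda>a. a j) as)) (?t j)"
    by (rule oper_\<pi>_sym[of ?n ?t j, OF arity_pos[OF i f] hat_component_Fm[OF i f] j])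
  finally show ?thesis
    using eval_vars[of "map (\<lambda>a. a i) as" ?n "fst (M i)"] arity_pos[OF i f]
    by (cases "j = i") (simp_all del: map_map)
qed

text \<open>Outside coordinate \<open>i\<close> each symbol returns its first argument, so the value
  is that of the leftmost variable. If all variables agree there, it is their common value
  \<open>e\<close>.\<close>

lemma eval_hat:
  assumes i: "i \<in> I" and j: "j \<in> I" and t: "t \<in> Fm (lang (l i)) W"
    and e: "j \<noteq> i \<Longrightarrow> (\<And>x. x \<in> W \<Longrightarrow> k x j = e)"
  shows "eval (Prod M) k (translate (hat i) t) j =
    (if j = i then eval (fst (M i)) (\<lambda>x. k x i) t else e)"
  unfolding eval_reduct[OF hat[OF i] t, symmetric]
  using t
proof (induction rule: Fm.induct)
  case (App f ts)
  let ?B = "reduct (hat i) (Prod M)"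
  have "eval ?B k (App f ts) j = (if j = i then oper (fst (M i)) f (map (\<lambda>a. a i) (map (eval ?B k) ts))
      else (map (eval ?B k) ts ! 0) j)"
    using oper_hat[OF i, of f "map (eval ?B k) ts", OF _ j] App.hyps by simp
  moreover have "map (\<lambda>a. a i) (map (eval ?B k) ts) = map (eval (fst (M i)) (\<lambda>x. k x i)) ts" if "j = i"
    using App.IH that by auto
  moreover have "(map (eval ?B k) ts ! 0) j = e" if "j \<noteq> i"
    using App.IH arity_pos[OF i App.hyps(1)] that by (auto simp: in_lists_conv_set)
  ultimately show ?case by (cases "j = i") (simp_all del: map_map)
qed (use e in auto)

lemma lift_Fm: "i \<in> I \<Longrightarrow> t \<in> Fm (lang (l i)) W \<Longrightarrow> lift i t \<in> Fm L (opt W)"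
  unfolding lift_def by (rule subst_Fm[OF translate_Fm[OF hat]]) (auto intro!: at_Fm Fm.Var)

text \<open>Substituting \<open>at i\<close> with the base point makes all variables agree with
  \<open>None\<close> outside coordinate \<open>i\<close>, as \<open>eval_hat\<close>
  requires.\<close>

lemma eval_Prod_lift:
  assumes "i \<in> I" "j \<in> I" "t \<in> Fm (lang (l i)) W"
  shows "eval (Prod M) k (lift i t) j =
    (if j = i then eval (fst (M i)) (\<lambda>x. k (Some x) i) t else k None j)"
  unfolding lift_def eval_subst
  by (subst eval_hat[OF assms, where e = "k None j"]) (use assms in \<open>simp_all add: eval_Prod_at\<close>)

lemma opt_lepoll:
  assumes "W \<lesssim> V" shows "opt W \<lesssim> V"
proof (cases "finite W")
  case True
  then show ?thesis by (intro finite_lepoll_infinite[OF inf_V]) simp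
next
  case False
  then have "infinite (Some ` W)" by (simp add: finite_image_iff)
  then have "opt W \<lesssim> Some ` W"
    by (intro eqpoll_imp_lepoll infinite_insert_eqpoll)
  also have "Some ` W \<lesssim> V" using image_lepoll assms by (rule lepoll_trans)
  finally show ?thesis .
qed

end

text \<open>Fixing \<open>c \<in> F\<close>, the map \<open>p i\<close> keeps the \<open>i\<close>-th coordinate and replaces all others by those
  of \<open>c\<close>. Its image carries a reduced model of the \<open>i\<close>-th logic.\<close>

locale reduced_product_model = product_of_logics U I l \<Delta> code V
  for U :: "'u itself" and I :: "'i set" and l and \<Delta> and code and V +
  fixes A :: "('u, 'u) alg" and F :: "'u set" and c :: 'u
  assumes AF: "(A, F) \<in> Mod_equiv prod" and c: "c \<in> F"
begin

definition p :: "'i \<Rightarrow> 'u \<Rightarrow> 'u" where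
  "p i a = oper A (dec i) [c, a]"

text \<open>The image of \<open>p i\<close> consists of its fixed points and plays the part of the
  \<open>i\<close>-th factor inside \<open>A\<close>: intuitively, the elements that agree with
  \<open>c\<close> in all other coordinates.\<close>

definition C :: "'i \<Rightarrow> ('u, 'u) alg" where
  "C i = (reduct (hat i) A)\<lparr>carrier := p i ` carrier A\<rparr>"

definition G :: "'i \<Rightarrow> 'u set" where
  "G i = F \<inter> p i ` carrier A"

lemma alg_A: "is_alg L A" and small_A: "small U (carrier A)" and F_A: "F \<subseteq> carrier A"
  using Mod_equivD[OF AF] by (simp_all add: deductive_filter_def prod_def)

lemma c_A: "c \<in> carrier A"
  using c F_A by blast

lemmas rule_mem = reduced_implication_mem[OF equality_class_axioms AF[unfolded prod_def]]
lemmas rule_eq = reduced_implication_eq[OF equality_class_axioms AF[unfolded prod_def]]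

lemma eval_at: "eval A h (at i s t) = oper A (dec i) [eval A h s, eval A h t]"
  by (simp add: at_def)

lemma p_closed: "a \<in> carrier A \<Longrightarrow> p i a \<in> carrier A"
  using eval_closed[OF alg_A at_Fm[of "Var 0" "{..<2 :: nat}" "Var 1" i], of "pair c a"] c_A
  by (auto simp: p_def eval_at pair_def Fm.Var)

lemma eval_C: "eval (C i) h t = eval (reduct (hat i) A) h t"
  by (rule eval_oper_cong) (simp add: C_def)

text \<open>With \<open>None\<close> interpreted by \<open>c\<close>, the term \<open>at i\<close>
  with base point evaluates to \<open>p i\<close>.\<close>

lemma eval_lift:
  assumes "i \<in> I" "t \<in> Fm (lang (l i)) W"
  shows "eval A (case_option c h) (lift i t) = eval (C i) (\<lambda>x. p i (h x)) t"
  unfolding eval_C eval_reduct[OF hat[OF assms(1)] assms(2)]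
  by (simp add: lift_def eval_subst eval_at p_def)

text \<open>Says that \<open>p i\<close> is a homomorphism once each symbol of the product is read
  as its \<open>i\<close>-th term. It is an equation valid in products: both sides apply
  \<open>t i\<close> in coordinate \<open>i\<close> and return the base point elsewhere.\<close>

lemma p_sym:
  assumes n: "0 < length as" and t: "\<And>i. i \<in> I \<Longrightarrow> t i \<in> Fm (lang (l i)) {..<length as}"
    and as: "as \<in> lists (carrier A)" and i: "i \<in> I"
  shows "p i (oper A (sym (length as) t) as) = eval (C i) ((!) (map (p i) as)) (t i)"
proof -
  let ?n = "length as"
  \<comment> \<open>The value \<open>c\<close> past the end of the list only keeps \<open>g\<close>
    inside the carrier.\<close>
  define g where "g m = (if m < ?n then as ! m else c)" for m
  let ?s = "App (sym ?n t) (map (\<lambda>m. Var (Some m)) [0..<?n])"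
  have s: "?s \<in> Fm L (opt {..<?n})"
    by (rule Fm.App) (auto simp: L_sym[OF n t] intro!: Fm.Var)
  have "map (eval A (case_option c g)) (map (\<lambda>m. Var (Some m)) [0..<?n]) = as"
    by (rule nth_equalityI) (auto simp: g_def)
  then have "eval A (case_option c g) ?s = oper A (sym ?n t) as" by (simp only: eval.simps)
  then have "p i (oper A (sym ?n t) as) = eval A (case_option c g) (at i (Var None) ?s)"
    by (simp only: eval_at p_def eval.simps option.case)
  also have "\<dots> = eval A (case_option c g) (lift i (t i))"
  proof (rule rule_eq[where W = "opt {..<?n}" and \<Gamma> = "{}" and E = "{}"])
    show "opt {..<?n} \<lesssim> V" by (rule finite_lepoll_infinite[OF inf_V]) simp
    show "at i (Var None) ?s \<in> Fm L (opt {..<?n})" by (rule at_Fm[OF _ s]) (simp add: Fm.Var)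
    show "lift i (t i) \<in> Fm L (opt {..<?n})" by (rule lift_Fm[OF i t[OF i]])
    show "case_option c g ` opt {..<?n} \<subseteq> carrier A"
      using as c_A by (auto simp: g_def in_lists_conv_set)
    fix B H k assume "(B, H) \<in> K" and k: "k ` opt {..<?n} \<subseteq> carrier B"
    then obtain M where "\<forall>i\<in>I. M i \<in> Mod_equiv (l i)" and B: "B = Prod M" by (elim K_cases)
    then have M: "\<And>i. i \<in> I \<Longrightarrow> M i \<in> Mod_equiv (l i)" by blast
    show "eval B k (at i (Var None) ?s) = eval B k (lift i (t i))"
      unfolding B
    proof (rule eval_Prod_eqI[OF M, where W = "opt {..<?n}"])
      fix j assume j: "j \<in> I"
      have "eval (Prod M) k ?s j = eval (fst (M j)) ((!) (map (\<lambda>m. k (Some m) j) [0..<?n])) (t j)"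
        using eval_Prod_sym[of ?n t j M k "map (\<lambda>m. Var (Some m)) [0..<?n]", OF n t j]
        by (simp only: map_map comp_def eval.simps)
      also have "\<dots> = eval (fst (M j)) (\<lambda>m. k (Some m) j) (t j)"
        by (rule eval_cong[OF t[OF j]]) simp
      finally show "eval (Prod M) k (at i (Var None) ?s) j = eval (Prod M) k (lift i (t i)) j"
        unfolding eval_Prod_at[OF j] eval_Prod_lift[OF i j t[OF i]] by auto
    qed (use k B at_Fm[OF _ s] lift_Fm[OF i t[OF i]] in \<open>auto simp: Fm.Var\<close>)
  qed simp_all
  also have "\<dots> = eval (C i) (\<lambda>m. p i (g m)) (t i)"
    by (rule eval_lift[OF i t[OF i]])
  also have "\<dots> = eval (C i) ((!) (map (p i) as)) (t i)"
    by (rule eval_cong[OF t[OF i]]) (simp add: g_def)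
  finally show ?thesis .
qed

text \<open>\<open>dec i\<close> is itself a symbol of the product, with \<open>i\<close>-th
  component \<open>Var 1\<close>, so this is an instance of \<open>p_sym\<close>.\<close>

lemma p_idem:
  assumes i: "i \<in> I" and a: "a \<in> carrier A"
  shows "p i (p i a) = p i a"
proof -
  let ?t = "\<lambda>j. if j = i then Var 1 else Var 0"
  have len: "length [c, a] = 2" by simp
  have "p i (oper A (sym 2 ?t) [c, a]) = eval (C i) ((!) (map (p i) [c, a])) (?t i)"
    by (rule p_sym[of "[c, a]" ?t i, unfolded len, OF zero_less_numeral dec_Fm _ i]) (simp add: a c_A)
  then show ?thesis by (simp add: p_def dec_def)
qed

text \<open>On \<open>C i\<close> the operation is given by a symbol of the product. By
  \<open>p_sym\<close> the map \<open>p i\<close> commutes with it, and the arguments are fixed by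
  \<open>p i\<close>, so the value is fixed too and lies in the image.\<close>

lemma oper_C:
  assumes i: "i \<in> I" and f: "lang (l i) f = Some (length as)" and as: "as \<in> lists (carrier (C i))"
  shows "oper (C i) f as \<in> carrier (C i)"
proof -
  let ?n = "length as"
  let ?t = "\<lambda>j. if j = i then App f (map Var [0..<?n]) else Var 0"
  have as_A: "as \<in> lists (carrier A)" and p_as: "map (p i) as = as"
    using as p_closed p_idem[OF i] by (auto simp: C_def in_lists_conv_set intro!: map_idI)
  have oper: "oper (C i) f as = oper A (sym ?n ?t) as"
    using eval_vars[of as ?n A] by (simp add: C_def reduct_def hat_eq[OF f] del: map_map)
  then have "oper (C i) f as \<in> carrier A"
    using alg_A as_A L_hat[OF i f] by (simp add: is_alg_def)
  moreover have "p i (oper (C i) f as) = eval (C i) ((!) (map (p i) as)) (?t i)"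
    unfolding oper by (rule p_sym[OF arity_pos[OF i f] hat_component_Fm[OF i f] as_A i])
  then have "p i (oper (C i) f as) = oper (C i) f as"
    unfolding p_as using eval_vars[of as ?n "C i"] by (simp del: map_map)
  ultimately show ?thesis by (simp add: C_def) (metis imageI)
qed

lemma alg_C: "i \<in> I \<Longrightarrow> is_alg (lang (l i)) (C i)"
  unfolding is_alg_def using oper_C c_A by (auto simp: C_def)

text \<open>In a product, each coordinate of the value comes from one of two members of the filter;
  here \<open>c\<close> has to be in \<open>F\<close>.\<close>

lemma p_mem:
  assumes i: "i \<in> I" and a: "a \<in> F" shows "p i a \<in> F"
proof -
  have "eval A (pair c a) (at i (Var 0) (Var 1)) \<in> F"
  proof (rule rule_mem[where W = "{..<2}" and \<Gamma> = "{Var 0, Var 1}" and E = "{}"])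
    show "{..<2 :: nat} \<lesssim> V" by (rule finite_lepoll_infinite[OF inf_V]) simp
    show fm: "at i (Var 0) (Var 1) \<in> Fm L {..<2 :: nat}" by (rule at_Fm) (auto intro: Fm.Var)
    fix B H k assume "(B, H) \<in> K" and k: "k ` {..<2 :: nat} \<subseteq> carrier B"
      and \<Gamma>: "\<forall>\<gamma>\<in>{Var 0, Var 1}. eval B k \<gamma> \<in> H"
    then obtain M where "\<forall>i\<in>I. M i \<in> Mod_equiv (l i)" and B: "B = Prod M"
      and H: "H = (\<Pi>\<^sub>E i\<in>I. snd (M i))" by (elim K_cases)
    then have M: "\<And>i. i \<in> I \<Longrightarrow> M i \<in> Mod_equiv (l i)" by blast
    show "eval B k (at i (Var 0) (Var 1)) \<in> H"
      unfolding B H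
      by (rule eval_Prod_memI[OF M k[unfolded B] fm]) (use \<Gamma> in \<open>auto simp: eval_Prod_at B H\<close>)
  qed (use a c F_A in \<open>auto simp: pair_def Fm.Var\<close>)
  then show ?thesis by (simp add: eval_at p_def pair_def)
qed

text \<open>A rule with one premise per index: coordinate \<open>i\<close> of the element is read
  off the \<open>i\<close>-th premise.\<close>

lemma mem_if_p_mem:
  assumes a: "a \<in> carrier A" and p: "\<And>i. i \<in> I \<Longrightarrow> p i a \<in> F"
  shows "a \<in> F"
proof -
  have "eval A (pair c a) (Var 1) \<in> F"
  proof (rule rule_mem[where W = "{..<2}" and E = "{}"
        and \<Gamma> = "insert (Var 0) ((\<lambda>i. at i (Var 0) (Var 1)) ` I)"])
    show "{..<2 :: nat} \<lesssim> V" by (rule finite_lepoll_infinite[OF inf_V]) simp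
    have "at i (Var 0) (Var 1) \<in> Fm L {..<2 :: nat}" for i by (rule at_Fm) (auto intro: Fm.Var)
    then show "insert (Var 0) ((\<lambda>i. at i (Var 0) (Var 1)) ` I) \<subseteq> Fm L {..<2 :: nat}"
      by (auto intro: Fm.Var)
    show fm: "Var 1 \<in> Fm L {..<2 :: nat}" by (simp add: Fm.Var)
    fix B H k assume "(B, H) \<in> K" and k: "k ` {..<2 :: nat} \<subseteq> carrier B"
      and \<Gamma>: "\<forall>\<gamma>\<in>insert (Var 0) ((\<lambda>i. at i (Var 0) (Var 1)) ` I). eval B k \<gamma> \<in> H"
    then obtain M where "\<forall>i\<in>I. M i \<in> Mod_equiv (l i)" and B: "B = Prod M"
      and H: "H = (\<Pi>\<^sub>E i\<in>I. snd (M i))" by (elim K_cases)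
    then have M: "\<And>i. i \<in> I \<Longrightarrow> M i \<in> Mod_equiv (l i)" by blast
    show "eval B k (Var 1) \<in> H"
      unfolding B H
    proof (rule eval_Prod_memI[OF M k[unfolded B] fm])
      fix i assume i: "i \<in> I"
      then have "eval (Prod M) k (at i (Var 0) (Var 1)) \<in> (\<Pi>\<^sub>E i\<in>I. snd (M i))"
        using \<Gamma> unfolding B H by blast
      then have "eval (Prod M) k (at i (Var 0) (Var 1)) i \<in> snd (M i)" using i by (rule PiE_mem)
      then show "eval (Prod M) k (Var 1) i \<in> snd (M i)" by (simp add: eval_Prod_at[OF i])
    qed
  qed (use a c c_A p in \<open>auto simp: pair_def eval_at p_def\<close>)
  then show ?thesis by (simp add: pair_def)
qed

text \<open>An implication with one equation per index as premise; in products it says that elements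
  with the same coordinates are equal.\<close>

lemma p_jointly_inj:
  assumes a: "a \<in> carrier A" and b: "b \<in> carrier A" and p: "\<And>i. i \<in> I \<Longrightarrow> p i a = p i b"
  shows "a = b"
proof -
  let ?E = "(\<lambda>i. (at i (Var None) (Var (Some 0)), at i (Var None) (Var (Some 1)))) ` I"
  have fm: "at i (Var None) (Var (Some m)) \<in> Fm L (opt {..<2 :: nat})" if "m < 2" for i m
    using that by (intro at_Fm) (auto intro: Fm.Var)
  have "eval A (case_option c (pair a b)) (Var (Some 0)) = eval A (case_option c (pair a b)) (Var (Some 1))"
  proof (rule rule_eq[where W = "opt {..<2}" and \<Gamma> = "{}" and E = ?E])
    show "opt {..<2 :: nat} \<lesssim> V" by (rule finite_lepoll_infinite[OF inf_V]) simp
    show "?E \<subseteq> Fm L (opt {..<2 :: nat}) \<times> Fm L (opt {..<2 :: nat})" using fm by auto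
    show v: "Var (Some 0) \<in> Fm L (opt {..<2 :: nat})" "Var (Some 1) \<in> Fm L (opt {..<2 :: nat})"
      by (auto intro: Fm.Var)
    fix B H k assume "(B, H) \<in> K" and k: "k ` opt {..<2 :: nat} \<subseteq> carrier B"
      and E: "\<forall>(u, v)\<in>?E. eval B k u = eval B k v"
    then obtain M where "\<forall>i\<in>I. M i \<in> Mod_equiv (l i)" and B: "B = Prod M" by (elim K_cases)
    then have M: "\<And>i. i \<in> I \<Longrightarrow> M i \<in> Mod_equiv (l i)" by blast
    show "eval B k (Var (Some 0)) = eval B k (Var (Some 1))"
      unfolding B
    proof (rule eval_Prod_eqI[OF M k[unfolded B] v])
      fix i assume i: "i \<in> I"
      then have "eval (Prod M) k (at i (Var None) (Var (Some 0))) =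
          eval (Prod M) k (at i (Var None) (Var (Some 1)))"
        using E unfolding B by blast
      then have "eval (Prod M) k (at i (Var None) (Var (Some 0))) i =
          eval (Prod M) k (at i (Var None) (Var (Some 1))) i" by simp
      then show "eval (Prod M) k (Var (Some 0)) i = eval (Prod M) k (Var (Some 1)) i"
        by (simp only: eval_Prod_at[OF i] if_True simp_thms)
    qed
  qed (use a b c_A p in \<open>auto simp: pair_def eval_at p_def\<close>)
  then show ?thesis by (simp add: pair_def)
qed

lemma p_C: "b \<in> carrier (C i) \<Longrightarrow> i \<in> I \<Longrightarrow> p i b = b"
  using p_idem by (auto simp: C_def)

lemma carrier_C: "carrier (C i) \<subseteq> carrier A"
  using p_closed by (auto simp: C_def)

lemma eval_lift_C:
  assumes "i \<in> I" "t \<in> Fm (lang (l i)) W" "h ` W \<subseteq> carrier (C i)"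
  shows "eval A (case_option c h) (lift i t) = eval (C i) h t"
  unfolding eval_lift[OF assms(1,2)]
  by (rule eval_cong[OF assms(2)]) (use p_C[OF _ assms(1)] assms(3) in auto)

text \<open>Each rule of \<open>l i\<close> becomes a rule of the product by lifting its formulas
  and adding the base point as a premise: the rule acts in coordinate \<open>i\<close>, and the
  added premise provides membership in all others.\<close>

lemma factor_model:
  assumes i: "i \<in> I"
  shows "(C i, G i) \<in> Mod_equiv (l i)"
proof -
  have G_iff: "b \<in> G i \<longleftrightarrow> b \<in> F" if "b \<in> carrier (C i)" for b
    using that by (auto simp: G_def C_def)
  have "deductive_filter (l i) (C i) (G i)"
  proof (rule deductive_filterI)
    show "G i \<subseteq> carrier (C i)" by (auto simp: G_def C_def)
    fix \<Gamma> \<phi> and h :: "'u \<Rightarrow> 'u"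
    assume ent: "entails (l i) \<Gamma> \<phi>" and h: "h ` vars (l i) \<subseteq> carrier (C i)"
      and \<Gamma>: "eval (C i) h ` \<Gamma> \<subseteq> G i"
    note fm = entails_formulas[OF cons[OF i] ent]
    have "eval A (case_option c h) (lift i \<phi>) \<in> F"
    proof (rule rule_mem[where W = "opt (vars (l i))" and E = "{}"
          and \<Gamma> = "insert (Var None) (lift i ` \<Gamma>)"])
      show "opt (vars (l i)) \<lesssim> V" by (rule opt_lepoll[OF subset_imp_lepoll[OF vars_V[OF i]]])
      show "insert (Var None) (lift i ` \<Gamma>) \<subseteq> Fm L (opt (vars (l i)))"
        using lift_Fm[OF i] fm(1) by (auto intro: Fm.Var)
      show \<phi>: "lift i \<phi> \<in> Fm L (opt (vars (l i)))" by (rule lift_Fm[OF i fm(2)])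
      show "case_option c h ` opt (vars (l i)) \<subseteq> carrier A"
        using subset_trans[OF h carrier_C] c_A by auto
      have "eval A (case_option c h) (lift i \<gamma>) \<in> F" if "\<gamma> \<in> \<Gamma>" for \<gamma>
        using eval_lift_C[OF i subsetD[OF fm(1) that] h] \<Gamma> that by (auto simp: G_def)
      then show "\<forall>\<gamma>\<in>insert (Var None) (lift i ` \<Gamma>). eval A (case_option c h) \<gamma> \<in> F"
        using c by simp
      fix B H k assume "(B, H) \<in> K" and k: "k ` opt (vars (l i)) \<subseteq> carrier B"
        and \<Gamma>': "\<forall>\<gamma>\<in>insert (Var None) (lift i ` \<Gamma>). eval B k \<gamma> \<in> H"
      then obtain M where "\<forall>i\<in>I. M i \<in> Mod_equiv (l i)" and B: "B = Prod M"
        and H: "H = (\<Pi>\<^sub>E i\<in>I. snd (M i))" by (elim K_cases)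
      then have M: "\<And>i. i \<in> I \<Longrightarrow> M i \<in> Mod_equiv (l i)" by blast
      have Mi: "(fst (M i), snd (M i)) \<in> Mod_equiv (l i)" using M[OF i] by simp
      show "eval B k (lift i \<phi>) \<in> H"
        unfolding B H
      proof (rule eval_Prod_memI[OF M k[unfolded B] \<phi>])
        fix j assume j: "j \<in> I"
        have "eval (fst (M i)) (\<lambda>x. k (Some x) i) \<phi> \<in> snd (M i)"
        proof (rule deductive_filter_entails[OF Mod_equivD(3)[OF Mi] ent])
          show "(\<lambda>x. k (Some x) i) ` vars (l i) \<subseteq> carrier (fst (M i))"
            using k i unfolding B by auto
          fix \<gamma> assume \<gamma>: "\<gamma> \<in> \<Gamma>"
          then have "eval (Prod M) k (lift i \<gamma>) \<in> (\<Pi>\<^sub>E i\<in>I. snd (M i))"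
            using \<Gamma>' unfolding B H by blast
          then have "eval (Prod M) k (lift i \<gamma>) i \<in> snd (M i)" using i by (rule PiE_mem)
          then show "eval (fst (M i)) (\<lambda>x. k (Some x) i) \<gamma> \<in> snd (M i)"
            using eval_Prod_lift[OF i i subsetD[OF fm(1) \<gamma>]] by simp
        qed
        moreover have "k None j \<in> snd (M j)" using \<Gamma>' j unfolding H by auto
        ultimately show "eval (Prod M) k (lift i \<phi>) j \<in> snd (M j)"
          using eval_Prod_lift[OF i j fm(2)] by auto
      qed
    qed simp_all
    then show "eval (C i) h \<phi> \<in> G i"
      using eval_lift_C[OF i fm(2) h] G_iff[OF eval_closed[OF alg_C[OF i] fm(2) h]] by simp
  qed
  then have mod: "(C i, G i) \<in> Mod (l i)"
    using alg_C[OF i] small_subset[OF carrier_C small_A] by (simp add: Mod_def)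
  show ?thesis
  proof (rule Mod_equiv_eq_formulasI[OF \<Delta>[OF i] mod])
    fix a b assume a: "a \<in> carrier (C i)" and b: "b \<in> carrier (C i)"
      and eq: "eq_formulas (\<Delta> i) (C i) (G i) a b"
    \<comment> \<open>The lifted equivalence formulas control only coordinate \<open>i\<close>, so
      equality can be concluded only after resetting all other coordinates to the base point. On
      \<open>C i\<close> this resetting is the identity.\<close>
    let ?s = "at i (Var None) (Var (Some 0))" and ?t = "at i (Var None) (Var (Some 1))"
    have ab: "pair a b ` {..<2} \<subseteq> carrier (C i)" using a b by (auto simp: pair_def)
    note fm = subsetD[OF family_Fm[OF i]]
    have "eval A (case_option c (pair a b)) ?s = eval A (case_option c (pair a b)) ?t"
    proof (rule rule_eq[where W = "opt {..<2}" and \<Gamma> = "lift i ` \<Delta> i" and E = "{}"])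
      show "opt {..<2 :: nat} \<lesssim> V" by (rule finite_lepoll_infinite[OF inf_V]) simp
      show "lift i ` \<Delta> i \<subseteq> Fm L (opt {..<2})" using lift_Fm[OF i] fm by blast
      show st: "?s \<in> Fm L (opt {..<2 :: nat})" "?t \<in> Fm L (opt {..<2 :: nat})"
        by (auto intro!: at_Fm Fm.Var)
      show "case_option c (pair a b) ` opt {..<2} \<subseteq> carrier A"
        using subset_trans[OF ab carrier_C] c_A by auto
      show "\<forall>\<gamma>\<in>lift i ` \<Delta> i. eval A (case_option c (pair a b)) \<gamma> \<in> F"
        using eq eval_lift_C[OF i fm ab] by (auto simp: eq_formulas_def G_def)
      fix B H k assume "(B, H) \<in> K" and k: "k ` opt {..<2 :: nat} \<subseteq> carrier B"
        and \<Gamma>: "\<forall>\<gamma>\<in>lift i ` \<Delta> i. eval B k \<gamma> \<in> H"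
      then obtain M where "\<forall>i\<in>I. M i \<in> Mod_equiv (l i)" and B: "B = Prod M"
        and H: "H = (\<Pi>\<^sub>E i\<in>I. snd (M i))" by (elim K_cases)
      then have M: "\<And>i. i \<in> I \<Longrightarrow> M i \<in> Mod_equiv (l i)" by blast
      have "eq_formulas (\<Delta> i) (fst (M i)) (snd (M i)) (k (Some 0) i) (k (Some 1) i)"
        unfolding eq_formulas_def
      proof
        fix \<delta> assume \<delta>: "\<delta> \<in> \<Delta> i"
        then have "eval (Prod M) k (lift i \<delta>) \<in> (\<Pi>\<^sub>E i\<in>I. snd (M i))"
          using \<Gamma> unfolding B H by blast
        then have "eval (Prod M) k (lift i \<delta>) i \<in> snd (M i)" using i by (rule PiE_mem)
        moreover have "eval (fst (M i)) (\<lambda>x. k (Some x) i) \<delta> =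
            eval (fst (M i)) (pair (k (Some 0) i) (k (Some 1) i)) \<delta>"
          by (rule eval_cong[OF fm[OF \<delta>]]) (auto simp: pair_def less_2_cases_iff)
        ultimately show "eval (fst (M i)) (pair (k (Some 0) i) (k (Some 1) i)) \<delta> \<in> snd (M i)"
          using eval_Prod_lift[OF i i fm[OF \<delta>]] by simp
      qed
      moreover have "k (Some m) i \<in> carrier (fst (M i))" if "m < 2" for m
      proof -
        have "k (Some m) \<in> carrier B" using k that by blast
        then show ?thesis unfolding B carrier_Prod using i by (rule PiE_mem)
      qed
      then have "k (Some 0) i \<in> carrier (fst (M i))" "k (Some 1) i \<in> carrier (fst (M i))"
        by simp_all
      ultimately have eq': "k (Some 0) i = k (Some 1) i"
        using factor_eq[OF i M[OF i]] by blast
      show "eval B k ?s = eval B k ?t"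
        unfolding B
      proof (rule eval_Prod_eqI[OF M k[unfolded B] st])
        fix j assume j: "j \<in> I"
        show "eval (Prod M) k ?s j = eval (Prod M) k ?t j"
          unfolding eval_Prod_at[OF j] using eq' by simp
      qed
    qed simp_all
    then show "a = b"
      using p_C[OF a i] p_C[OF b i] by (simp add: eval_at p_def[symmetric] pair_def)
  qed
qed

end

section \<open>Optimality of the product among all logics\<close>

context product_of_logics
begin

text \<open>The terms that the given interpretations assign to one symbol form a family, hence a
  symbol of the product, and this defines the translation. The maps \<open>p i\<close> then present
  the reduct as a subdirect product of reduced models of \<open>l'\<close>.\<close>

lemma prod_greatest:
  assumes l': "is_logic l'" and low: "\<And>i. i \<in> I \<Longrightarrow> interpretable l' (l i)"
  shows "interpretable l' prod"
proof -
  have "\<forall>i\<in>I. \<exists>\<tau>. is_interpretation \<tau> l' (l i)" using low by (simp add: interpretable_def)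
  then obtain \<tau> where \<tau>: "\<And>i. i \<in> I \<Longrightarrow> is_interpretation (\<tau> i) l' (l i)" by metis
  then have trans: "is_translation (\<tau> i) (lang l') (lang (l i))"
    and red: "(A, F) \<in> Mod_equiv (l i) \<Longrightarrow> (reduct (\<tau> i) A, F) \<in> Mod_equiv l'" if "i \<in> I" for i A F
    using that by (auto simp: is_interpretation_def)
  have cons': "is_consequence l'" using l' by (simp add: is_logic_def)
  have pos: "0 < n" if "lang l' f = Some n" for f n
    using l' that by (auto simp: is_logic_def ran_def intro: gr0I)
  have fm: "\<tau> i f \<in> Fm (lang (l i)) {..<n}" if "lang l' f = Some n" "i \<in> I" for f n i
    using trans[OF that(2)] that(1) by (simp add: is_translation_def)
  let ?n = "\<lambda>f. the (lang l' f)"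
  define \<sigma> where "\<sigma> f = App (sym (?n f) (\<lambda>i. \<tau> i f)) (map Var [0..<?n f])" for f
  have "L (sym n (\<lambda>i. \<tau> i f)) = Some n" if "lang l' f = Some n" for f n
    by (rule L_sym[OF pos[OF that] fm[OF that]])
  then have \<sigma>: "is_translation \<sigma> (lang l') L"
    by (auto simp: is_translation_def \<sigma>_def intro!: App_vars_Fm)
  show ?thesis
  proof (rule interpretableI)
    show "is_translation \<sigma> (lang l') (lang prod)" using \<sigma> by (simp add: prod_def)
    fix A F assume AF: "(A, F) \<in> Mod_equiv prod"
    obtain a where a: "a \<in> carrier A" using Mod_equivD(1)[OF AF] by (auto simp: is_alg_def)
    \<comment> \<open>Origin of the base point: some formula of \<open>D\<close> exists, and its
      value at \<open>(a, a)\<close> lies in \<open>F\<close>.\<close>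
    have "eq_formulas D A F a a" using eq_formulas_Mod_equiv[OF defines_Leibniz_prod AF a a] by simp
    moreover have "D \<noteq> {}" using defines_Leibniz_prod by (simp add: defines_Leibniz_def)
    ultimately obtain c where c: "c \<in> F" by (auto simp: eq_formulas_def)
    interpret reduced_product_model U I l \<Delta> code V A F c
      by unfold_locales (use AF c in auto)
    show "(reduct \<sigma> A, F) \<in> Mod_equiv l'"
    proof (rule Mod_equiv_subdirect[OF cons', where I = I and p = p and G = G
          and B = "\<lambda>i. reduct (\<tau> i) (C i)"])
      show "is_alg (lang l') (reduct \<sigma> A)" by (rule is_alg_reduct[OF \<sigma> alg_A])
      show "small U (carrier (reduct \<sigma> A))" using small_A by simp
      show "F = {a \<in> carrier (reduct \<sigma> A). \<forall>i\<in>I. p i a \<in> G i}"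
        using F_A p_mem mem_if_p_mem by (auto simp: G_def)
      show "a = b" if "a \<in> carrier (reduct \<sigma> A)" "b \<in> carrier (reduct \<sigma> A)" "\<forall>i\<in>I. p i a = p i b" for a b
        using p_jointly_inj that by simp
      fix i assume i: "i \<in> I"
      show "(reduct (\<tau> i) (C i), G i) \<in> Mod_equiv l'" by (rule red[OF i factor_model[OF i]])
      show "surj_hom (lang l') (reduct \<sigma> A) (reduct (\<tau> i) (C i)) (p i)"
      proof (rule surj_homI)
        show "p i ` carrier (reduct \<sigma> A) = carrier (reduct (\<tau> i) (C i))" by (simp add: C_def)
        fix f as assume f: "lang l' f = Some (length as)" and as: "as \<in> lists (carrier (reduct \<sigma> A))"
        have "oper (reduct \<sigma> A) f as = oper A (sym (length as) (\<lambda>i. \<tau> i f)) as"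
          using eval_vars[of as "length as" A] f by (simp add: reduct_def \<sigma>_def del: map_map)
        then have "p i (oper (reduct \<sigma> A) f as) = eval (C i) ((!) (map (p i) as)) (\<tau> i f)"
          using p_sym[OF pos[OF f] fm[OF f] _ i] as by simp
        then show "p i (oper (reduct \<sigma> A) f as) = oper (reduct (\<tau> i) (C i)) f (map (p i) as)"
          by (simp add: reduct_def)
      qed
    qed
  qed
qed

end

text \<open>For empty \<open>I\<close> the result is an equivalential logic in which every logic is
  interpretable, a greatest element.\<close>

lemma (in universe) ex_infimum:
  fixes l :: "'i \<Rightarrow> ('u, 'u) logic"
  assumes I: "small U I"
    and l: "\<And>i. i \<in> I \<Longrightarrow> is_logic (l i)" "\<And>i. i \<in> I \<Longrightarrow> equivalential (l i)"
  shows "\<exists>s. is_logic s \<and> equivalential s \<and> (\<forall>i\<in>I. interpretable s (l i)) \<and>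
    (\<forall>l'. is_logic l' \<and> (\<forall>i\<in>I. interpretable l' (l i)) \<longrightarrow> interpretable l' s)"
proof -
  have "\<forall>i\<in>I. \<exists>\<Delta>. defines_Leibniz \<Delta> (l i)" using l equivalential_iff by blast
  then obtain \<Delta> where \<Delta>: "\<And>i. i \<in> I \<Longrightarrow> defines_Leibniz (\<Delta> i) (l i)" by metis
  interpret equivalential_family U I l \<Delta>
    by unfold_locales (use I l \<Delta> in auto)
  have "small U (SIGMA n:{0<..}. \<Pi>\<^sub>E i\<in>I. Fm (lang (l i)) {..<n :: nat})"
    by (intro small_Sigma small_PiE small_I small_Fm small_lang small_subset[OF subset_UNIV small_nat])
  then obtain code :: "nat \<times> ('i \<Rightarrow> ('u, nat) trm) \<Rightarrow> 'u"
    where code: "inj_on code (SIGMA n:{0<..}. \<Pi>\<^sub>E i\<in>I. Fm (lang (l i)) {..<n})"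
    using ex_code by blast
  \<comment> \<open>The range of \<open>e\<close> makes the set of variables infinite even when
    \<open>I\<close> is empty.\<close>
  obtain e :: "nat \<Rightarrow> 'u" where e: "inj e"
    using infinite_universe by (auto simp: infinite_iff_countable_subset)
  let ?V = "range e \<union> (\<Union>i\<in>I. vars (l i))"
  have "small U (\<Union>b\<in>UNIV. if b then range e else (\<Union>i\<in>I. vars (l i)))"
    using l(1) by (intro small_UN small_finite[OF finite])
      (auto simp: is_logic_def intro!: small_image[OF small_nat] small_UN small_I)
  then have V: "small U ?V" by (simp add: UNIV_bool Un_commute)
  have "infinite ?V" using range_inj_infinite[OF e] by simp
  then interpret product_of_logics U I l \<Delta> code ?V
    by unfold_locales (use code V in auto)
  show ?thesis
    using is_logic_prod prod_lower prod_greatest defines_Leibniz_prod equivalential_iff[OF is_logic_prod]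
    by blast
qed


section \<open>The posets\<close>

text \<open>The identity translation returns an algebra that agrees with the original only on the
  language, whence \<open>Mod_equiv_cong\<close>.\<close>

lemma interpretable_refl:
  assumes l: "is_logic l" shows "interpretable l l"
proof (rule interpretableI)
  let ?\<tau> = "\<lambda>f. App f (map Var [0..<the (lang l f)])"
  show "is_translation ?\<tau> (lang l) (lang l)"
    by (auto simp: is_translation_def intro!: App_vars_Fm)
  fix A F assume AF: "(A, F) \<in> Mod_equiv l"
  have "is_consequence l" using l by (simp add: is_logic_def)
  then show "(reduct ?\<tau> A, F) \<in> Mod_equiv l"
    using AF by (rule Mod_equiv_cong) (simp_all add: oper_reduct_App)
qed

lemma interpretable_trans:
  assumes l: "is_logic l" and "interpretable l l'" "interpretable l' l''"
  shows "interpretable l l''"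
proof -
  obtain \<tau> where \<tau>: "is_translation \<tau> (lang l) (lang l')"
    and red: "\<And>A F. (A, F) \<in> Mod_equiv l' \<Longrightarrow> (reduct \<tau> A, F) \<in> Mod_equiv l"
    using assms(2) by (auto simp: interpretable_def is_interpretation_def)
  obtain \<tau>' where \<tau>': "is_translation \<tau>' (lang l') (lang l'')"
    and red': "\<And>A F. (A, F) \<in> Mod_equiv l'' \<Longrightarrow> (reduct \<tau>' A, F) \<in> Mod_equiv l'"
    using assms(3) by (auto simp: interpretable_def is_interpretation_def)
  let ?\<sigma> = "\<lambda>f. translate \<tau>' (\<tau> f)"
  have fm: "\<tau> f \<in> Fm (lang l') {..<n}" if "lang l f = Some n" for f n
    using \<tau> that by (simp add: is_translation_def)
  show ?thesis
  proof (rule interpretableI)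
    show "is_translation ?\<sigma> (lang l) (lang l'')"
      unfolding is_translation_def using translate_Fm[OF \<tau>' fm] by blast
    fix A F assume AF: "(A, F) \<in> Mod_equiv l''"
    have "is_consequence l" using l by (simp add: is_logic_def)
    then show "(reduct ?\<sigma> A, F) \<in> Mod_equiv l"
    proof (rule Mod_equiv_cong[OF _ red[OF red'[OF AF]]])
      show "oper (reduct ?\<sigma> A) f as = oper (reduct \<tau> (reduct \<tau>' A)) f as"
        if "lang l f = Some (length as)" for f as
      proof -
        have "oper (reduct \<tau> (reduct \<tau>' A)) f as = eval (reduct \<tau>' A) ((!) as) (\<tau> f)"
          by (simp add: reduct_def[of \<tau>])
        also have "\<dots> = eval A ((!) as) (translate \<tau>' (\<tau> f))"
          by (rule eval_reduct[OF \<tau>' fm[OF that]])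
        finally show ?thesis by (simp add: reduct_def)
      qed
    qed simp
  qed
qed

abbreviation cls :: "('u, 'u) logic \<Rightarrow> ('u, 'u) logic set" where
  "cls l \<equiv> equi_interpretable `` {l}"

lemma cls_eq:
  assumes "is_logic l" "is_logic l'"
  shows "cls l = cls l' \<longleftrightarrow> interpretable l l' \<and> interpretable l' l"
proof
  assume "cls l = cls l'"
  moreover have "l' \<in> cls l'" using assms interpretable_refl by (auto simp: equi_interpretable_def)
  ultimately have "l' \<in> cls l" by simp
  then show "interpretable l l' \<and> interpretable l' l" by (simp add: equi_interpretable_def)
next
  assume "interpretable l l' \<and> interpretable l' l"
  then have "l'' \<in> cls l \<longleftrightarrow> l'' \<in> cls l'" for l''
    using assms interpretable_trans unfolding equi_interpretable_def by blast
  then show "cls l = cls l'" by blast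
qed

text \<open>The order on classes asks for some representatives; by transitivity any others do as
  well.\<close>

lemma le_Log_cls:
  assumes "is_logic l" "is_logic l'"
  shows "le Log (cls l) (cls l') \<longleftrightarrow> interpretable l l'"
proof
  assume "le Log (cls l) (cls l')"
  then obtain k k' where "(l, k) \<in> equi_interpretable" "(l', k') \<in> equi_interpretable" "interpretable k k'"
    by (auto simp: Log_def)
  then have "interpretable l k" "interpretable k k'" "interpretable k' l'" "is_logic k"
    by (auto simp: equi_interpretable_def)
  then show "interpretable l l'" using interpretable_trans assms by blast
next
  assume "interpretable l l'"
  moreover have "l \<in> cls l" "l' \<in> cls l'"
    using assms interpretable_refl by (auto simp: equi_interpretable_def)
  ultimately show "le Log (cls l) (cls l')" unfolding Log_def by auto
qed

lemma carrier_Log: "carrier Log = cls ` {l. is_logic l}"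
  by (auto simp: Log_def quotient_def)

lemma carrier_Equiv: "carrier Equiv = cls ` {l. is_logic l \<and> equivalential l}"
  by (auto simp: Equiv_def quotient_def)

lemma Equiv_subset_Log: "carrier Equiv \<subseteq> carrier Log"
  by (auto simp: carrier_Equiv carrier_Log)

lemma partial_order_Log: "partial_order Log"
proof -
  have eq: "eq Log = (=)" by (simp add: Log_def)
  show ?thesis
  proof (unfold_locales, unfold eq)
    fix x y z assume "le Log x y" "le Log y z" "x \<in> carrier Log" "y \<in> carrier Log" "z \<in> carrier Log"
    then obtain k l m where "is_logic k" "is_logic l" "is_logic m" "x = cls k" "y = cls l" "z = cls m"
      and "le Log (cls k) (cls l)" "le Log (cls l) (cls m)"
      unfolding carrier_Log by blast
    then show "le Log x z"
      using interpretable_trans[of k l m] by (simp add: le_Log_cls)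
  next
    fix x y assume "le Log x y" "le Log y x" "x \<in> carrier Log" "y \<in> carrier Log"
    then obtain k l where "is_logic k" "is_logic l" "x = cls k" "y = cls l"
      and "le Log (cls k) (cls l)" "le Log (cls l) (cls k)"
      unfolding carrier_Log by blast
    then show "x = y" using cls_eq[of k l] by (simp add: le_Log_cls)
  next
    fix x assume "x \<in> carrier Log"
    then show "le Log x x"
      unfolding carrier_Log using le_Log_cls interpretable_refl by auto
  qed auto
qed

section \<open>Bounds in a subposet\<close>

lemma partial_order_subset:
  assumes "partial_order P" "Y \<subseteq> carrier P"
  shows "partial_order (P\<lparr>carrier := Y\<rparr>)"
proof -
  interpret partial_order P by fact
  interpret sub: weak_partial_order "P\<lparr>carrier := Y\<rparr>"
    by (rule weak_partial_order_subset[OF weak_partial_order_axioms assms(2)])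
  show ?thesis by unfold_locales (simp add: eq_is_equal)
qed

text \<open>A greatest lower bound taken in the large poset stays one in any subposet that contains
  it. Uniqueness in both posets then settles every candidate \<open>t\<close>.\<close>

lemma glb_subposet:
  assumes P: "partial_order P" and Y: "Y \<subseteq> carrier P" and X: "X \<subseteq> Y"
    and s: "is_glb P s X" "s \<in> Y"
  shows "is_glb (P\<lparr>carrier := Y\<rparr>) t X \<longleftrightarrow> is_glb P t X"
proof -
  have "X \<inter> carrier P = X" "X \<inter> Y = X" using X Y by blast+
  then have "Lower (P\<lparr>carrier := Y\<rparr>) X = Lower P X \<inter> Y"
    using Y by (auto simp: Lower_def)
  then have "is_glb (P\<lparr>carrier := Y\<rparr>) s X"
    using s by (simp add: greatest_def)
  then show ?thesis
    using partial_order.greatest_unique[OF P s(1)]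
      partial_order.greatest_unique[OF partial_order_subset[OF P Y]] s(1) by metis
qed

lemma lub_subposet:
  assumes P: "partial_order P" and Y: "Y \<subseteq> carrier P" and X: "X \<subseteq> Y"
    and s: "is_lub P s X" "s \<in> Y"
  shows "is_lub (P\<lparr>carrier := Y\<rparr>) t X \<longleftrightarrow> is_lub P t X"
proof -
  have "X \<inter> carrier P = X" "X \<inter> Y = X" using X Y by blast+
  then have "Upper (P\<lparr>carrier := Y\<rparr>) X = Upper P X \<inter> Y"
    using Y by (auto simp: Upper_def)
  then have "is_lub (P\<lparr>carrier := Y\<rparr>) s X"
    using s by (simp add: least_def)
  then show ?thesis
    using partial_order.least_unique[OF P s(1)]
      partial_order.least_unique[OF partial_order_subset[OF P Y]] s(1) by metis
qed

lemma Equiv_eq: "Log\<lparr>carrier := carrier Equiv\<rparr> = Equiv"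
  by (simp add: Equiv_def)

section \<open>Bounds of small sets of classes\<close>

context universe
begin

text \<open>Membership in \<open>Equiv\<close> provides one equivalential logic in the class. One is
  chosen for each class, and \<open>X\<close> itself becomes the index set of the family.\<close>

lemma representatives:
  fixes X :: "('u, 'u) logic set set"
  assumes "X \<subseteq> carrier Equiv"
  obtains r where "\<And>C. C \<in> X \<Longrightarrow> is_logic (r C)" "\<And>C. C \<in> X \<Longrightarrow> equivalential (r C)"
    "\<And>C. C \<in> X \<Longrightarrow> cls (r C) = C"
proof -
  have "\<forall>C\<in>X. \<exists>l. is_logic l \<and> equivalential l \<and> cls l = C"
    using assms by (auto simp: carrier_Equiv)
  then show thesis using that by metis
qed

text \<open>The bound is obtained in \<open>Log\<close> at once, since \<open>ex_infimum\<close>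
  competes with all logics; that it lies in \<open>Equiv\<close> lets \<open>glb_subposet\<close>
  transfer it.\<close>

lemma ex_glb_Log:
  fixes X :: "('u, 'u) logic set set"
  assumes X: "X \<subseteq> carrier Equiv" "small U X"
  shows "\<exists>s\<in>carrier Equiv. is_glb Log s X"
proof -
  obtain r where r: "\<And>C. C \<in> X \<Longrightarrow> is_logic (r C)" "\<And>C. C \<in> X \<Longrightarrow> equivalential (r C)"
    "\<And>C. C \<in> X \<Longrightarrow> cls (r C) = C" using X(1) by (rule representatives) blast
  obtain s where s: "is_logic s" "equivalential s" and lower: "\<forall>C\<in>X. interpretable s (r C)"
    and greatest: "\<forall>l. is_logic l \<and> (\<forall>C\<in>X. interpretable l (r C)) \<longrightarrow> interpretable l s"
    using ex_infimum[where l = r and I = X, OF X(2) r(1,2)] by blast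
  have le: "le Log (cls l) C \<longleftrightarrow> interpretable l (r C)" if "is_logic l" "C \<in> X" for l C
    using le_Log_cls[OF that(1) r(1)[OF that(2)]] r(3)[OF that(2)] by simp
  have "is_glb Log (cls s) X"
    unfolding greatest_def
  proof (intro conjI ballI)
    show "cls s \<in> Lower Log X"
      using s lower le by (intro Lower_memI) (auto simp: carrier_Log)
    fix D assume D: "D \<in> Lower Log X"
    then obtain l where l: "is_logic l" "D = cls l"
      using Lower_closed[of Log X] by (auto simp: carrier_Log)
    have "interpretable l (r C)" if "C \<in> X" for C
      using D le[OF l(1) that] that X(1) Equiv_subset_Log unfolding l(2) by (auto simp: Lower_def)
    then show "le Log D (cls s)" using greatest l le_Log_cls[OF l(1) s(1)] by blast
  qed (rule Lower_closed)
  moreover have "cls s \<in> carrier Equiv" using s by (auto simp: carrier_Equiv)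
  ultimately show ?thesis by blast
qed

lemma ex_lub_Log:
  fixes X :: "('u, 'u) logic set set"
  assumes X: "X \<subseteq> carrier Equiv" "small U X" "X \<noteq> {}"
  shows "\<exists>s\<in>carrier Equiv. is_lub Log s X"
proof -
  obtain r where r: "\<And>C. C \<in> X \<Longrightarrow> is_logic (r C)" "\<And>C. C \<in> X \<Longrightarrow> equivalential (r C)"
    "\<And>C. C \<in> X \<Longrightarrow> cls (r C) = C" using X(1) by (rule representatives) blast
  obtain s where s: "is_logic s" "equivalential s" and upper: "\<forall>C\<in>X. interpretable (r C) s"
    and least: "\<forall>l. is_logic l \<and> (\<forall>C\<in>X. interpretable (r C) l) \<longrightarrow> interpretable s l"
    using ex_supremum[where l = r and I = X, OF X(2,3) r(1,2)] by blast
  have le: "le Log C (cls l) \<longleftrightarrow> interpretable (r C) l" if "is_logic l" "C \<in> X" for l C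
    using le_Log_cls[OF r(1)[OF that(2)] that(1)] r(3)[OF that(2)] by simp
  have "is_lub Log (cls s) X"
    unfolding least_def
  proof (intro conjI ballI)
    show "cls s \<in> Upper Log X"
      using s upper le by (intro Upper_memI) (auto simp: carrier_Log)
    fix D assume D: "D \<in> Upper Log X"
    then obtain l where l: "is_logic l" "D = cls l"
      using Upper_closed[of Log X] by (auto simp: carrier_Log)
    have "interpretable (r C) l" if "C \<in> X" for C
      using D le[OF l(1) that] that X(1) Equiv_subset_Log unfolding l(2) by (auto simp: Upper_def)
    then show "le Log (cls s) D" using least l le_Log_cls[OF s(1) l(1)] by blast
  qed (rule Upper_closed)
  moreover have "cls s \<in> carrier Equiv" using s by (auto simp: carrier_Equiv)
  ultimately show ?thesis by blast
qed

lemma glb_Equiv: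
  fixes X :: "('u, 'u) logic set set"
  assumes X: "X \<subseteq> carrier Equiv" "small U X"
  shows "\<exists>s. is_glb Equiv s X" and "is_glb Equiv s X \<longleftrightarrow> is_glb Log s X"
proof -
  obtain t where t: "t \<in> carrier Equiv" "is_glb Log t X" using ex_glb_Log[OF X] by blast
  note sub = glb_subposet[OF partial_order_Log Equiv_subset_Log X(1) t(2,1), unfolded Equiv_eq]
  show "\<exists>s. is_glb Equiv s X" and "is_glb Equiv s X \<longleftrightarrow> is_glb Log s X" using t sub by auto
qed

lemma lub_Equiv:
  fixes X :: "('u, 'u) logic set set"
  assumes X: "X \<subseteq> carrier Equiv" "small U X" "X \<noteq> {}"
  shows "\<exists>s. is_lub Equiv s X" and "is_lub Equiv s X \<longleftrightarrow> is_lub Log s X"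
proof -
  obtain t where t: "t \<in> carrier Equiv" "is_lub Log t X" using ex_lub_Log[OF X] by blast
  note sub = lub_subposet[OF partial_order_Log Equiv_subset_Log X(1) t(2,1), unfolded Equiv_eq]
  show "\<exists>s. is_lub Equiv s X" and "is_lub Equiv s X \<longleftrightarrow> is_lub Log s X" using t sub by auto
qed

text \<open>The two-element sets of the lattice axioms are finite and so small.\<close>

lemma lattice_Equiv: "lattice (Equiv :: ('u, 'u) logic set gorder)"
proof -
  interpret partial_order "Equiv :: ('u, 'u) logic set gorder"
    using partial_order_subset[OF partial_order_Log Equiv_subset_Log] by (simp only: Equiv_eq)
  show ?thesis
    by unfold_locales (auto intro!: glb_Equiv(1) lub_Equiv(1) small_finite)
qed

end

theorem theorem6p5:
  assumes "inaccessible TYPE('u)"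
  shows "lattice (Equiv :: ('u, 'u) logic set gorder) \<and>
    (\<forall>X \<subseteq> carrier (Equiv :: ('u, 'u) logic set gorder). X \<prec> (UNIV :: 'u set) \<longrightarrow>
      (\<exists>s. is_glb Equiv s X) \<and>
      (\<forall>s. is_glb Equiv s X \<longleftrightarrow> is_glb Log s X) \<and>
      (X \<noteq> {} \<longrightarrow>
        (\<exists>s. is_lub Equiv s X) \<and>
        (\<forall>s. is_lub Equiv s X \<longleftrightarrow> is_lub Log s X)))"
proof -
  interpret universe "TYPE('u)" by unfold_locales (rule assms)
  show ?thesis
    using lattice_Equiv glb_Equiv lub_Equiv by blast
qed

end
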